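(* Let $n\ge3$. Let $U\subset\mathcal{S}^{n\times n}$ be an open set satisfying (a) $O^{-1}UO=U$ for all $O\in O(n)$, and (b) $U\cap\{M+tN:0<t<\infty\}$ is convex for all $M\in\mathcal{S}^{n\times n}$, $N\in\mathcal{S}^{n\times n}_+$. Let $F\in C^1(U)$ satisfy (c) $F(O^{-1}MO)=F(M)$ for all $M\in U$, $O\in O(n)$, and (d) the matrix $(F_{ij}(M))$ is positive definite for all $M\in U$. Assume that $u\in C^2(\mathbb{R}^n)$ is a superharmonic solution of $$F(A^u)=u^{p-\frac{n+2}{n-2}},\quad A^u\in U,\quad u>0\quad\text{on }\mathbb{R}^n$$ for some $-\infty<p\le\frac{n+2}{n-2}$. Then either $u\equiv$ constant, or $p=\frac{n+2}{n-2}$ and, for some $\bar x\in\mathbb{R}^n$ and some positive constants $a$ and $b$ satisfying $2b^2a^{-2}I\in U$ and $F(2b^2a^{-2}I)=1$, $$u(x)\equiv\Big(\frac{a}{1+b^2|x-\bar x|^2}\Big)^{\frac{n-2}{2}}\quad\forall\,x\in\mathbb{R}^n.$$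
   Context: $\mathcal{S}^{n\times n}$ is the set of $n\times n$ real symmetric matrices, $\mathcal{S}^{n\times n}_+$ the subset of positive definite ones, $O(n)$ the set of $n\times n$ real orthogonal matrices. $F_{ij}(M):=\frac{\partial F}{\partial M_{ij}}(M)$. Superharmonic means $\Delta u\le0$. For a positive $C^2$ function $u$ on a subset of $\mathbb{R}^n$, $$A^u:=-\frac{2}{n-2}u^{-\frac{n+2}{n-2}}\nabla^2u+\frac{2n}{(n-2)^2}u^{-\frac{2n}{n-2}}\nabla u\otimes\nabla u-\frac{2}{(n-2)^2}u^{-\frac{2n}{n-2}}|\nabla u|^2I,$$ where $I$ is the $n\times n$ identity matrix. *)

theory Defs
  imports "HOL-Analysis.Analysis"
begin

definition symmetric_mats :: "(real^'n^'n) set" where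
  "symmetric_mats = {M. transpose M = M}"

definition posdef_mats :: "(real^'n^'n) set" where
  "posdef_mats = {M. M \<in> symmetric_mats \<and> (\<forall>x. x \<noteq> 0 \<longrightarrow> 0 < x \<bullet> (M *v x))}"

definition dir_deriv :: "('a::real_normed_vector \<Rightarrow> real) \<Rightarrow> 'a \<Rightarrow> 'a \<Rightarrow> real" where
  "dir_deriv f v x = deriv (\<lambda>t. f (x + t *\<^sub>R v)) 0"

subsection \<open>Functions of a symmetric matrix\<close>

text \<open>The symmetric part \<open>(e\<^sub>i e\<^sub>j\<^sup>T + e\<^sub>j e\<^sub>i\<^sup>T) / 2\<close> of the matrix unit at \<open>(i, j)\<close>.\<close>

definition sym_unit :: "'n \<Rightarrow> 'n \<Rightarrow> real^'n^'n" where
  "sym_unit i j = (\<chi> k l. ((if k = i \<and> l = j then 1 else 0) + (if k = j \<and> l = i then 1 else 0)) / 2)"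

text \<open>The matrix of partial derivatives \<open>F\<^sub>i\<^sub>j = \<partial>F / \<partial>M\<^sub>i\<^sub>j\<close> of a function given on
  symmetric matrices only. With the factor 1/2 in \<^const>\<open>sym_unit\<close> it is the symmetric matrix with
  \<open>dF(M)(H) = (\<Sum>i j. F\<^sub>i\<^sub>j(M) H\<^sub>i\<^sub>j)\<close> for symmetric \<open>H\<close>. At points of a relatively
  open \<open>U \<subseteq> symmetric_mats\<close> it depends only on the values of \<open>F\<close> on \<open>U\<close>.\<close>

definition mat_partials :: "(real^'n^'n \<Rightarrow> real) \<Rightarrow> real^'n^'n \<Rightarrow> real^'n^'n" where
  "mat_partials F M = (\<chi> i j. dir_deriv F (sym_unit i j) M)"

text \<open>\<open>F \<in> C\<^sup>1(U)\<close> for \<open>U\<close> relatively open in \<^const>\<open>symmetric_mats\<close>; differentiability is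
  relative to \<open>U\<close>.\<close>

definition C1_on_sym :: "(real^'n^'n) set \<Rightarrow> (real^'n^'n \<Rightarrow> real) \<Rightarrow> bool" where
  "C1_on_sym U F \<longleftrightarrow> F differentiable_on U \<and> continuous_on U (mat_partials F)"

subsection \<open>Functions on Euclidean space\<close>

definition partial :: "'n \<Rightarrow> (real^'n \<Rightarrow> real) \<Rightarrow> real^'n \<Rightarrow> real" where
  "partial i f = dir_deriv f (axis i 1)"

definition C2 :: "(real^'n \<Rightarrow> real) \<Rightarrow> bool" where
  "C2 u \<longleftrightarrow> (\<forall>x. u differentiable (at x)) \<and>
     (\<forall>i x. partial i u differentiable (at x)) \<and>
     (\<forall>i j. continuous_on UNIV (partial i (partial j u)))"

definition gradient :: "(real^'n \<Rightarrow> real) \<Rightarrow> real^'n \<Rightarrow> real^'n" where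
  "gradient u x = (\<chi> i. partial i u x)"

definition hessian :: "(real^'n \<Rightarrow> real) \<Rightarrow> real^'n \<Rightarrow> real^'n^'n" where
  "hessian u x = (\<chi> i j. partial i (partial j u) x)"

definition laplacian :: "(real^'n \<Rightarrow> real) \<Rightarrow> real^'n \<Rightarrow> real" where
  "laplacian u x = (\<Sum>i\<in>UNIV. partial i (partial i u) x)"

definition superharmonic :: "(real^'n \<Rightarrow> real) \<Rightarrow> bool" where
  "superharmonic u \<longleftrightarrow> (\<forall>x. laplacian u x \<le> 0)"

definition tensor :: "real^'n \<Rightarrow> real^'n \<Rightarrow> real^'n^'n" where
  "tensor v w = (\<chi> i j. v $ i * w $ j)"

definition conformal_hessian :: "(real^'n \<Rightarrow> real) \<Rightarrow> real^'n \<Rightarrow> real^'n^'n" where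
  "conformal_hessian u x = (let n = real CARD('n) in
     (- (2 / (n - 2)) * u x powr (- ((n + 2) / (n - 2)))) *\<^sub>R hessian u x
     + (2 * n / (n - 2)\<^sup>2 * u x powr (- (2 * n / (n - 2)))) *\<^sub>R tensor (gradient u x) (gradient u x)
     - (2 / (n - 2)\<^sup>2 * u x powr (- (2 * n / (n - 2))) * (norm (gradient u x))\<^sup>2) *\<^sub>R mat 1)"

end

theory Submission
  imports Defs
begin

text \<open>
  Put \<open>v = u\<^bsup>-2/(n-2)\<^esup>\<close>. Then \<open>A\<^sup>u = v \<nabla>\<^sup>2v - |\<nabla>v|\<^sup>2/2 I\<close> (here
  \<open>schouten\<close>), the equation reads \<open>F(A\<^sup>u) = v\<^sup>q\<close> with \<open>q = (n-2)/2 ((n+2)/(n-2) - p) \<ge> 0\<close>, and the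
  asserted nonconstant solutions are exactly \<open>v(x) = \<beta> |x - xbar|\<^sup>2 + d\<close>. The aim is therefore to show that \<open>v\<close> is
  constant or a quadratic polynomial of this shape.

  The argument is the method of moving spheres. Let
  \<open>v\<^sub>x\<^sub>,\<^sub>l(y) = |y-x|\<^sup>2/l\<^sup>2 v(x + l\<^sup>2 (y-x)/|y-x|\<^sup>2)\<close> be the Kelvin transform in the sphere of radius \<open>l\<close>
  about \<open>x\<close>. Conformal invariance (\<open>schouten_kelvin\<close>) says that inversion only conjugates the matrix by
  a reflection; because \<open>q \<ge> 0\<close>, the Kelvin transform is then a supersolution outside the sphere
  (\<open>kelvin_supersolution\<close>). For small \<open>l\<close> one has \<open>v \<le> v\<^sub>x\<^sub>,\<^sub>l\<close> outside the sphere
  (\<open>moving_sphere_start\<close>). When \<open>l\<close> grows, a first contact at a finite point, or a first vanishing normal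
  derivative on the sphere, is excluded by a boundary point lemma of Hopf type
  (\<open>boundary_point_lemma\<close>, \<open>no_touching\<close>). So the inequality can only be lost at infinity. Let \<open>\<beta>\<close> be the
  infimum of all \<open>b\<close> with \<open>v(y) \<le> b |y|\<^sup>2\<close> for large \<open>y\<close>; it is finite because \<open>u\<close> is positive and
  superharmonic. Since \<open>v\<^sub>x\<^sub>,\<^sub>l(y)/|y|\<^sup>2 \<rightarrow> v(x)/l\<^sup>2\<close>, the inequality \<open>v \<le> v\<^sub>x\<^sub>,\<^sub>l\<close> holds for
  every \<open>l\<close> with \<open>l\<^sup>2 \<beta> < v(x)\<close> (\<open>moving_sphere\<close>, \<open>sphere_inequality\<close>).

  If \<open>\<beta> = 0\<close>, all radii about all centres are available, and comparing two points from a centre that recedes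
  to infinity shows that \<open>v\<close> is constant (\<open>constant_if_all_spheres\<close>). If \<open>\<beta> > 0\<close>, the critical
  radius \<open>l\<^sup>2 = v(x)/\<beta>\<close> is reached, and expanding \<open>v\<^sub>x\<^sub>,\<^sub>l\<close> at infinity gives, for every centre \<open>x\<close>,
  \<open>v(y) \<le> \<beta> |y|\<^sup>2 + (\<nabla>v(x) - 2 \<beta> x) \<cdot> y + o(|y|)\<close>.
  If the vector \<open>\<nabla>v(x) - 2 \<beta> x\<close> depended on \<open>x\<close>, two of these bounds together would put \<open>v\<close> below
  \<open>\<beta> |y|\<^sup>2 - |g \<cdot> y| + o(|y|)\<close> about a suitable origin, for some \<open>g \<noteq> 0\<close>. On a large sphere \<open>u\<close> would
  then exceed \<open>\<beta>\<^bsup>-(n-2)/2\<^esup> |y|\<^bsup>2-n\<^esup>\<close> on average, and comparing the superharmonic function \<open>u\<close> outside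
  that sphere with a harmonic function vanishing at infinity would give a growth rate below \<open>\<beta>\<close>
  (\<open>growth_improvement\<close>), a contradiction. Hence \<open>\<nabla>v(x) - 2 \<beta> x\<close> is constant, which makes \<open>v\<close>
  the quadratic polynomial that was sought; as its matrix is constant, the equation forces \<open>q = 0\<close>.
\<close>

section \<open>Symmetric matrices\<close>

lemma mat_inner: "(A::real^'n^'n) \<bullet> B = (\<Sum>i\<in>UNIV. \<Sum>j\<in>UNIV. A$i$j * B$i$j)"
  by (simp add: inner_vec_def)

lemma inner_tensor: "(A::real^'n^'n) \<bullet> tensor x y = x \<bullet> (A *v y)"
  by (simp add: mat_inner tensor_def matrix_vector_mult_def inner_vec_def sum_distrib_left algebra_simps)

lemma tensor_mult_vec: "tensor x y *v h = (y \<bullet> h) *\<^sub>R (x::real^'n)"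
  by (simp add: tensor_def matrix_vector_mult_def inner_vec_def vec_eq_iff sum_distrib_left
      sum_distrib_right algebra_simps)

lemma symmetric_mats_iff: "M \<in> symmetric_mats \<longleftrightarrow> (\<forall>i j. M$i$j = M$j$i)"
  by (auto simp: symmetric_mats_def transpose_def vec_eq_iff)

lemma symmetric_mats_combine:
  assumes "A \<in> symmetric_mats" "B \<in> symmetric_mats"
  shows "a *\<^sub>R A + b *\<^sub>R B \<in> symmetric_mats"
  using assms by (auto simp: symmetric_mats_iff)

lemma symmetric_mats_simps:
  "mat 1 \<in> symmetric_mats"
  "A \<in> symmetric_mats \<Longrightarrow> B \<in> symmetric_mats \<Longrightarrow> A + B \<in> symmetric_mats"
  "A \<in> symmetric_mats \<Longrightarrow> B \<in> symmetric_mats \<Longrightarrow> A - B \<in> symmetric_mats"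
  "A \<in> symmetric_mats \<Longrightarrow> c *\<^sub>R A \<in> symmetric_mats"
  "tensor x x \<in> symmetric_mats"
  by (auto simp: symmetric_mats_iff mat_def tensor_def)

lemma symmetric_mat_inner:
  assumes "A \<in> symmetric_mats"
  shows "x \<bullet> (A *v y) = y \<bullet> (A *v x)"
proof -
  have "x \<bullet> (A *v y) = (\<Sum>i\<in>UNIV. \<Sum>j\<in>UNIV. x$i * (A$i$j * y$j))"
    by (simp add: matrix_vector_mult_def inner_vec_def sum_distrib_left)
  also have "\<dots> = (\<Sum>j\<in>UNIV. \<Sum>i\<in>UNIV. x$i * (A$i$j * y$j))"
    by (rule sum.swap)
  also have "\<dots> = (\<Sum>j\<in>UNIV. \<Sum>i\<in>UNIV. y$j * (A$j$i * x$i))"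
    using assms by (intro sum.cong) (auto simp: symmetric_mats_iff)
  also have "\<dots> = y \<bullet> (A *v x)"
    by (simp add: matrix_vector_mult_def inner_vec_def sum_distrib_left)
  finally show ?thesis .
qed

definition psd_mats :: "(real^'n^'n) set" where
  "psd_mats = {P. P \<in> symmetric_mats \<and> (\<forall>x. 0 \<le> x \<bullet> (P *v x))}"

lemma posdef_imp_psd:
  assumes "A \<in> posdef_mats"
  shows "A \<in> psd_mats"
proof -
  have "0 \<le> x \<bullet> (A *v x)" for x
    using assms by (cases "x = 0") (auto simp: posdef_mats_def less_imp_le)
  then show ?thesis using assms by (simp add: posdef_mats_def psd_mats_def)
qed

lemma axis_quadratic: "axis i 1 \<bullet> ((P::real^'n^'n) *v axis j 1) = P $ i $ j"
  by (simp add: inner_axis' matrix_vector_mult_basis column_def)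

text \<open>Otherwise the quadratic form would be a nonconstant affine function of \<open>t\<close> on the line
  \<open>e\<^sub>i + t e\<^sub>k\<close>, and hence negative somewhere.\<close>

lemma psd_zero_diagonal:
  fixes P :: "real^'n^'n"
  assumes P: "P \<in> psd_mats" and z: "P$k$k = 0"
  shows "P$i$k = 0"
proof (rule ccontr)
  assume nz: "P$i$k \<noteq> 0"
  have sym: "P \<in> symmetric_mats" and nn: "\<And>x. 0 \<le> x \<bullet> (P *v x)"
    using P by (auto simp: psd_mats_def)
  \<comment> \<open>chosen to make the form equal to \<open>-1\<close>\<close>
  define t where "t = - (P$i$i + 1) / (2 * P$i$k)"
  let ?x = "axis i 1 + t *\<^sub>R axis k 1 :: real^'n"
  have "?x \<bullet> (P *v ?x) = P$i$i + t * P$i$k + t * P$k$i + t * t * P$k$k"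
    by (simp add: matrix_vector_right_distrib matrix_vector_mult_scaleR inner_add_left inner_add_right
        axis_quadratic algebra_simps)
  also have "\<dots> = P$i$i + 2 * t * P$i$k"
    using sym z by (simp add: symmetric_mats_iff)
  also have "\<dots> = -1"
    using nz by (simp add: t_def field_simps)
  finally show False using nn[of ?x] by simp
qed

text \<open>Gaussian elimination
  on \<open>P\<close> takes the place of diagonalisation: with \<open>w\<close> the \<open>k\<close>-th column, subtracting
  \<open>w w\<^sup>T / P\<^sub>k\<^sub>k\<close> clears the \<open>k\<close>-th row and keeps \<open>P\<close> positive semidefinite, and the rank one term
  split off contributes \<open>w\<^sup>T A w / P\<^sub>k\<^sub>k \<ge> 0\<close>. The set \<open>S\<close> contains the rows that are not cleared yet.\<close>

lemma psd_inner_nonneg_supported: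
  fixes A P :: "real^'n^'n"
  assumes "finite S" and A: "A \<in> psd_mats"
  shows "P \<in> psd_mats \<Longrightarrow> (\<And>i j. i \<notin> S \<Longrightarrow> P$i$j = 0) \<Longrightarrow> 0 \<le> A \<bullet> P"
  using assms(1)
proof (induction S arbitrary: P rule: finite_induct)
  case empty
  then show ?case by (simp add: mat_inner)
next
  case (insert k S)
  have sym: "P \<in> symmetric_mats" and nn: "\<And>x. 0 \<le> x \<bullet> (P *v x)"
    using insert.prems by (auto simp: psd_mats_def)
  show ?case
  proof (cases "P$k$k = 0")
    case True
    have "P$i$j = 0" if "i \<notin> S" for i j
      using psd_zero_diagonal[OF insert.prems(1) True, of j] insert.prems(2)[of i j] sym that
      by (cases "i = k") (auto simp: symmetric_mats_iff)
    then show ?thesis using insert.IH insert.prems(1) by blast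
  next
    case False
    define w where "w = P *v axis k 1"
    define d where "d = P$k$k"
    have "0 \<le> axis k 1 \<bullet> (P *v axis k 1)" by (rule nn)
    then have d: "d > 0" using False by (simp add: axis_quadratic d_def)
    have w: "w$i = P$i$k" for i
      by (simp add: w_def matrix_vector_mult_basis column_def)
    define Q where "Q = P - (1/d) *\<^sub>R tensor w w"
    have Qnn: "0 \<le> x \<bullet> (Q *v x)" for x
    proof -
      \<comment> \<open>completing the square: \<open>?y\<close> minimises the form of \<open>P\<close> on the line through \<open>x\<close> along \<open>e\<^sub>k\<close>\<close>
      let ?y = "x - ((w \<bullet> x) / d) *\<^sub>R axis k 1"
      have *: "x \<bullet> (P *v axis k 1) = w \<bullet> x" "axis k 1 \<bullet> (P *v x) = w \<bullet> x"
        using symmetric_mat_inner[OF sym, of x "axis k 1"] by (auto simp: w_def inner_commute)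
      have "?y \<bullet> (P *v ?y) = x \<bullet> (P *v x) - 2 * ((w \<bullet> x) / d) * (w \<bullet> x)
          + ((w \<bullet> x) / d) * ((w \<bullet> x) / d) * d"
        by (simp add: matrix_vector_mult_diff_distrib matrix_vector_mult_scaleR inner_diff_left
            inner_diff_right axis_quadratic * d_def algebra_simps)
      also have "\<dots> = x \<bullet> (P *v x) - (w \<bullet> x) * (w \<bullet> x) / d"
        using d by (simp add: field_simps)
      also have "\<dots> = x \<bullet> (Q *v x)"
        by (simp add: Q_def matrix_vector_mult_diff_rdistrib inner_diff_right tensor_mult_vec inner_commute
            flip: scaleR_matrix_vector_assoc)
      finally show ?thesis using nn[of ?y] by simp
    qed
    have Q: "Q \<in> psd_mats"
      using Qnn sym by (auto simp: psd_mats_def Q_def intro!: symmetric_mats_simps)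
    have "Q$i$j = 0" if "i \<notin> S" for i j
    proof (cases "i = k")
      case True
      then show ?thesis using d sym by (simp add: Q_def tensor_def w d_def symmetric_mats_iff)
    next
      case False
      then show ?thesis using insert.prems(2)[of i] that by (simp add: Q_def tensor_def w)
    qed
    then have "0 \<le> A \<bullet> Q" using insert.IH Q by blast
    moreover have "A \<bullet> P = A \<bullet> Q + (1/d) * (w \<bullet> (A *v w))"
      by (simp add: Q_def inner_diff_right inner_tensor)
    ultimately show ?thesis using d A by (auto simp: psd_mats_def)
  qed
qed

lemma psd_inner_nonneg:
  "A \<in> psd_mats \<Longrightarrow> P \<in> psd_mats \<Longrightarrow> 0 \<le> A \<bullet> (P::real^'n^'n)"
  using psd_inner_nonneg_supported[of UNIV A P] by simp

text \<open>The convexity hypothesis speaks of positive definite directions, while at a point of contact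
  the difference of the two matrices is only semidefinite. As \<open>U\<close> is open, both endpoints can be pushed apart by small
  multiples of the identity, which makes the difference definite; the two amounts are balanced so
  that the point with parameter \<open>\<theta>\<close> stays where it is.\<close>

lemma segment_in_domain:
  fixes U :: "(real^'n^'n) set"
  assumes U_open: "openin (top_of_set symmetric_mats) U"
    and U_conv: "\<And>M N. M \<in> symmetric_mats \<Longrightarrow> N \<in> posdef_mats \<Longrightarrow>
        convex (U \<inter> {M + t *\<^sub>R N | t. 0 < t})"
    and P: "P \<in> U" and Q: "Q \<in> U" and PQ: "Q - P \<in> psd_mats" and th: "0 \<le> \<theta>" "\<theta> \<le> 1"
  shows "(1-\<theta>) *\<^sub>R P + \<theta> *\<^sub>R Q \<in> U"
proof -
  obtain T where T: "open T" "U = symmetric_mats \<inter> T"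
    using U_open by (auto simp: openin_open)
  have near: "\<exists>d>0. \<forall>s. \<bar>s\<bar> \<le> d \<longrightarrow> X + s *\<^sub>R mat 1 \<in> U" if X: "X \<in> U" for X
  proof -
    have "((\<lambda>s::real. X + s *\<^sub>R mat 1) \<longlongrightarrow> X + 0 *\<^sub>R mat 1) (at 0)"
      by (intro tendsto_intros)
    then have "eventually (\<lambda>s. X + s *\<^sub>R mat 1 \<in> T) (at 0)"
      using T X topological_tendstoD by fastforce
    then obtain d where d: "d > 0" "\<And>s. s \<noteq> 0 \<Longrightarrow> dist s 0 < d \<Longrightarrow> X + s *\<^sub>R mat 1 \<in> T"
      by (auto simp: eventually_at)
    have "X + s *\<^sub>R mat 1 \<in> U" if "\<bar>s\<bar> \<le> d/2" for s
      using d(2)[of s] that d(1) X T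
      by (cases "s = 0") (auto simp: dist_real_def intro!: symmetric_mats_simps)
    then show ?thesis using d(1) by (intro exI[of _ "d/2"]) auto
  qed
  obtain d1 where d1: "d1 > 0" "\<And>s. \<bar>s\<bar> \<le> d1 \<Longrightarrow> P + s *\<^sub>R mat 1 \<in> U" using near[OF P] by blast
  obtain d2 where d2: "d2 > 0" "\<And>s. \<bar>s\<bar> \<le> d2 \<Longrightarrow> Q + s *\<^sub>R mat 1 \<in> U" using near[OF Q] by blast
  define d where "d = min d1 d2"
  have d: "d > 0" using d1 d2 by (simp add: d_def)
  \<comment> \<open>\<open>(1-\<theta>) P' + \<theta> Q'\<close> is again the given point\<close>
  define P' where "P' = P + (- (d * \<theta>)) *\<^sub>R mat 1"
  define Q' where "Q' = Q + (d * (1 - \<theta>)) *\<^sub>R mat 1"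
  have "d * \<theta> \<le> d * 1" "d * (1-\<theta>) \<le> d * 1" using d th by (intro mult_left_mono; simp)+
  then have "\<bar>- (d * \<theta>)\<bar> \<le> d1" "\<bar>d * (1-\<theta>)\<bar> \<le> d2"
    using d th d1 d2 by (auto simp: d_def abs_mult)
  then have P': "P' \<in> U" and Q': "Q' \<in> U"
    unfolding P'_def Q'_def by (intro d1(2) d2(2); simp)+
  have N: "Q' - P' = (Q - P) + d *\<^sub>R mat 1"
    by (simp add: P'_def Q'_def algebra_simps)
  have "Q' - P' \<in> posdef_mats"
  proof -
    have "x \<bullet> ((Q - P + d *\<^sub>R mat 1) *v x) = x \<bullet> ((Q - P) *v x) + d * (x \<bullet> x)" for x
      by (simp add: matrix_vector_mult_add_rdistrib inner_add_right flip: scaleR_matrix_vector_assoc)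
    then show ?thesis using PQ d unfolding N posdef_mats_def psd_mats_def
      by (auto intro!: symmetric_mats_simps add_nonneg_pos)
  qed
  moreover have "P' - (Q' - P') \<in> symmetric_mats"
    using P' Q' T by (intro symmetric_mats_simps) auto
  ultimately have cv: "convex (U \<inter> {(P' - (Q' - P')) + t *\<^sub>R (Q' - P') | t. 0 < t})"
    using U_conv by blast
  have "P' \<in> U \<inter> {(P' - (Q' - P')) + t *\<^sub>R (Q' - P') | t. 0 < t}"
    using P' by (auto intro!: exI[of _ 1])
  moreover have "Q' \<in> U \<inter> {(P' - (Q' - P')) + t *\<^sub>R (Q' - P') | t. 0 < t}"
    using Q' by (auto intro!: exI[of _ 2] simp: scaleR_2)
  ultimately have "(1-\<theta>) *\<^sub>R P' + \<theta> *\<^sub>R Q' \<in> U"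
    using convexD[OF cv, of P' Q' "1-\<theta>" \<theta>] th by auto
  moreover have "(1-\<theta>) *\<^sub>R P' + \<theta> *\<^sub>R Q' = (1-\<theta>) *\<^sub>R P + \<theta> *\<^sub>R Q"
    by (simp add: P'_def Q'_def algebra_simps)
  ultimately show ?thesis by simp
qed

section \<open>Differentiating along a segment\<close>

lemma sym_decomp:
  fixes D :: "real^'n^'n"
  assumes "D \<in> symmetric_mats"
  shows "D = (\<Sum>i\<in>UNIV. \<Sum>j\<in>UNIV. D$i$j *\<^sub>R sym_unit i j)"
proof -
  have "(\<Sum>i\<in>UNIV. \<Sum>j\<in>UNIV. D$i$j *\<^sub>R sym_unit i j) $ k $ l = D $ k $ l" for k l
  proof -
    have "(\<Sum>i\<in>UNIV. \<Sum>j\<in>UNIV. D$i$j *\<^sub>R sym_unit i j) $ k $ l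
       = (\<Sum>i\<in>UNIV. \<Sum>j\<in>UNIV. (if k = i then if l = j then D$i$j/2 else 0 else 0)
            + (if k = j then if l = i then D$i$j/2 else 0 else 0))"
      by (auto simp: sym_unit_def intro!: sum.cong)
    also have "\<dots> = (\<Sum>i\<in>UNIV. (if k = i then D$i$l/2 else 0) + (if l = i then D$i$k/2 else 0))"
    proof (intro sum.cong refl)
      fix i
      show "(\<Sum>j\<in>UNIV. (if k = i then if l = j then D$i$j/2 else 0 else 0)
            + (if k = j then if l = i then D$i$j/2 else 0 else 0))
          = (if k = i then D$i$l/2 else 0) + (if l = i then D$i$k/2 else 0)"
        by (cases "k = i"; cases "l = i") (simp_all add: sum.distrib)
    qed
    also have "\<dots> = D$k$l/2 + D$l$k/2" by (simp add: sum.distrib)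
    finally show ?thesis using assms by (simp add: symmetric_mats_iff)
  qed
  then show ?thesis by (simp add: vec_eq_iff)
qed

lemma sym_unit_symmetric: "sym_unit i j \<in> symmetric_mats"
  unfolding symmetric_mats_iff sym_unit_def by (simp add: add.commute conj_commute)

text \<open>The derivative of \<open>F\<close> exists only within \<open>U\<close>, a set with empty interior among all matrices as soon as
  \<open>n \<ge> 2\<close>. The lines along symmetric directions that define the partial derivatives stay in \<open>U\<close> near their base
  point, so along them it is an ordinary derivative.\<close>

lemma mat_partials_derivative:
  fixes U :: "(real^'n^'n) set"
  assumes U_open: "openin (top_of_set symmetric_mats) U"
    and F': "(F has_derivative F') (at M within U)" and M: "M \<in> U" and D: "D \<in> symmetric_mats"
  shows "F' D = mat_partials F M \<bullet> D"
proof -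
  obtain T where T: "open T" "U = symmetric_mats \<inter> T"
    using U_open by (auto simp: openin_open)
  interpret F': bounded_linear F' using F' by (rule has_derivative_bounded_linear)
  have part: "mat_partials F M $ i $ j = F' (sym_unit i j)" for i j
  proof -
    let ?E = "sym_unit i j"
    let ?S = "(\<lambda>t::real. M + t *\<^sub>R ?E) -` T"
    have opS: "open ?S" using T(1) by (intro open_vimage) (auto intro!: continuous_intros)
    have S0: "0 \<in> ?S" using M T by simp
    have "((\<lambda>t::real. M + t *\<^sub>R ?E) has_derivative (\<lambda>t. t *\<^sub>R ?E)) (at 0 within ?S)"
      by (auto intro!: derivative_eq_intros)
    moreover have "(F has_derivative F') (at (M + 0 *\<^sub>R ?E) within (\<lambda>t. M + t *\<^sub>R ?E) ` ?S)"
    proof -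
      have "(\<lambda>t. M + t *\<^sub>R ?E) ` ?S \<subseteq> U"
        using M T by (auto intro!: symmetric_mats_simps sym_unit_symmetric)
      then show ?thesis using has_derivative_subset[OF F'] by simp
    qed
    ultimately have "((\<lambda>t. F (M + t *\<^sub>R ?E)) has_derivative (\<lambda>t. F' (t *\<^sub>R ?E))) (at 0 within ?S)"
      by (rule has_derivative_in_compose)
    then have "((\<lambda>t. F (M + t *\<^sub>R ?E)) has_derivative (\<lambda>t. F' (t *\<^sub>R ?E))) (at 0)"
      using at_within_open[OF S0 opS] by simp
    then have "((\<lambda>t. F (M + t *\<^sub>R ?E)) has_field_derivative F' ?E) (at 0)"
      by (simp add: F'.scaleR has_field_derivative_def mult.commute[of _ "F' ?E"] )
    then show ?thesis by (simp add: mat_partials_def dir_deriv_def DERIV_imp_deriv)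
  qed
  have "F' D = F' (\<Sum>i\<in>UNIV. \<Sum>j\<in>UNIV. D$i$j *\<^sub>R sym_unit i j)"
    using sym_decomp[OF D] by simp
  also have "\<dots> = mat_partials F M \<bullet> D"
    by (simp add: F'.sum F'.scaleR mat_inner part mult.commute)
  finally show ?thesis .
qed

lemma segment_mean_value:
  fixes U :: "(real^'n^'n) set"
  assumes U_open: "openin (top_of_set symmetric_mats) U"
    and C1: "C1_on_sym U F"
    and seg: "\<And>\<theta>. 0 \<le> \<theta> \<Longrightarrow> \<theta> \<le> 1 \<Longrightarrow> (1-\<theta>) *\<^sub>R P + \<theta> *\<^sub>R Q \<in> U"
  shows "\<exists>\<theta>. 0 < \<theta> \<and> \<theta> < 1 \<and> F Q - F P = mat_partials F ((1-\<theta>) *\<^sub>R P + \<theta> *\<^sub>R Q) \<bullet> (Q - P)"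
proof -
  let ?M = "\<lambda>\<theta>::real. (1-\<theta>) *\<^sub>R P + \<theta> *\<^sub>R Q"
  have UT: "U \<subseteq> symmetric_mats" using U_open openin_imp_subset by blast
  have D: "Q - P \<in> symmetric_mats"
    using UT seg[of 0] seg[of 1] by (auto intro!: symmetric_mats_simps)
  have der: "((\<lambda>\<theta>. F (?M \<theta>)) has_derivative (\<lambda>t. t * (mat_partials F (?M \<theta>) \<bullet> (Q - P)))) (at \<theta> within {0..1})"
    if th: "\<theta> \<in> {0..1}" for \<theta>
  proof -
    have MU: "?M \<theta> \<in> U" using seg th by auto
    then obtain F' where F': "(F has_derivative F') (at (?M \<theta>) within U)"
      using C1 unfolding C1_on_sym_def differentiable_on_def differentiable_def by blast
    interpret F': bounded_linear F' using F' by (rule has_derivative_bounded_linear)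
    have "(?M has_derivative (\<lambda>t. t *\<^sub>R (Q - P))) (at \<theta> within {0..1})"
      by (auto intro!: derivative_eq_intros simp: algebra_simps)
    moreover have "(F has_derivative F') (at (?M \<theta>) within ?M ` {0..1})"
      by (rule has_derivative_subset[OF F']) (use seg in auto)
    ultimately have "((\<lambda>\<theta>. F (?M \<theta>)) has_derivative (\<lambda>t. F' (t *\<^sub>R (Q - P)))) (at \<theta> within {0..1})"
      by (rule has_derivative_in_compose)
    then show ?thesis
      using mat_partials_derivative[OF U_open F' MU D] by (simp add: F'.scaleR)
  qed
  have "continuous_on {0..1} (\<lambda>\<theta>. F (?M \<theta>))"
    by (rule has_derivative_continuous_on) (rule der)
  moreover have "((\<lambda>\<theta>. F (?M \<theta>)) has_derivative (\<lambda>t. t * (mat_partials F (?M \<theta>) \<bullet> (Q - P)))) (at \<theta>)"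
    if "0 < \<theta>" "\<theta> < 1" for \<theta>
  proof -
    have "at \<theta> within {0..1} = at \<theta>" using that by (intro at_within_interior) auto
    then show ?thesis using der[of \<theta>] that by simp
  qed
  ultimately obtain \<theta> where "0 < \<theta>" "\<theta> < 1"
    "F (?M 1) - F (?M 0) = (1 - 0) * (mat_partials F (?M \<theta>) \<bullet> (Q - P))"
    using mvt[of 0 1 "\<lambda>\<theta>. F (?M \<theta>)" "\<lambda>\<theta> t. t * (mat_partials F (?M \<theta>) \<bullet> (Q - P))"] by auto
  then show ?thesis by auto
qed

section \<open>Second order Taylor data\<close>

text \<open>A \<open>C\<^sup>2\<close> function on \<open>S\<close> that carries its gradient and Hessian along as explicit functions, because
  the calculations with Kelvin transforms, powers and barriers need the formulas for them.\<close>

definition has_jet :: "(real^'n \<Rightarrow> real) \<Rightarrow> (real^'n \<Rightarrow> real^'n) \<Rightarrow> (real^'n \<Rightarrow> real^'n^'n)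
    \<Rightarrow> (real^'n) set \<Rightarrow> bool" where
  "has_jet f G H S \<longleftrightarrow> (\<forall>x\<in>S. (f has_derivative (\<lambda>h. G x \<bullet> h)) (at x) \<and>
      (G has_derivative (\<lambda>h. H x *v h)) (at x)) \<and> continuous_on S H"

text \<open>The minimum is one-sided, which suffices at a critical point; in the boundary point lemma the sign of the
  function is known on one side only.\<close>

lemma second_derivative_nonneg:
  fixes \<phi> :: "real \<Rightarrow> real"
  assumes "\<delta> > 0" and d1: "\<And>t. \<bar>t\<bar> < \<delta> \<Longrightarrow> (\<phi> has_real_derivative \<phi>' t) (at t)"
    and d2: "(\<phi>' has_real_derivative c) (at 0)"
    and crit: "\<phi>' 0 = 0"
    and min: "\<And>t. 0 \<le> t \<Longrightarrow> t < \<delta> \<Longrightarrow> \<phi> 0 \<le> \<phi> t"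
  shows "c \<ge> 0"
proof (rule ccontr)
  assume "\<not> c \<ge> 0"
  then obtain d where d: "d > 0" "\<And>h. h > 0 \<Longrightarrow> h < d \<Longrightarrow> \<phi>' (0 + h) < \<phi>' 0"
    using DERIV_neg_dec_right[OF d2] by auto
  define s where "s = min d \<delta> / 2"
  have s: "s > 0" "s < d" "s < \<delta>" using d \<open>\<delta> > 0\<close> by (auto simp: s_def)
  have "\<exists>z. 0 < z \<and> z < s \<and> \<phi> s - \<phi> 0 = (s - 0) * \<phi>' z"
    using s by (intro MVT2) (auto intro!: d1)
  then obtain z where z: "0 < z" "z < s" "\<phi> s - \<phi> 0 = s * \<phi>' z" by auto
  have "\<phi>' z < 0" using d(2)[of z] z s crit by auto
  then have "s * \<phi>' z < 0" using s by (simp add: mult_pos_neg)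
  then show False using z min[of s] s by auto
qed

text \<open>Restricting to a ray reduces second order conditions to one variable.\<close>

lemma jet_along_line:
  assumes J: "has_jet f G H S" and x: "x + t *\<^sub>R e \<in> S"
  shows "((\<lambda>t. f (x + t *\<^sub>R e)) has_real_derivative (G (x + t *\<^sub>R e) \<bullet> e)) (at t)"
    and "((\<lambda>t. G (x + t *\<^sub>R e) \<bullet> e) has_real_derivative (e \<bullet> (H (x + t *\<^sub>R e) *v e))) (at t)"
proof -
  have l: "((\<lambda>t::real. x + t *\<^sub>R e) has_derivative (\<lambda>s. s *\<^sub>R e)) (at t)"
    by (auto intro!: derivative_eq_intros)
  have f: "(f has_derivative (\<lambda>h. G (x + t *\<^sub>R e) \<bullet> h)) (at (x + t *\<^sub>R e))"
    and G: "(G has_derivative (\<lambda>h. H (x + t *\<^sub>R e) *v h)) (at (x + t *\<^sub>R e))"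
    using J x by (auto simp: has_jet_def)
  show "((\<lambda>t. f (x + t *\<^sub>R e)) has_real_derivative (G (x + t *\<^sub>R e) \<bullet> e)) (at t)"
    using has_derivative_compose[OF l f]
    by (simp add: has_field_derivative_def mult.commute[of _ "G (x + t *\<^sub>R e) \<bullet> e"])
  have "((\<lambda>t. G (x + t *\<^sub>R e) \<bullet> e) has_derivative (\<lambda>s. (H (x + t *\<^sub>R e) *v (s *\<^sub>R e)) \<bullet> e)) (at t)"
    by (rule has_derivative_inner_left[OF has_derivative_compose[OF l G]])
  then show "((\<lambda>t. G (x + t *\<^sub>R e) \<bullet> e) has_real_derivative (e \<bullet> (H (x + t *\<^sub>R e) *v e))) (at t)"
    by (simp add: has_field_derivative_def matrix_vector_mult_scaleR inner_commute
        mult.commute[of _ "e \<bullet> (H (x + t *\<^sub>R e) *v e)"])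
qed

lemma ray_in_open:
  fixes z e :: "'a::real_normed_vector"
  assumes "open S" "z \<in> S"
  shows "\<exists>\<delta>>0. \<forall>t. \<bar>t\<bar> < \<delta> \<longrightarrow> z + t *\<^sub>R e \<in> S"
proof -
  obtain d where d: "d > 0" "ball z d \<subseteq> S" using assms open_contains_ball by blast
  have "z + t *\<^sub>R e \<in> S" if "\<bar>t\<bar> < d / (norm e + 1)" for t
  proof -
    have pos: "0 < norm e + 1" using norm_ge_zero[of e] by linarith
    have "\<bar>t\<bar> * norm e \<le> \<bar>t\<bar> * (norm e + 1)" by (simp add: mult_left_mono)
    also have "\<dots> < d" using that pos by (simp add: pos_less_divide_eq)
    finally have "dist z (z + t *\<^sub>R e) < d" by (simp add: dist_norm)
    then show ?thesis using d by auto
  qed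
  moreover have "d / (norm e + 1) > 0" using d by (intro divide_pos_pos add_nonneg_pos) auto
  ultimately show ?thesis by blast
qed

lemma second_order_along_ray:
  assumes J: "has_jet f G H S" and S: "open S" "z \<in> S" and crit: "G z \<bullet> e = 0"
    and \<delta>: "\<delta> > 0" and min: "\<And>t. 0 \<le> t \<Longrightarrow> t < \<delta> \<Longrightarrow> f z \<le> f (z + t *\<^sub>R e)"
  shows "0 \<le> e \<bullet> (H z *v e)"
proof -
  obtain d where d: "d > 0" "\<And>t. \<bar>t\<bar> < d \<Longrightarrow> z + t *\<^sub>R e \<in> S"
    using ray_in_open[OF S, of e] by blast
  show ?thesis
  proof (rule second_derivative_nonneg[of "min d \<delta>" "\<lambda>t. f (z + t *\<^sub>R e)" "\<lambda>t. G (z + t *\<^sub>R e) \<bullet> e"])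
    show "((\<lambda>t. f (z + t *\<^sub>R e)) has_real_derivative G (z + t *\<^sub>R e) \<bullet> e) (at t)" if "\<bar>t\<bar> < min d \<delta>" for t
      using jet_along_line(1)[OF J d(2)[of t]] that by simp
    show "((\<lambda>t. G (z + t *\<^sub>R e) \<bullet> e) has_real_derivative e \<bullet> (H z *v e)) (at 0)"
      using jet_along_line(2)[OF J d(2)[of 0]] d by simp
  qed (use d \<delta> crit min in auto)
qed

lemma gradient_zero_at_min:
  assumes J: "has_jet f G H S" and S: "open S" "z \<in> S"
    and min: "\<And>y. y \<in> S \<Longrightarrow> f z \<le> f y"
  shows "G z = 0"
proof -
  have "(f has_derivative (\<lambda>h. G z \<bullet> h)) (at z)" using J S by (auto simp: has_jet_def)
  moreover have "eventually (\<lambda>y. f z \<le> f y) (at z)"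
    using S min by (auto simp: eventually_at_topological)
  ultimately have "(\<lambda>h. G z \<bullet> h) = (\<lambda>h. 0)"
    using has_derivative_local_min by blast
  then have "G z \<bullet> G z = 0" by meson
  then show ?thesis by simp
qed

lemma hessian_psd_at_min:
  assumes J: "has_jet f G H S" and S: "open S" "z \<in> S"
    and min: "\<And>y. y \<in> S \<Longrightarrow> f z \<le> f y"
  shows "0 \<le> e \<bullet> (H z *v e)"
proof -
  obtain d where d: "d > 0" "\<And>t. \<bar>t\<bar> < d \<Longrightarrow> z + t *\<^sub>R e \<in> S"
    using ray_in_open[OF S, of e] by blast
  show ?thesis
    by (rule second_order_along_ray[OF J S _ d(1)]) (use gradient_zero_at_min[OF J S min] d min in auto)
qed

lemma has_jet_subset: "has_jet f G H S \<Longrightarrow> T \<subseteq> S \<Longrightarrow> has_jet f G H T"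
  by (auto simp: has_jet_def intro: continuous_on_subset)

lemma has_jet_continuous:
  assumes "has_jet f G H S"
  shows "continuous_on S f" "continuous_on S G" "continuous_on S H"
  using assms unfolding has_jet_def continuous_on_eq_continuous_within
  by (blast intro: has_derivative_continuous continuous_at_imp_continuous_at_within)+

lemma has_jet_add:
  assumes "has_jet f1 G1 H1 S" "has_jet f2 G2 H2 S"
  shows "has_jet (\<lambda>x. f1 x + f2 x) (\<lambda>x. G1 x + G2 x) (\<lambda>x. H1 x + H2 x) S"
  using assms unfolding has_jet_def
  by (auto intro!: derivative_eq_intros continuous_intros simp: inner_add_left matrix_vector_mult_add_rdistrib)

lemma has_jet_scale:
  assumes "has_jet f G H S"
  shows "has_jet (\<lambda>x. c * f x) (\<lambda>x. c *\<^sub>R G x) (\<lambda>x. c *\<^sub>R H x) S"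
proof -
  have "((\<lambda>x. c * f x) has_derivative (\<lambda>h. c *\<^sub>R G x \<bullet> h)) (at x)" if "x \<in> S" for x
    using assms that unfolding has_jet_def by (auto intro!: derivative_eq_intros)
  moreover have "((\<lambda>x. c *\<^sub>R G x) has_derivative (\<lambda>h. (c *\<^sub>R H x) *v h)) (at x)" if "x \<in> S" for x
    using assms that unfolding has_jet_def
    by (auto intro!: derivative_eq_intros simp: scaleR_matrix_vector_assoc[symmetric])
  moreover have "continuous_on S (\<lambda>x. c *\<^sub>R H x)"
    using assms unfolding has_jet_def by (auto intro!: continuous_intros)
  ultimately show ?thesis unfolding has_jet_def by blast
qed

lemma has_jet_diff:
  assumes "has_jet f1 G1 H1 S" "has_jet f2 G2 H2 S"
  shows "has_jet (\<lambda>x. f1 x - f2 x) (\<lambda>x. G1 x - G2 x) (\<lambda>x. H1 x - H2 x) S"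
  using has_jet_add[OF assms(1) has_jet_scale[OF assms(2), of "-1"]] by simp

lemma has_jet_translate:
  assumes "has_jet f G H UNIV"
  shows "has_jet (\<lambda>x. f (a + x)) (\<lambda>x. G (a + x)) (\<lambda>x. H (a + x)) UNIV"
proof -
  have l: "((\<lambda>x. a + x) has_derivative (\<lambda>h. h)) (at x)" for x
    by (auto intro!: derivative_eq_intros)
  have f: "(f has_derivative (\<lambda>h. G x \<bullet> h)) (at x)" and G: "(G has_derivative (\<lambda>h. H x *v h)) (at x)"
    and H: "continuous_on UNIV H" for x
    using assms unfolding has_jet_def by auto
  have "continuous_on UNIV (\<lambda>x. H (a + x))"
    by (rule continuous_on_compose2[OF H]) (auto intro!: continuous_intros)
  then show ?thesis
    using has_derivative_compose[OF l f] has_derivative_compose[OF l G] unfolding has_jet_def by simp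
qed

section \<open>The Kelvin transform\<close>

text \<open>With \<open>r\<close>, \<open>g\<close>, \<open>H\<close> the value, gradient and Hessian of \<open>v\<close> at a point, this is the Schouten tensor of
  the metric \<open>v\<^sup>-\<^sup>2 |dx|\<^sup>2\<close> with one index raised.\<close>

definition schouten :: "real \<Rightarrow> real^'n \<Rightarrow> real^'n^'n \<Rightarrow> real^'n^'n" where
  "schouten r g H = r *\<^sub>R H - (g \<bullet> g / 2) *\<^sub>R mat 1"

definition refl_mat :: "real^'n \<Rightarrow> real^'n^'n" where
  "refl_mat y = mat 1 - (2 / (y \<bullet> y)) *\<^sub>R tensor y y"

definition sphere_inv :: "real \<Rightarrow> real^'n \<Rightarrow> real^'n" where
  "sphere_inv \<rho> y = (\<rho>\<^sup>2 / (y \<bullet> y)) *\<^sub>R y"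

text \<open>For \<open>u = v\<^bsup>-(n-2)/2\<^esup>\<close> this is the classical Kelvin transform of \<open>u\<close>; the conformal factor of the
  inversion enters \<open>v\<close> with the power \<open>-1\<close>, whatever the dimension.\<close>

definition kelvin :: "real \<Rightarrow> (real^'n \<Rightarrow> real) \<Rightarrow> real^'n \<Rightarrow> real" where
  "kelvin \<rho> v y = (y \<bullet> y) / \<rho>\<^sup>2 * v (sphere_inv \<rho> y)"

definition kelvin_grad where
  "kelvin_grad \<rho> v G y = (2 * v (sphere_inv \<rho> y) / \<rho>\<^sup>2) *\<^sub>R y + refl_mat y *v G (sphere_inv \<rho> y)"

definition kelvin_hess where
  "kelvin_hess \<rho> v G H y = (2 * v (sphere_inv \<rho> y) / \<rho>\<^sup>2 - 2 * (y \<bullet> G (sphere_inv \<rho> y)) / (y \<bullet> y)) *\<^sub>R mat 1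
     + (\<rho>\<^sup>2 / (y \<bullet> y)) *\<^sub>R (refl_mat y ** H (sphere_inv \<rho> y) ** refl_mat y)"

lemma refl_mat_vec: "refl_mat y *v h = h - (2 * (y \<bullet> h) / (y \<bullet> y)) *\<^sub>R y"
  by (simp add: refl_mat_def matrix_vector_mult_diff_rdistrib tensor_mult_vec
      flip: scaleR_matrix_vector_assoc)

lemma refl_mat_symmetric: "transpose (refl_mat y) = refl_mat y"
proof -
  have "refl_mat y \<in> symmetric_mats"
    unfolding refl_mat_def by (intro symmetric_mats_simps)
  then show ?thesis by (simp add: symmetric_mats_def)
qed

lemma refl_mat_involution:
  assumes "y \<noteq> 0"
  shows "refl_mat y ** refl_mat y = mat 1"
proof -
  have "refl_mat y *v (refl_mat y *v h) = h" for h
    using assms by (simp add: refl_mat_vec inner_diff_right)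
  then have "(refl_mat y ** refl_mat y) *v h = mat 1 *v h" for h
    by (simp add: matrix_vector_mul_assoc[symmetric])
  then show ?thesis by (simp add: matrix_eq)
qed

lemma refl_mat_orthogonal: "y \<noteq> 0 \<Longrightarrow> orthogonal_matrix (refl_mat y)"
  by (simp add: orthogonal_matrix_def refl_mat_symmetric refl_mat_involution)

lemma refl_mat_inverse:
  assumes "y \<noteq> 0"
  shows "matrix_inv (refl_mat y) = refl_mat y"
proof -
  let ?R = "refl_mat y"
  have "?R ** ?R = mat 1 \<and> ?R ** ?R = mat 1" using refl_mat_involution[OF assms] by simp
  then have "?R ** matrix_inv ?R = mat 1 \<and> matrix_inv ?R ** ?R = mat 1"
    unfolding matrix_inv_def by (rule someI)
  then have "matrix_inv ?R ** ?R = mat 1" by simp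
  then have "matrix_inv ?R ** ?R ** ?R = ?R" by simp
  then show ?thesis
    by (simp add: refl_mat_involution[OF assms] matrix_mul_assoc[symmetric])
qed

lemma refl_mat_inner: "x \<bullet> (refl_mat y *v h) = (refl_mat y *v x) \<bullet> h"
  by (simp add: refl_mat_vec inner_diff_left inner_diff_right inner_commute)

text \<open>Inversion is conformal: its differential is a multiple of the reflection in the
  hyperplane orthogonal to \<open>y\<close>.\<close>

lemma sphere_inv_derivative:
  assumes "y \<noteq> 0"
  shows "(sphere_inv \<rho> has_derivative (\<lambda>h. (\<rho>\<^sup>2 / (y \<bullet> y)) *\<^sub>R (refl_mat y *v h))) (at y)"
proof -
  have yy: "y \<bullet> y \<noteq> 0" using assms by simp
  have "((\<lambda>y. (\<rho>\<^sup>2 / (y \<bullet> y)) *\<^sub>R y) has_derivative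
      (\<lambda>h. (\<rho>\<^sup>2 / (y \<bullet> y)) *\<^sub>R h + (- (\<rho>\<^sup>2 * (y \<bullet> h + h \<bullet> y)) / ((y \<bullet> y) * (y \<bullet> y))) *\<^sub>R y)) (at y)" (is "(_ has_derivative ?D) _")
    using yy by (auto intro!: derivative_eq_intros simp: divide_simps)
  moreover have "?D h = (\<rho>\<^sup>2 / (y \<bullet> y)) *\<^sub>R (refl_mat y *v h)" for h
    by (simp add: refl_mat_vec scaleR_diff_right inner_commute algebra_simps)
  ultimately show ?thesis by (simp add: sphere_inv_def[abs_def])
qed

lemma continuous_on_matrix_mult [continuous_intros]:
  fixes A :: "'a::topological_space \<Rightarrow> real^'n^'m" and B :: "'a \<Rightarrow> real^'k^'n"
  assumes "continuous_on S A" "continuous_on S B"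
  shows "continuous_on S (\<lambda>x. A x ** B x)"
  unfolding matrix_matrix_mult_def using assms
  by (intro continuous_intros)

lemma continuous_on_tensor [continuous_intros]:
  fixes a b :: "'a::topological_space \<Rightarrow> real^'n"
  assumes "continuous_on S a" "continuous_on S b"
  shows "continuous_on S (\<lambda>x. tensor (a x) (b x))"
  unfolding tensor_def using assms by (intro continuous_intros)

text \<open>The terms of the Hessian in which the reflection itself is differentiated combine with the
  derivative of the first summand of the gradient; all that survives of them is a multiple of the identity.\<close>

lemma kelvin_jet:
  fixes v :: "real^'n \<Rightarrow> real"
  assumes J: "has_jet v G H UNIV" and l: "\<rho> > 0"
  shows "has_jet (kelvin \<rho> v) (kelvin_grad \<rho> v G) (kelvin_hess \<rho> v G H) (-{0})"
proof -
  have v: "(v has_derivative (\<lambda>h. G x \<bullet> h)) (at x)" and G: "(G has_derivative (\<lambda>h. H x *v h)) (at x)" for x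
    using J by (auto simp: has_jet_def)
  have d1: "(kelvin \<rho> v has_derivative (\<lambda>h. kelvin_grad \<rho> v G y \<bullet> h)) (at y)" if y: "y \<noteq> 0" for y
  proof -
    let ?i = "sphere_inv \<rho> y"
    have "(kelvin \<rho> v has_derivative (\<lambda>h. (y \<bullet> y) / \<rho>\<^sup>2 * (G ?i \<bullet> ((\<rho>\<^sup>2 / (y \<bullet> y)) *\<^sub>R (refl_mat y *v h)))
       + (y \<bullet> h + h \<bullet> y) / \<rho>\<^sup>2 * v ?i)) (at y)" (is "(_ has_derivative ?D) _")
      unfolding kelvin_def[abs_def]
      by (rule derivative_eq_intros has_derivative_compose[OF sphere_inv_derivative[OF y] v] refl | use l in force)+
    moreover have "?D h = kelvin_grad \<rho> v G y \<bullet> h" for h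
      using y l by (simp add: kelvin_grad_def inner_add_left refl_mat_inner inner_commute[of h y] field_simps)
    ultimately show ?thesis by simp
  qed
  have d2: "(kelvin_grad \<rho> v G has_derivative (\<lambda>h. kelvin_hess \<rho> v G H y *v h)) (at y)" if y: "y \<noteq> 0" for y
  proof -
    let ?i = "sphere_inv \<rho> y"
    let ?c = "\<rho>\<^sup>2 / (y \<bullet> y)"
    let ?Di = "\<lambda>h. ?c *\<^sub>R (refl_mat y *v h)"
    have yy: "y \<bullet> y \<noteq> 0" using y by simp
    have GI: "((\<lambda>y. G (sphere_inv \<rho> y)) has_derivative (\<lambda>h. H ?i *v ?Di h)) (at y)"
      by (rule has_derivative_compose[OF sphere_inv_derivative[OF y] G])
    have vI: "((\<lambda>y. v (sphere_inv \<rho> y)) has_derivative (\<lambda>h. G ?i \<bullet> ?Di h)) (at y)"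
      by (rule has_derivative_compose[OF sphere_inv_derivative[OF y] v])
    have eq: "kelvin_grad \<rho> v G = (\<lambda>y. (2 / \<rho>\<^sup>2 * v (sphere_inv \<rho> y)) *\<^sub>R y + (G (sphere_inv \<rho> y) -
        (2 * (y \<bullet> G (sphere_inv \<rho> y)) / (y \<bullet> y)) *\<^sub>R y))"
      by (simp add: kelvin_grad_def fun_eq_iff refl_mat_vec)
    have q: "((\<lambda>y. 2 * (y \<bullet> G (sphere_inv \<rho> y)) / (y \<bullet> y)) has_derivative
        (\<lambda>h. 2 * (y \<bullet> (H ?i *v ?Di h) + h \<bullet> G ?i) / (y \<bullet> y)
          - 2 * (y \<bullet> G ?i) * (y \<bullet> h + h \<bullet> y) / ((y \<bullet> y) * (y \<bullet> y)))) (at y)"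
      using yy by (auto intro!: derivative_eq_intros GI simp: divide_simps)
    have "(kelvin_grad \<rho> v G has_derivative (\<lambda>h.
       ((2 / \<rho>\<^sup>2 * v ?i) *\<^sub>R h + (2 / \<rho>\<^sup>2 * (G ?i \<bullet> ?Di h)) *\<^sub>R y) +
       ((H ?i *v ?Di h) -
        ((2 * (y \<bullet> G ?i) / (y \<bullet> y)) *\<^sub>R h + (2 * (y \<bullet> (H ?i *v ?Di h) + h \<bullet> G ?i) / (y \<bullet> y)
          - 2 * (y \<bullet> G ?i) * (y \<bullet> h + h \<bullet> y) / ((y \<bullet> y) * (y \<bullet> y))) *\<^sub>R y)))) (at y)" (is "(_ has_derivative ?D) _")
      unfolding eq
      by (intro has_derivative_add has_derivative_diff has_derivative_scaleR has_derivative_mult_right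
          q GI vI has_derivative_ident)
    moreover have "?D h = kelvin_hess \<rho> v G H y *v h" for h
    proof -
      have "kelvin_hess \<rho> v G H y *v h = (2 * v ?i / \<rho>\<^sup>2 - 2 * (y \<bullet> G ?i) / (y \<bullet> y)) *\<^sub>R h
          + refl_mat y *v (H ?i *v ?Di h)"
        by (simp add: kelvin_hess_def matrix_vector_mult_add_rdistrib matrix_vector_mul_assoc
            matrix_vector_mult_scaleR matrix_mul_assoc flip: scaleR_matrix_vector_assoc)
      also have "refl_mat y *v (H ?i *v ?Di h) = (H ?i *v ?Di h) - (2 * (y \<bullet> (H ?i *v ?Di h)) / (y \<bullet> y)) *\<^sub>R y"
        by (simp add: refl_mat_vec)
      finally have R: "kelvin_hess \<rho> v G H y *v h = (2 * v ?i / \<rho>\<^sup>2 - 2 * (y \<bullet> G ?i) / (y \<bullet> y)) *\<^sub>R h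
          + ((H ?i *v ?Di h) - (2 * (y \<bullet> (H ?i *v ?Di h)) / (y \<bullet> y)) *\<^sub>R y)" .
      have coef: "2 / \<rho>\<^sup>2 * (G ?i \<bullet> ?Di h) = 2 * (h \<bullet> G ?i) / (y \<bullet> y)
          - 2 * (y \<bullet> G ?i) * (y \<bullet> h + h \<bullet> y) / ((y \<bullet> y) * (y \<bullet> y))"
        using yy l by (simp add: refl_mat_vec inner_diff_right inner_commute field_simps)
      show ?thesis unfolding R coef
        by (simp add: algebra_simps add_divide_distrib)
    qed
    ultimately show ?thesis by simp
  qed
  have ci: "continuous_on (-{0}) (sphere_inv \<rho> :: real^'n \<Rightarrow> real^'n)"
    unfolding sphere_inv_def[abs_def] by (intro continuous_intros) auto
  have "continuous_on (-{0}) (\<lambda>y. v (sphere_inv \<rho> y))" "continuous_on (-{0}) (\<lambda>y. G (sphere_inv \<rho> y))"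
    "continuous_on (-{0}) (\<lambda>y. H (sphere_inv \<rho> y))"
    by (rule continuous_on_compose2[OF has_jet_continuous(1)[OF J] ci] continuous_on_compose2[OF has_jet_continuous(2)[OF J] ci]
          continuous_on_compose2[OF has_jet_continuous(3)[OF J] ci]; simp)+
  then have "continuous_on (-{0}) (kelvin_hess \<rho> v G H)"
    unfolding kelvin_hess_def[abs_def] refl_mat_def
    using l by (intro continuous_intros) auto
  then show ?thesis using d1 d2 by (simp add: has_jet_def)
qed

lemma refl_mat_sandwich:
  "refl_mat y ** (a *\<^sub>R X - b *\<^sub>R mat 1) ** refl_mat y
     = a *\<^sub>R (refl_mat y ** X ** refl_mat y) - b *\<^sub>R (refl_mat y ** refl_mat y)"
  by (simp add: matrix_eq matrix_vector_mul_assoc[symmetric] matrix_vector_mult_diff_rdistrib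
      matrix_vector_mult_diff_distrib matrix_vector_mult_scaleR flip: scaleR_matrix_vector_assoc)

text \<open>Conformal invariance. Apart from the reflected Hessian there are only multiples of the identity,
  from the Hessian of the conformal factor and from the square of the gradient; they add up to
  \<open>-|\<nabla>v|\<^sup>2/2\<close> at the inverse point.\<close>

lemma schouten_kelvin:
  assumes y: "y \<noteq> 0" and l: "\<rho> > 0"
  shows "schouten (kelvin \<rho> v y) (kelvin_grad \<rho> v G y) (kelvin_hess \<rho> v G H y)
    = matrix_inv (refl_mat y) ** schouten (v (sphere_inv \<rho> y)) (G (sphere_inv \<rho> y)) (H (sphere_inv \<rho> y)) ** refl_mat y"
proof -
  define w g X where "w = v (sphere_inv \<rho> y)" and "g = G (sphere_inv \<rho> y)" and "X = H (sphere_inv \<rho> y)"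
  define s where "s = y \<bullet> y"
  have s: "s \<noteq> 0" using y by (simp add: s_def)
  have "(refl_mat y *v g) \<bullet> (refl_mat y *v g) = g \<bullet> (refl_mat y *v (refl_mat y *v g))"
    by (simp add: refl_mat_inner)
  also have "\<dots> = g \<bullet> g"
    by (simp add: matrix_vector_mul_assoc refl_mat_involution[OF y])
  finally have rr: "(refl_mat y *v g) \<bullet> (refl_mat y *v g) = g \<bullet> g" .
  have yr: "y \<bullet> (refl_mat y *v g) = - (y \<bullet> g)"
    using s by (simp add: refl_mat_vec inner_diff_right s_def)
  have gg: "kelvin_grad \<rho> v G y \<bullet> kelvin_grad \<rho> v G y = 4 * w\<^sup>2 / \<rho>^4 * s - 4 * w / \<rho>\<^sup>2 * (y \<bullet> g) + g \<bullet> g"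
  proof -
    have "(a *\<^sub>R y + refl_mat y *v g) \<bullet> (a *\<^sub>R y + refl_mat y *v g) = a\<^sup>2 * s - 2 * a * (y \<bullet> g) + g \<bullet> g" for a
      by (simp add: inner_add_left inner_add_right rr yr inner_commute[of "refl_mat y *v g" y] s_def[symmetric]
        power2_eq_square right_diff_distrib)
    from this[of "2 * w / \<rho>\<^sup>2"] show ?thesis
      unfolding kelvin_grad_def w_def[symmetric] g_def[symmetric]
      by (simp add: power_divide flip: power_mult)
  qed
  have a1: "s / \<rho>\<^sup>2 * w * (\<rho>\<^sup>2 / s) = w" using s l by simp
  have a2: "s / \<rho>\<^sup>2 * w * (2 * w / \<rho>\<^sup>2 - 2 * (y \<bullet> g) / s)
     - (4 * w\<^sup>2 / \<rho>^4 * s - 4 * w / \<rho>\<^sup>2 * (y \<bullet> g) + g \<bullet> g) / 2 = - (g \<bullet> g / 2)"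
  proof -
    have t: "s / t * w * (2 * w / t - 2 * (y \<bullet> g) / s) - (4 * w\<^sup>2 / t\<^sup>2 * s - 4 * w / t * (y \<bullet> g) + g \<bullet> g) / 2
        = - (g \<bullet> g / 2)" if "t \<noteq> 0" for t
      using s that by (simp add: field_simps power2_eq_square)
    show ?thesis using t[of "\<rho>\<^sup>2"] l by (simp flip: power_mult)
  qed
  have "schouten (kelvin \<rho> v y) (kelvin_grad \<rho> v G y) (kelvin_hess \<rho> v G H y)
     = (s / \<rho>\<^sup>2 * w) *\<^sub>R ((2 * w / \<rho>\<^sup>2 - 2 * (y \<bullet> g) / s) *\<^sub>R mat 1
        + (\<rho>\<^sup>2 / s) *\<^sub>R (refl_mat y ** X ** refl_mat y))
       - ((4 * w\<^sup>2 / \<rho>^4 * s - 4 * w / \<rho>\<^sup>2 * (y \<bullet> g) + g \<bullet> g) / 2) *\<^sub>R mat 1"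
    unfolding schouten_def gg by (simp add: kelvin_def kelvin_hess_def w_def g_def X_def s_def)
  also have "\<dots> = (s / \<rho>\<^sup>2 * w * (\<rho>\<^sup>2 / s)) *\<^sub>R (refl_mat y ** X ** refl_mat y)
     + (s / \<rho>\<^sup>2 * w * (2 * w / \<rho>\<^sup>2 - 2 * (y \<bullet> g) / s)
     - (4 * w\<^sup>2 / \<rho>^4 * s - 4 * w / \<rho>\<^sup>2 * (y \<bullet> g) + g \<bullet> g) / 2) *\<^sub>R mat 1"
  proof -
    have "a *\<^sub>R (b *\<^sub>R I + c *\<^sub>R Y) - d *\<^sub>R I = (a * c) *\<^sub>R Y + (a * b - d) *\<^sub>R I"
      for a b c d and I Y :: "real^'n^'n"
      by (simp add: algebra_simps)
    then show ?thesis .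
  qed
  also have "\<dots> = w *\<^sub>R (refl_mat y ** X ** refl_mat y) - (g \<bullet> g / 2) *\<^sub>R mat 1"
    unfolding a1 a2 by simp
  also have "\<dots> = refl_mat y ** schouten w g X ** refl_mat y"
    unfolding schouten_def refl_mat_sandwich refl_mat_involution[OF y] ..
  finally show ?thesis
    by (simp add: w_def g_def X_def refl_mat_inverse[OF y])
qed

section \<open>The boundary point lemma\<close>

text \<open>Ellipticity is pointwise on \<open>U\<close>; the constants come from the compactness of \<open>C\<close> and of the
  unit sphere.\<close>

lemma uniform_ellipticity:
  fixes U :: "(real^'n^'n) set"
  assumes C1: "C1_on_sym U F" and ell: "\<And>M. M \<in> U \<Longrightarrow> mat_partials F M \<in> posdef_mats"
    and C: "compact C" "C \<subseteq> U"
  obtains \<kappa> K where "\<kappa> > 0" "K > 0" "\<And>M. M \<in> C \<Longrightarrow> norm (mat_partials F M) \<le> K"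
    "\<And>M x. M \<in> C \<Longrightarrow> \<kappa> * (x \<bullet> x) \<le> x \<bullet> (mat_partials F M *v x)"
proof -
  have cont: "continuous_on C (mat_partials F)"
    using C1 C unfolding C1_on_sym_def by (blast intro: continuous_on_subset)
  obtain K where K: "K > 0" "\<And>M. M \<in> C \<Longrightarrow> norm (mat_partials F M) \<le> K"
    using compact_imp_bounded[OF compact_continuous_image[OF cont C(1)]] by (force simp: bounded_pos)
  show ?thesis
  proof (cases "C = {}")
    case True
    then show ?thesis using that[of 1 1] by auto
  next
    case False
    let ?S = "sphere 0 1 :: (real^'n) set"
    let ?q = "\<lambda>(M, x). x \<bullet> (mat_partials F M *v x)"
    have "axis undefined 1 \<in> ?S" by simp
    then have ne: "C \<times> ?S \<noteq> {}" using False by blast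
    have "continuous_on (C \<times> ?S) (\<lambda>p. mat_partials F (fst p))"
      by (rule continuous_on_compose2[OF cont]) (auto intro!: continuous_intros)
    then have "continuous_on (C \<times> ?S) (\<lambda>p. snd p \<bullet> (mat_partials F (fst p) *v snd p))"
      unfolding matrix_vector_mult_def by (intro continuous_intros)
    then have "continuous_on (C \<times> ?S) ?q" by (simp add: case_prod_beta')
    moreover have "compact (C \<times> ?S)" using C by (intro compact_Times) auto
    ultimately obtain p where p: "p \<in> C \<times> ?S" "\<And>q. q \<in> C \<times> ?S \<Longrightarrow> ?q p \<le> ?q q"
      using continuous_attains_inf[of "C \<times> ?S" ?q] ne by blast
    obtain M0 x0 where p0: "p = (M0, x0)" by (cases p)
    have "x0 \<noteq> 0" using p p0 by auto
    then have pos: "0 < ?q p" using p p0 C ell[of M0] by (auto simp: posdef_mats_def)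
    have "?q p * (x \<bullet> x) \<le> x \<bullet> (mat_partials F M *v x)" if M: "M \<in> C" for M x
    proof (cases "x = 0")
      case False
      let ?y = "(1 / norm x) *\<^sub>R x"
      have "?q p \<le> ?q (M, ?y)" using p(2)[of "(M, ?y)"] M False by simp
      also have "\<dots> = (x \<bullet> (mat_partials F M *v x)) / (norm x)\<^sup>2"
        by (simp add: matrix_vector_mult_scaleR power2_eq_square)
      finally show ?thesis using False by (simp add: field_simps power2_norm_eq_inner)
    qed simp
    then show ?thesis using that[OF pos K(1) K(2)] by blast
  qed
qed

definition hopf_weight :: "real \<Rightarrow> real^'n \<Rightarrow> real^'n \<Rightarrow> real" where
  "hopf_weight \<alpha> c y = exp (- \<alpha> * ((y - c) \<bullet> (y - c)))"

text \<open>Zero on the sphere of radius \<open>R\<close> about \<open>c\<close> and positive inside. Away from \<open>c\<close> and for large \<open>\<alpha>\<close> the radial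
  part of its Hessian, of order \<open>\<alpha>\<^sup>2\<close> relative to the exponential, dominates the value, the gradient and the tangential part, which are at
  most of order \<open>\<alpha>\<close>.\<close>

definition hopf_barrier :: "real \<Rightarrow> real \<Rightarrow> real^'n \<Rightarrow> real^'n \<Rightarrow> real" where
  "hopf_barrier \<alpha> R c y = hopf_weight \<alpha> c y - exp (- \<alpha> * R\<^sup>2)"

lemma hopf_barrier_jet:
  "has_jet (hopf_barrier \<alpha> R c)
     (\<lambda>y. (- 2 * \<alpha> * hopf_weight \<alpha> c y) *\<^sub>R (y - c))
     (\<lambda>y. hopf_weight \<alpha> c y *\<^sub>R ((4 * \<alpha>\<^sup>2) *\<^sub>R tensor (y - c) (y - c) - (2 * \<alpha>) *\<^sub>R mat 1)) UNIV"
  unfolding has_jet_def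
proof (intro conjI ballI)
  fix y
  have W: "(hopf_weight \<alpha> c has_derivative (\<lambda>h. hopf_weight \<alpha> c y * (- \<alpha> * ((y - c) \<bullet> h + h \<bullet> (y - c))))) (at y)"
    unfolding hopf_weight_def[abs_def] by (rule derivative_eq_intros refl)+ (simp add: algebra_simps)
  show "(hopf_barrier \<alpha> R c has_derivative
      (\<lambda>h. ((- 2 * \<alpha> * hopf_weight \<alpha> c y) *\<^sub>R (y - c)) \<bullet> h)) (at y)"
    unfolding hopf_barrier_def[abs_def]
    by (rule derivative_eq_intros W refl)+ (simp add: inner_commute algebra_simps)
  have "((\<lambda>y. (- 2 * \<alpha> * hopf_weight \<alpha> c y) *\<^sub>R (y - c)) has_derivative
     (\<lambda>h. (- 2 * \<alpha> * hopf_weight \<alpha> c y) *\<^sub>R h +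
        (- 2 * \<alpha> * (hopf_weight \<alpha> c y * (- \<alpha> * ((y - c) \<bullet> h + h \<bullet> (y - c))))) *\<^sub>R (y - c))) (at y)" (is "(_ has_derivative ?D) _")
    by (rule derivative_eq_intros W refl)+ (simp add: algebra_simps)
  moreover have "?D h = (hopf_weight \<alpha> c y *\<^sub>R ((4 * \<alpha>\<^sup>2) *\<^sub>R tensor (y - c) (y - c) - (2 * \<alpha>) *\<^sub>R mat 1)) *v h" for h
    unfolding scaleR_matrix_vector_assoc[symmetric] matrix_vector_mult_diff_rdistrib tensor_mult_vec
    by (simp add: inner_commute[of h] scaleR_diff_right power2_eq_square mult_ac)
  ultimately show "((\<lambda>y. (- 2 * \<alpha> * hopf_weight \<alpha> c y) *\<^sub>R (y - c)) has_derivative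
     (\<lambda>h. (hopf_weight \<alpha> c y *\<^sub>R ((4 * \<alpha>\<^sup>2) *\<^sub>R tensor (y - c) (y - c) - (2 * \<alpha>) *\<^sub>R mat 1)) *v h)) (at y)"
    by simp
next
  show "continuous_on UNIV (\<lambda>y. hopf_weight \<alpha> c y *\<^sub>R ((4 * \<alpha>\<^sup>2) *\<^sub>R tensor (y - c) (y - c) - (2 * \<alpha>) *\<^sub>R mat 1))"
    unfolding hopf_weight_def by (intro continuous_intros)
qed

lemma large_parameter:
  fixes A B C :: real
  assumes "A > 0"
  obtains \<alpha> where "\<alpha> > 0" "A * \<alpha>\<^sup>2 > B * \<alpha> + C"
proof -
  define \<alpha> where "\<alpha> = (\<bar>B\<bar> + \<bar>C\<bar>) / A + 1"
  have a1: "\<alpha> \<ge> 1" using assms by (simp add: \<alpha>_def)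
  have "A * \<alpha>\<^sup>2 = (\<bar>B\<bar> + \<bar>C\<bar> + A) * \<alpha>"
    using assms by (simp add: \<alpha>_def power2_eq_square field_simps)
  also have "\<dots> = \<bar>B\<bar> * \<alpha> + \<bar>C\<bar> * \<alpha> + A * \<alpha>" by (simp add: algebra_simps)
  also have "\<dots> > B * \<alpha> + C"
  proof -
    have "B * \<alpha> \<le> \<bar>B\<bar> * \<alpha>" using a1 by (intro mult_right_mono) auto
    moreover have "\<bar>C\<bar> * 1 \<le> \<bar>C\<bar> * \<alpha>" using a1 by (intro mult_left_mono) auto
    moreover have "A * \<alpha> > 0" using a1 assms by simp
    ultimately show ?thesis by linarith
  qed
  finally show ?thesis using that[of \<alpha>] a1 by auto
qed

lemma abs_inner_le: "\<bar>a \<bullet> b\<bar> \<le> A * B" if "norm a \<le> A" "norm b \<le> B" "0 \<le> A" for a b :: "'a::real_inner"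
  using Cauchy_Schwarz_ineq2[of a b] mult_mono[OF that(1,2)] that by (meson norm_ge_zero order_trans)

text \<open>A one-sided second order condition: rays from \<open>z\<close> into the ball see \<open>v1 - v2\<close> start from a
  one-sided minimum. A quadratic form does not distinguish \<open>e\<close> from \<open>-e\<close>, so outward directions are covered as
  well.\<close>

lemma touching_hessian_psd:
  fixes v1 v2 :: "real^'n \<Rightarrow> real"
  assumes S: "open S" "z \<in> S"
    and J1: "has_jet v1 G1 H1 S" and J2: "has_jet v2 G2 H2 S"
    and touch: "v1 z = v2 z" "G1 z = G2 z"
    and R: "R > 0" "dist z c = R"
    and above: "\<And>y. y \<in> S \<Longrightarrow> dist y c \<le> R \<Longrightarrow> v2 y \<le> v1 y"
  shows "0 \<le> e \<bullet> ((H1 z - H2 z) *v e)"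
proof -
  have J: "has_jet (\<lambda>y. v1 y - v2 y) (\<lambda>y. G1 y - G2 y) (\<lambda>y. H1 y - H2 y) S"
    by (rule has_jet_diff[OF J1 J2])
  have inward: "0 \<le> e \<bullet> ((H1 z - H2 z) *v e)" if e: "e \<bullet> (c - z) > 0" for e
  proof -
    obtain d where d: "d > 0" "\<And>t. \<bar>t\<bar> < d \<Longrightarrow> z + t *\<^sub>R e \<in> S" using ray_in_open[OF S, of e] by blast
    have e0: "e \<bullet> e > 0" using e by auto
    define \<delta> where "\<delta> = min d (2 * (e \<bullet> (c - z)) / (e \<bullet> e))"
    show ?thesis
    proof (rule second_order_along_ray[OF J S, of e \<delta>])
      show "\<delta> > 0" using d e e0 by (simp add: \<delta>_def)
      fix t assume t: "0 \<le> t" "t < \<delta>"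
      have "(dist (z + t *\<^sub>R e) c)\<^sup>2 = (dist z c)\<^sup>2 - t * (2 * (e \<bullet> (c - z)) - t * (e \<bullet> e))"
        by (simp add: dist_norm power2_norm_eq_inner inner_diff_left inner_diff_right inner_add_left
            inner_add_right inner_commute algebra_simps)
      moreover have "t * (e \<bullet> e) \<le> 2 * (e \<bullet> (c - z))"
        using t e0 by (simp add: \<delta>_def field_simps)
      then have "0 \<le> t * (2 * (e \<bullet> (c - z)) - t * (e \<bullet> e))" using t by (intro mult_nonneg_nonneg) auto
      ultimately have "(dist (z + t *\<^sub>R e) c)\<^sup>2 \<le> (dist z c)\<^sup>2" by linarith
      then have "dist (z + t *\<^sub>R e) c \<le> R" using R by (simp add: abs_le_square_iff[symmetric])
      then show "v1 z - v2 z \<le> v1 (z + t *\<^sub>R e) - v2 (z + t *\<^sub>R e)"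
        using above d(2)[of t] t touch by (simp add: \<delta>_def)
    qed (use touch in simp)
  qed
  let ?n = "c - z"
  let ?q = "\<lambda>e. e \<bullet> ((H1 z - H2 z) *v e)"
  have n: "?n \<bullet> ?n > 0" using R by auto
  consider "e \<bullet> ?n > 0" | "e \<bullet> ?n < 0" | "e \<bullet> ?n = 0" by linarith
  then show ?thesis
  proof cases
    case 2
    then have "0 \<le> ?q (- e)" by (intro inward) simp
    then show ?thesis by (simp add: linear_neg[OF matrix_vector_mul_linear])
  next
    case 3
    \<comment> \<open>tangential directions are limits of inward ones\<close>
    have "((\<lambda>t. ?q (e + t *\<^sub>R ?n)) \<longlongrightarrow> ?q (e + 0 *\<^sub>R ?n)) (at_right 0)"
      by (intro tendsto_intros bounded_linear.tendsto[OF matrix_vector_mul_bounded_linear])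
    moreover have "eventually (\<lambda>t. 0 \<le> ?q (e + t *\<^sub>R ?n)) (at_right 0)"
      using eventually_at_right_less[of 0]
    proof eventually_elim
      case (elim t)
      show ?case using 3 n elim by (intro inward) (simp add: inner_add_left)
    qed
    ultimately have "0 \<le> ?q (e + 0 *\<^sub>R ?n)"
      by (rule tendsto_lowerbound) simp
    then show ?thesis by simp
  qed (rule inward)
qed

text \<open>Hopf's lemma for the fully nonlinear operator, \<open>v1\<close> being the supersolution. The operator is linearised along the
  segment between the two matrices. At \<open>z\<close> their difference is a positive multiple of the difference of
  the Hessians, hence positive semidefinite, and \<open>segment_in_domain\<close> places the segment inside \<open>U\<close>; by continuity this
  persists near \<open>z\<close>. There \<open>v1 - v2\<close> is compared with a small multiple \<open>\<epsilon> h\<close> of the barrier on the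
  lens cut out of the ball by a small ball about \<open>z\<close>: at a negative interior minimum of
  \<open>v1 - v2 - \<epsilon> h\<close> the Hessian of \<open>h\<close> would violate the inequality assumed for \<open>F\<close>. Thus
  \<open>v1 - v2 \<ge> \<epsilon> h\<close>, and the inner normal derivative of \<open>h\<close> at \<open>z\<close> is positive while the gradients of \<open>v1\<close> and
  \<open>v2\<close> agree there. The multiple \<open>L\<close> of \<open>v1 - v2\<close> is harmless, whatever its sign, since \<open>v1 - v2 \<le> \<epsilon> h\<close> at such a
  minimum.\<close>

lemma boundary_point_lemma:
  fixes U :: "(real^'n^'n) set" and v1 v2 :: "real^'n \<Rightarrow> real"
  assumes U_open: "openin (top_of_set symmetric_mats) U"
    and U_conv: "\<And>M N. M \<in> symmetric_mats \<Longrightarrow> N \<in> posdef_mats \<Longrightarrow>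
        convex (U \<inter> {M + t *\<^sub>R N | t. 0 < t})"
    and C1: "C1_on_sym U F"
    and ell: "\<And>M. M \<in> U \<Longrightarrow> mat_partials F M \<in> posdef_mats"
    and S: "open S" "z \<in> S"
    and J1: "has_jet v1 G1 H1 S" and J2: "has_jet v2 G2 H2 S"
    and pos: "\<And>y. y \<in> S \<Longrightarrow> 0 < v1 y" "\<And>y. y \<in> S \<Longrightarrow> 0 < v2 y"
    and adm: "\<And>y. y \<in> S \<Longrightarrow> schouten (v1 y) (G1 y) (H1 y) \<in> U"
      "\<And>y. y \<in> S \<Longrightarrow> schouten (v2 y) (G2 y) (H2 y) \<in> U"
    and super: "\<And>y. y \<in> S \<Longrightarrow> dist y c \<le> R \<Longrightarrow> v2 y \<le> v1 y \<Longrightarrow>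
        F (schouten (v1 y) (G1 y) (H1 y)) - F (schouten (v2 y) (G2 y) (H2 y)) \<le> L * (v1 y - v2 y)"
    and touch: "v1 z = v2 z" "G1 z = G2 z"
    and R: "R > 0" "dist z c = R"
    and above: "\<And>y. y \<in> S \<Longrightarrow> dist y c \<le> R \<Longrightarrow> y \<noteq> z \<Longrightarrow> v2 y < v1 y"
  shows False
proof -
  define A1 where "A1 = (\<lambda>y. schouten (v1 y) (G1 y) (H1 y))"
  define A2 where "A2 = (\<lambda>y. schouten (v2 y) (G2 y) (H2 y))"
  define M where "M = (\<lambda>y \<theta>. (1 - \<theta>) *\<^sub>R A2 y + \<theta> *\<^sub>R A1 y)"
  have above': "v2 y \<le> v1 y" if "y \<in> S" "dist y c \<le> R" for y
    using above[OF that] touch by (cases "y = z") auto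
  have Usym: "U \<subseteq> symmetric_mats" using U_open openin_imp_subset by blast
  have sym: "H1 y \<in> symmetric_mats" "H2 y \<in> symmetric_mats" if y: "y \<in> S" for y
  proof -
    have *: "X \<in> symmetric_mats" if "schouten r g X \<in> U" "r > 0" for r g and X :: "real^'n^'n"
    proof -
      have "schouten r g X + (g \<bullet> g / 2) *\<^sub>R mat 1 \<in> symmetric_mats"
        using that Usym by (intro symmetric_mats_simps) auto
      then have "(1/r) *\<^sub>R (schouten r g X + (g \<bullet> g / 2) *\<^sub>R mat 1) \<in> symmetric_mats"
        by (rule symmetric_mats_simps)
      then show ?thesis using that by (simp add: schouten_def)
    qed
    show "H1 y \<in> symmetric_mats" "H2 y \<in> symmetric_mats"
      using *[OF adm(1)[OF y] pos(1)[OF y]] *[OF adm(2)[OF y] pos(2)[OF y]] by auto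
  qed
  have contA: "continuous_on S A1" "continuous_on S A2"
    unfolding A1_def A2_def schouten_def
    using has_jet_continuous[OF J1] has_jet_continuous[OF J2] by (intro continuous_intros; simp)+

  \<comment> \<open>the segment joining the two matrices at \<open>z\<close> lies in \<open>U\<close>, hence so do nearby segments\<close>
  have "A1 z - A2 z = v1 z *\<^sub>R (H1 z - H2 z)"
    using touch by (simp add: A1_def A2_def schouten_def scaleR_diff_right)
  then have psdz: "A1 z - A2 z \<in> psd_mats"
    using touching_hessian_psd[OF S J1 J2 touch R above'] pos[OF S(2)] sym[OF S(2)]
    by (auto simp: psd_mats_def intro!: symmetric_mats_simps simp flip: scaleR_matrix_vector_assoc)
  have segz: "M z \<theta> \<in> U" if "0 \<le> \<theta>" "\<theta> \<le> 1" for \<theta>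
    unfolding M_def
    by (rule segment_in_domain[OF U_open U_conv _ _ psdz that]) (use adm S in \<open>auto simp: A1_def A2_def\<close>)
  obtain T where T: "open T" "U = symmetric_mats \<inter> T"
    using U_open by (auto simp: openin_open)
  have "compact (M z ` {0..1})"
    unfolding M_def by (intro compact_continuous_image continuous_intros) auto
  moreover have "M z ` {0..1} \<subseteq> T" using segz T by auto
  ultimately obtain e where e: "e > 0" "\<And>X. X \<in> M z ` {0..1} \<Longrightarrow> ball X e \<subseteq> T"
    using compact_subset_open_imp_ball_epsilon_subset[OF _ T(1)] by (metis UN_subset_iff)
  obtain \<eta>0 where \<eta>0: "\<eta>0 > 0" "ball z \<eta>0 \<subseteq> S" using S open_contains_ball by blast
  obtain \<eta>1 where \<eta>1: "\<eta>1 > 0" "\<And>y. y \<in> S \<Longrightarrow> dist y z < \<eta>1 \<Longrightarrow> dist (A1 y) (A1 z) < e"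
    using contA(1) S(2) e(1) unfolding continuous_on_iff by metis
  obtain \<eta>2 where \<eta>2: "\<eta>2 > 0" "\<And>y. y \<in> S \<Longrightarrow> dist y z < \<eta>2 \<Longrightarrow> dist (A2 y) (A2 z) < e"
    using contA(2) S(2) e(1) unfolding continuous_on_iff by metis
  \<comment> \<open>\<open>\<eta> \<le> R/2\<close> keeps the lens away from the centre \<open>c\<close>, where the barrier is concave\<close>
  define \<eta> where "\<eta> = min (min \<eta>0 R) (min \<eta>1 \<eta>2) / 2"
  have \<eta>: "\<eta> > 0" "\<eta> < \<eta>0" "\<eta> \<le> R / 2" "\<eta> < \<eta>1" "\<eta> < \<eta>2"
    using \<eta>0 \<eta>1 \<eta>2 R by (auto simp: \<eta>_def)
  let ?B = "cball z \<eta>"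
  have BS: "?B \<subseteq> S" using \<eta> \<eta>0 by auto
  have MU: "M y \<theta> \<in> U" if y: "y \<in> ?B" and th: "0 \<le> \<theta>" "\<theta> \<le> 1" for y \<theta>
  proof -
    have yS: "y \<in> S" using BS y by blast
    have d: "norm (A1 y - A1 z) < e" "norm (A2 y - A2 z) < e"
      using \<eta>1(2)[OF yS] \<eta>2(2)[OF yS] \<eta> y by (auto simp: dist_norm norm_minus_commute)
    have "M y \<theta> - M z \<theta> = (1 - \<theta>) *\<^sub>R (A2 y - A2 z) + \<theta> *\<^sub>R (A1 y - A1 z)"
      by (simp add: M_def algebra_simps)
    also have "norm \<dots> \<le> (1 - \<theta>) * norm (A2 y - A2 z) + \<theta> * norm (A1 y - A1 z)"
      using norm_triangle_ineq[of "(1 - \<theta>) *\<^sub>R (A2 y - A2 z)" "\<theta> *\<^sub>R (A1 y - A1 z)"] th by simp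
    also have "\<dots> < e"
      using convex_bound_lt[OF d(2) d(1), of "1-\<theta>" \<theta>] th by simp
    finally have "M y \<theta> \<in> ball (M z \<theta>) e" by (simp add: dist_norm norm_minus_commute)
    then have "M y \<theta> \<in> T" using e(2)[of "M z \<theta>"] th by auto
    moreover have "M y \<theta> \<in> symmetric_mats"
      using adm yS Usym by (auto simp: M_def A1_def A2_def intro!: symmetric_mats_combine)
    ultimately show ?thesis using T by blast
  qed

  define C where "C = (\<lambda>(y, \<theta>). M y \<theta>) ` (?B \<times> {0..1})"
  have "continuous_on (?B \<times> {0..1}) (\<lambda>p. A1 (fst p))" "continuous_on (?B \<times> {0..1}) (\<lambda>p. A2 (fst p))"
    using BS by (auto intro!: continuous_on_compose2[OF contA(1)] continuous_on_compose2[OF contA(2)] continuous_intros)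
  then have "continuous_on (?B \<times> {0..1}) (\<lambda>(y, \<theta>). M y \<theta>)"
    unfolding M_def case_prod_beta' by (intro continuous_intros)
  then have C: "compact C" "C \<subseteq> U"
    using MU by (auto simp: C_def intro!: compact_continuous_image compact_Times)
  obtain \<kappa> K where K: "\<kappa> > 0" "K > 0" "\<And>X. X \<in> C \<Longrightarrow> norm (mat_partials F X) \<le> K"
    "\<And>X x. X \<in> C \<Longrightarrow> \<kappa> * (x \<bullet> x) \<le> x \<bullet> (mat_partials F X *v x)"
    using uniform_ellipticity[OF C1 ell C] by blast
  have cB: "compact ?B" "?B \<noteq> {}" using \<eta> by auto
  have cont1: "continuous_on ?B v1" "continuous_on ?B v2" "continuous_on ?B G1" "continuous_on ?B G2" "continuous_on ?B H2"
    using has_jet_continuous[OF has_jet_subset[OF J1 BS]] has_jet_continuous[OF has_jet_subset[OF J2 BS]] by auto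
  obtain y0 where y0: "y0 \<in> ?B" "\<And>y. y \<in> ?B \<Longrightarrow> v1 y0 \<le> v1 y"
    using continuous_attains_inf[OF cB cont1(1)] by blast
  define m where "m = v1 y0"
  have m: "m > 0" "\<And>y. y \<in> ?B \<Longrightarrow> m \<le> v1 y" using y0 pos BS by (auto simp: m_def)
  obtain C2 where C2: "C2 > 0" "\<And>y. y \<in> ?B \<Longrightarrow> norm (H2 y) \<le> C2"
    using compact_imp_bounded[OF compact_continuous_image[OF cont1(5) cB(1)]] by (force simp: bounded_pos)
  have "continuous_on ?B (\<lambda>y. G1 y + G2 y)" by (intro continuous_intros cont1)
  then obtain C3 where C3: "C3 > 0" "\<And>y. y \<in> ?B \<Longrightarrow> norm (G1 y + G2 y) \<le> C3"
    using compact_imp_bounded[OF compact_continuous_image[OF _ cB(1)]] by (force simp: bounded_pos)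
  define K' where "K' = K * norm (mat 1 :: real^'n^'n)"
  have K': "K' \<ge> 0" using K by (simp add: K'_def)
  obtain \<alpha> where \<alpha>: "\<alpha> > 0"
    "(m * \<kappa> * R\<^sup>2) * \<alpha>\<^sup>2 > (2 * m * K' + R * C3 * K') * \<alpha> + (\<bar>L\<bar> + K * C2)"
    using large_parameter[of "m * \<kappa> * R\<^sup>2"] m K R by (metis mult_pos_pos zero_less_power)
  \<comment> \<open>up to the common factor \<open>\<epsilon> exp(-\<alpha> |y-c|\<^sup>2)\<close>, \<open>m * Q\<close> bounds the second order terms from
    below and the other side of \<open>Q1\<close> bounds the lower order terms\<close>
  define Q where "Q = \<alpha>\<^sup>2 * \<kappa> * R\<^sup>2 - 2 * \<alpha> * K'"
  have Q1: "m * Q > \<bar>L\<bar> + K * C2 + \<alpha> * R * C3 * K'"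
    using \<alpha>(2) by (simp add: Q_def algebra_simps)
  have "0 \<le> \<bar>L\<bar> + K * C2 + \<alpha> * R * C3 * K'" using K C2 C3 \<alpha> R K' by simp
  then have Q0: "Q > 0" using Q1 m by (smt (verit) zero_less_mult_pos)

  define h where "h = (hopf_barrier \<alpha> R c :: real^'n \<Rightarrow> real)"
  define \<omega> where "\<omega> = hopf_weight \<alpha> c"
  define Gh where "Gh = (\<lambda>y. (- 2 * \<alpha> * \<omega> y) *\<^sub>R (y - c))"
  define Hh where "Hh = (\<lambda>y. \<omega> y *\<^sub>R ((4 * \<alpha>\<^sup>2) *\<^sub>R tensor (y - c) (y - c) - (2 * \<alpha>) *\<^sub>R mat 1))"
  have Jh: "has_jet h Gh Hh UNIV"
    using hopf_barrier_jet[of \<alpha> R c] unfolding h_def Gh_def Hh_def \<omega>_def .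
  have h\<omega>: "h y \<le> \<omega> y" "h y \<le> 1" "\<omega> y > 0" for y
  proof -
    have "\<omega> y \<le> 1" using \<alpha> by (simp add: \<omega>_def hopf_weight_def)
    moreover have "h y < \<omega> y" by (simp add: h_def hopf_barrier_def \<omega>_def)
    moreover have "\<omega> y > 0" by (simp add: \<omega>_def hopf_weight_def)
    ultimately show "h y \<le> \<omega> y" "h y \<le> 1" "\<omega> y > 0" by linarith+
  qed
  have h0: "h y = 0" if "dist y c = R" for y
    using that by (simp add: h_def hopf_barrier_def hopf_weight_def dist_norm power2_norm_eq_inner[symmetric])

  let ?D = "?B \<inter> cball c R"
  let ?T = "sphere z \<eta> \<inter> cball c R"
  have "\<exists>\<epsilon>>0. \<forall>y\<in>?T. \<epsilon> \<le> v1 y - v2 y"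
  proof (cases "?T = {}")
    case False
    have TS: "?T \<subseteq> ?B" by auto
    have "compact ?T" by (intro compact_Int_closed) auto
    moreover have "continuous_on ?T (\<lambda>y. v1 y - v2 y)"
      by (intro continuous_intros continuous_on_subset[OF cont1(1) TS] continuous_on_subset[OF cont1(2) TS])
    ultimately obtain t where t: "t \<in> ?T" "\<And>y. y \<in> ?T \<Longrightarrow> v1 t - v2 t \<le> v1 y - v2 y"
      using continuous_attains_inf[of ?T "\<lambda>y. v1 y - v2 y"] False by blast
    have "v2 t < v1 t" using t(1) \<eta> BS by (intro above) (auto simp: dist_commute)
    then show ?thesis using t by (intro exI[of _ "v1 t - v2 t"]) auto
  qed (auto intro: exI[of _ 1])
  then obtain \<epsilon> where \<epsilon>: "\<epsilon> > 0" "\<And>y. y \<in> ?T \<Longrightarrow> \<epsilon> \<le> v1 y - v2 y" by blast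
  define g where "g = (\<lambda>y. (v1 y - v2 y) - \<epsilon> * h y)"
  have Jg: "has_jet g (\<lambda>y. (G1 y - G2 y) - \<epsilon> *\<^sub>R Gh y) (\<lambda>y. (H1 y - H2 y) - \<epsilon> *\<^sub>R Hh y) S"
    unfolding g_def
    by (intro has_jet_diff J1 J2 has_jet_scale has_jet_subset[OF Jh]) auto

  \<comment> \<open>on the lens the difference dominates the barrier\<close>
  have g_nonneg: "0 \<le> g y" if y: "y \<in> ?D" for y
  proof (rule ccontr)
    assume neg: "\<not> 0 \<le> g y"
    have DS: "?D \<subseteq> S" using BS by blast
    have "compact ?D" by (intro compact_Int_closed) auto
    moreover have "continuous_on ?D g"
      using continuous_on_subset[OF has_jet_continuous(1)[OF Jg] DS] .
    ultimately obtain w where w: "w \<in> ?D" "\<And>y. y \<in> ?D \<Longrightarrow> g w \<le> g y"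
      using continuous_attains_inf[of ?D g] y by blast
    have gw: "g w < 0" using w(2)[OF y] neg by linarith
    have wS: "w \<in> S" using w DS by blast
    have dw: "dist w c \<le> R" "dist z w \<le> \<eta>" using w by (auto simp: dist_commute)
    have W0: "v2 w \<le> v1 w" using above' wS dw by blast
    have "dist w c \<noteq> R" using gw h0 W0 by (auto simp: g_def)
    moreover have "dist z w \<noteq> \<eta>"
    proof
      assume "dist z w = \<eta>"
      then have "\<epsilon> \<le> v1 w - v2 w" using w by (intro \<epsilon>) auto
      moreover have "\<epsilon> * h w \<le> \<epsilon> * 1" using h\<omega> \<epsilon> by (intro mult_left_mono) auto
      ultimately show False using gw by (simp add: g_def)
    qed
    ultimately have wI: "w \<in> ball z \<eta> \<inter> ball c R" using dw by (auto simp: dist_commute)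
    have IS: "ball z \<eta> \<inter> ball c R \<subseteq> S" using BS by auto
    have op: "open (ball z \<eta> \<inter> ball c R)" by auto
    note Jg' = has_jet_subset[OF Jg IS]
    have wmin: "g w \<le> g y" if "y \<in> ball z \<eta> \<inter> ball c R" for y
      using w(2) that by auto
    have grad: "G1 w - G2 w = \<epsilon> *\<^sub>R Gh w"
      using gradient_zero_at_min[OF Jg' op wI wmin] by simp
    define P where "P = (H1 w - H2 w) - \<epsilon> *\<^sub>R Hh w"
    have P: "P \<in> psd_mats"
      using hessian_psd_at_min[OF Jg' op wI wmin] sym[OF wS] unfolding P_def psd_mats_def Hh_def
      by (auto intro!: symmetric_mats_simps)
    define W where "W = v1 w - v2 w"
    have W: "0 \<le> W" "W \<le> \<epsilon> * \<omega> w"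
    proof -
      show "0 \<le> W" using W0 by (simp add: W_def)
      have "\<epsilon> * h w \<le> \<epsilon> * \<omega> w" using h\<omega> \<epsilon> by (intro mult_left_mono) auto
      then show "W \<le> \<epsilon> * \<omega> w" using gw by (simp add: g_def W_def)
    qed
    have wB: "w \<in> ?B" using wI by auto
    have "\<exists>\<theta>. 0 < \<theta> \<and> \<theta> < 1 \<and> F (A1 w) - F (A2 w) = mat_partials F (M w \<theta>) \<bullet> (A1 w - A2 w)"
      unfolding M_def using segment_mean_value[OF U_open C1 MU[OF wB, unfolded M_def]] by blast
    then obtain \<theta> where \<theta>: "0 < \<theta>" "\<theta> < 1" "F (A1 w) - F (A2 w) = mat_partials F (M w \<theta>) \<bullet> (A1 w - A2 w)"
      by blast
    define a where "a = mat_partials F (M w \<theta>)"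
    have MC: "M w \<theta> \<in> C" using \<theta> wB by (auto simp: C_def intro!: image_eqI[of _ _ "(w, \<theta>)"])
    have a: "a \<in> psd_mats" "norm a \<le> K" "\<And>x. \<kappa> * (x \<bullet> x) \<le> x \<bullet> (a *v x)"
      using K MC C posdef_imp_psd[OF ell] by (auto simp: a_def)
    have aD: "a \<bullet> (A1 w - A2 w) \<le> L * W"
      using super[OF wS dw(1) W0] \<theta>(3) by (simp add: a_def A1_def A2_def W_def)
    define d where "d = w - c"
    have r: "norm d \<le> R" "R / 2 \<le> norm d"
    proof -
      show "norm d \<le> R" using dw by (simp add: d_def dist_norm)
      have "dist z c \<le> dist z w + dist w c" by (rule dist_triangle)
      then show "R / 2 \<le> norm d" using R dw \<eta> by (simp add: d_def dist_norm)
    qed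
    have aI: "\<bar>a \<bullet> mat 1\<bar> \<le> K'" unfolding K'_def using a K by (intro abs_inner_le) auto
    \<comment> \<open>the difference of the squared gradients is linear in the gradient of the barrier\<close>
    have split: "A1 w - A2 w = v1 w *\<^sub>R (P + \<epsilon> *\<^sub>R Hh w) + W *\<^sub>R H2 w
        - (((G1 w + G2 w) \<bullet> (\<epsilon> *\<^sub>R Gh w)) / 2) *\<^sub>R mat 1"
    proof -
      have i1: "(G1 w + G2 w) \<bullet> (\<epsilon> *\<^sub>R Gh w) = G1 w \<bullet> G1 w - G2 w \<bullet> G2 w"
        unfolding grad[symmetric]
        by (simp add: inner_add_left inner_diff_right inner_commute[of "G2 w" "G1 w"])
      have i2: "P + \<epsilon> *\<^sub>R Hh w = H1 w - H2 w" by (simp add: P_def)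
      show ?thesis
        unfolding i1 i2
        by (simp add: A1_def A2_def schouten_def W_def algebra_simps diff_divide_distrib)
    qed
    have "a \<bullet> (A1 w - A2 w) = v1 w * (a \<bullet> P) + v1 w * \<epsilon> * (a \<bullet> Hh w) + W * (a \<bullet> H2 w)
        - ((G1 w + G2 w) \<bullet> (\<epsilon> *\<^sub>R Gh w)) / 2 * (a \<bullet> mat 1)"
      unfolding split by (simp add: inner_add_right inner_diff_right algebra_simps)
    moreover have "0 \<le> v1 w * (a \<bullet> P)"
      using psd_inner_nonneg[OF a(1) P] pos[OF wS] by simp
    moreover have "m * \<epsilon> * (\<omega> w * Q) \<le> v1 w * \<epsilon> * (a \<bullet> Hh w)"
    proof -
      have "R\<^sup>2 \<le> 4 * (d \<bullet> d)"
        using power_mono[OF r(2), of 2] R by (simp add: power_divide power2_norm_eq_inner)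
      then have "\<alpha>\<^sup>2 * \<kappa> * R\<^sup>2 \<le> \<alpha>\<^sup>2 * \<kappa> * (4 * (d \<bullet> d))" using \<alpha> K by (intro mult_left_mono) auto
      also have "\<dots> = 4 * \<alpha>\<^sup>2 * (\<kappa> * (d \<bullet> d))" by simp
      also have "\<dots> \<le> 4 * \<alpha>\<^sup>2 * (d \<bullet> (a *v d))" using a(3) by (intro mult_left_mono) auto
      finally have 1: "\<alpha>\<^sup>2 * \<kappa> * R\<^sup>2 \<le> 4 * \<alpha>\<^sup>2 * (d \<bullet> (a *v d))" .
      have 2: "2 * \<alpha> * (a \<bullet> mat 1) \<le> 2 * \<alpha> * K'" using aI \<alpha> by (intro mult_left_mono) auto
      have "a \<bullet> Hh w = \<omega> w * (4 * \<alpha>\<^sup>2 * (d \<bullet> (a *v d)) - 2 * \<alpha> * (a \<bullet> mat 1))"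
        by (simp add: Hh_def inner_diff_right inner_tensor d_def)
      then have "\<omega> w * Q \<le> a \<bullet> Hh w"
        using 1 2 h\<omega>(3)[of w] by (simp add: Q_def)
      moreover have "0 \<le> \<omega> w * Q" using h\<omega>(3)[of w] Q0 by simp
      ultimately show ?thesis
        using m wB \<epsilon> pos[OF wS] by (intro mult_mono) auto
    qed
    moreover have "- (W * (K * C2)) \<le> W * (a \<bullet> H2 w)"
    proof -
      have "\<bar>a \<bullet> H2 w\<bar> \<le> K * C2" using a(2) C2(2)[OF wB] K by (intro abs_inner_le) auto
      then have "W * (- (K * C2)) \<le> W * (a \<bullet> H2 w)" using W by (intro mult_left_mono) auto
      then show ?thesis by simp
    qed
    moreover have "((G1 w + G2 w) \<bullet> (\<epsilon> *\<^sub>R Gh w)) / 2 * (a \<bullet> mat 1) \<le> \<epsilon> * \<omega> w * (\<alpha> * R * C3 * K')"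
    proof -
      have "norm (\<epsilon> *\<^sub>R Gh w) = \<epsilon> * (2 * \<alpha> * \<omega> w) * norm d"
        using \<epsilon> \<alpha> h\<omega>(3)[of w] by (simp add: Gh_def d_def abs_mult)
      also have "\<dots> \<le> \<epsilon> * (2 * \<alpha> * \<omega> w) * R"
        using r \<epsilon> \<alpha> h\<omega>(3)[of w] by (intro mult_left_mono) auto
      finally have "\<bar>(G1 w + G2 w) \<bullet> (\<epsilon> *\<^sub>R Gh w)\<bar> \<le> C3 * (\<epsilon> * (2 * \<alpha> * \<omega> w) * R)"
        using C3 wB by (intro abs_inner_le) auto
      then have "\<bar>((G1 w + G2 w) \<bullet> (\<epsilon> *\<^sub>R Gh w)) / 2\<bar> \<le> \<epsilon> * \<omega> w * \<alpha> * R * C3"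
        by (simp add: algebra_simps)
      then have "\<bar>((G1 w + G2 w) \<bullet> (\<epsilon> *\<^sub>R Gh w)) / 2 * (a \<bullet> mat 1)\<bar> \<le> (\<epsilon> * \<omega> w * \<alpha> * R * C3) * K'"
        unfolding abs_mult using aI by (intro mult_mono) auto
      then show ?thesis by (simp add: algebra_simps)
    qed
    ultimately have "m * \<epsilon> * (\<omega> w * Q) \<le> L * W + W * (K * C2) + \<epsilon> * \<omega> w * (\<alpha> * R * C3 * K')"
      using aD by linarith
    also have "\<dots> \<le> \<bar>L\<bar> * (\<epsilon> * \<omega> w) + (\<epsilon> * \<omega> w) * (K * C2) + \<epsilon> * \<omega> w * (\<alpha> * R * C3 * K')"
    proof -
      have "L * W \<le> \<bar>L\<bar> * W" using W by (intro mult_right_mono) auto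
      also have "\<dots> \<le> \<bar>L\<bar> * (\<epsilon> * \<omega> w)" using W by (intro mult_left_mono) auto
      finally have "L * W \<le> \<bar>L\<bar> * (\<epsilon> * \<omega> w)" .
      moreover have "W * (K * C2) \<le> (\<epsilon> * \<omega> w) * (K * C2)"
        using W K C2 by (intro mult_right_mono) auto
      ultimately show ?thesis by linarith
    qed
    finally have "(\<epsilon> * \<omega> w) * (m * Q) \<le> (\<epsilon> * \<omega> w) * (\<bar>L\<bar> + K * C2 + \<alpha> * R * C3 * K')"
      by (simp add: algebra_simps)
    then show False using Q1 \<epsilon> h\<omega>(3)[of w] by simp
  qed

  \<comment> \<open>so the inner normal derivative of the difference at \<open>z\<close> is positive\<close>
  let ?n = "c - z"
  have "((\<lambda>t. g (z + t *\<^sub>R ?n)) has_real_derivative ((G1 z - G2 z) - \<epsilon> *\<^sub>R Gh z) \<bullet> ?n) (at 0)"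
    using jet_along_line(1)[OF Jg, of z 0 ?n] S by simp
  moreover have "((G1 z - G2 z) - \<epsilon> *\<^sub>R Gh z) \<bullet> ?n < 0"
  proof -
    have "((G1 z - G2 z) - \<epsilon> *\<^sub>R Gh z) \<bullet> ?n = - (\<epsilon> * (2 * \<alpha> * \<omega> z) * (?n \<bullet> ?n))"
      using touch by (simp add: Gh_def inner_diff_left inner_diff_right inner_commute algebra_simps)
    moreover have "?n \<bullet> ?n > 0" using R by auto
    ultimately show ?thesis using \<epsilon> \<alpha> h\<omega>(3)[of z] by simp
  qed
  ultimately have "\<exists>d>0. \<forall>t>0. t < d \<longrightarrow> g (z + (0 + t) *\<^sub>R ?n) < g (z + 0 *\<^sub>R ?n)"
    by (rule DERIV_neg_dec_right)
  then obtain d where d: "d > 0" "\<And>t. 0 < t \<Longrightarrow> t < d \<Longrightarrow> g (z + t *\<^sub>R ?n) < g z" by auto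
  define t where "t = min d (\<eta> / R) / 2"
  have t: "t > 0" "t < d" "t * R \<le> \<eta>" "t \<le> 1"
  proof -
    show "t > 0" "t < d" using d \<eta> R by (auto simp: t_def)
    have "0 < \<eta> / R" using \<eta>(1) R(1) by simp
    moreover have "min d b / 2 \<le> b" if "0 < b" for b using that by (auto simp: min_def)
    ultimately have le: "t \<le> \<eta> / R" unfolding t_def by blast
    then show "t * R \<le> \<eta>" using R by (simp add: pos_le_divide_eq)
    have "\<eta> / R \<le> 1" using \<eta> R by simp
    then show "t \<le> 1" using le by linarith
  qed
  have gz: "g z = 0" using touch h0[OF R(2)] by (simp add: g_def)
  have nR: "norm ?n = R" using R by (simp add: dist_norm norm_minus_commute)
  have "dist z (z + t *\<^sub>R ?n) = t * R" using t nR by (simp add: dist_norm)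
  moreover have "dist c (z + t *\<^sub>R ?n) = (1 - t) * R"
  proof -
    have "c - (z + t *\<^sub>R ?n) = (1 - t) *\<^sub>R ?n" by (simp add: algebra_simps)
    then show ?thesis using t nR by (simp add: dist_norm)
  qed
  moreover have "(1 - t) * R \<le> R" using t R by simp
  ultimately have "0 \<le> g (z + t *\<^sub>R ?n)" using t by (intro g_nonneg) auto
  then show False using d(2)[of t] t gz by simp
qed

section \<open>Moving spheres\<close>

lemma compact_continuous_bound:
  assumes "compact K" "continuous_on K f"
  obtains B where "\<And>x. x \<in> K \<Longrightarrow> norm (f x) \<le> B"
proof -
  have "bounded (f ` K)" using assms by (intro compact_imp_bounded compact_continuous_image)
  then show ?thesis using that by (auto simp: bounded_iff)
qed

lemma powr_lipschitz:
  fixes q m M :: real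
  assumes "0 < m" "q \<ge> 0"
  obtains L where "\<And>a b. m \<le> a \<Longrightarrow> a \<le> b \<Longrightarrow> b \<le> M \<Longrightarrow> b powr q - a powr q \<le> L * (b - a)"
proof -
  have "continuous_on {m..M} (\<lambda>x. x powr (q - 1))"
    using assms by (intro continuous_intros) auto
  then obtain B where B: "\<And>x. x \<in> {m..M} \<Longrightarrow> norm (x powr (q - 1)) \<le> B"
    using compact_continuous_bound[OF compact_Icc] by blast
  have "b powr q - a powr q \<le> (q * B) * (b - a)" if ab: "m \<le> a" "a \<le> b" "b \<le> M" for a b
  proof (cases "a = b")
    case False
    have "\<exists>z. a < z \<and> z < b \<and> b powr q - a powr q = (b - a) * (q * z powr (q - 1))"
      using ab False assms by (intro MVT2) (auto intro!: derivative_eq_intros)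
    then obtain z where z: "a < z" "z < b" "b powr q - a powr q = (b - a) * (q * z powr (q - 1))" by blast
    have "z powr (q - 1) \<le> B" using B[of z] z ab by simp
    then have "(b - a) * (q * z powr (q - 1)) \<le> (b - a) * (q * B)"
      using ab assms by (intro mult_left_mono) auto
    then show ?thesis using z by (simp add: algebra_simps)
  qed simp
  then show ?thesis using that by blast
qed

lemma kelvin_polar:
  assumes "t > 0" "norm \<theta> = 1"
  shows "kelvin \<rho> v (t *\<^sub>R \<theta>) = t\<^sup>2 / \<rho>\<^sup>2 * v ((\<rho>\<^sup>2 / t) *\<^sub>R \<theta>)"
proof -
  have "\<theta> \<bullet> \<theta> = 1" using assms by (simp add: norm_eq_1)
  then show ?thesis using assms
    by (simp add: kelvin_def sphere_inv_def power2_eq_square)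
qed

lemma kelvin_fixed: "norm y = \<rho> \<Longrightarrow> \<rho> > 0 \<Longrightarrow> kelvin \<rho> v y = v y"
  by (auto simp: kelvin_def sphere_inv_def power2_norm_eq_inner)

text \<open>The quotient \<open>v(r \<theta>)/r\<close> is the right quantity on a ray: in terms of it the Kelvin transform is
  the plain reflection \<open>r \<mapsto> \<rho>\<^sup>2/r\<close>, as \<open>kelvin_le_iff\<close> expresses, and the hypothesis bounds its radial
  derivative.\<close>

lemma radial_decreasing:
  assumes J: "has_jet v G H UNIV" and st: "0 < s" "s \<le> t"
    and neg: "\<And>r. s \<le> r \<Longrightarrow> r \<le> t \<Longrightarrow> (r *\<^sub>R \<theta>) \<bullet> G (r *\<^sub>R \<theta>) \<le> v (r *\<^sub>R \<theta>)"
  shows "v (t *\<^sub>R \<theta>) / t \<le> v (s *\<^sub>R \<theta>) / s"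
proof (rule DERIV_nonpos_imp_nonincreasing[OF st(2)])
  fix r assume r: "s \<le> r" "r \<le> t"
  have "((\<lambda>r. v (r *\<^sub>R \<theta>)) has_real_derivative (G (r *\<^sub>R \<theta>) \<bullet> \<theta>)) (at r)"
    using jet_along_line(1)[OF J, of 0 r \<theta>] by simp
  then have "((\<lambda>r. v (r *\<^sub>R \<theta>) / r) has_real_derivative
      ((G (r *\<^sub>R \<theta>) \<bullet> \<theta>) * r - v (r *\<^sub>R \<theta>) * 1) / (r * r)) (at r)"
    using r st by (intro DERIV_divide) auto
  moreover have "((G (r *\<^sub>R \<theta>) \<bullet> \<theta>) * r - v (r *\<^sub>R \<theta>) * 1) / (r * r) \<le> 0"
    using neg[OF r] r st by (intro divide_nonpos_pos) (auto simp: inner_commute mult.commute)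
  ultimately show "\<exists>y. ((\<lambda>r. v (r *\<^sub>R \<theta>) / r) has_real_derivative y) (at r) \<and> y \<le> 0" by blast
qed

lemma kelvin_le_iff:
  assumes "t > 0" "norm \<theta> = 1" "\<rho> > 0"
  shows "v (t *\<^sub>R \<theta>) \<le> kelvin \<rho> v (t *\<^sub>R \<theta>) \<longleftrightarrow>
    v (t *\<^sub>R \<theta>) / t \<le> v ((\<rho>\<^sup>2 / t) *\<^sub>R \<theta>) / (\<rho>\<^sup>2 / t)"
  using assms by (simp add: kelvin_polar field_simps power2_eq_square)

lemma polar_form:
  assumes "y \<noteq> (0::'a::real_inner)"
  obtains \<theta> where "norm \<theta> = 1" "y = norm y *\<^sub>R \<theta>"
  using that[of "y /\<^sub>R norm y"] assms by simp

text \<open>Near the centre \<open>v(r \<theta>)/r\<close> decreases because \<open>v\<close> is positive there. Away from the centre \<open>v\<close> is at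
  most a multiple of \<open>|y|\<^sup>2\<close>, whereas the Kelvin transform is at least \<open>|y|\<^sup>2/l\<^sup>2\<close> times the
  minimum of \<open>v\<close> near the centre.\<close>

lemma moving_sphere_start:
  fixes v :: "real^'n \<Rightarrow> real"
  assumes J: "has_jet v G H UNIV" and pos: "\<And>x. 0 < v x"
    and growth: "\<And>y. R0 \<le> norm y \<Longrightarrow> v y \<le> b * (y \<bullet> y)"
  obtains l0 where "l0 > 0"
    "\<And>l y. 0 < l \<Longrightarrow> l < l0 \<Longrightarrow> l \<le> norm y \<Longrightarrow> v y \<le> kelvin l v y"
proof -
  note cont = has_jet_continuous[OF J]
  have "continuous_on UNIV (\<lambda>y. v y - y \<bullet> G y)" by (intro continuous_intros cont)
  then have "\<exists>d>0. \<forall>y. dist y 0 < d \<longrightarrow> dist (v y - y \<bullet> G y) (v 0) < v 0"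
    using pos[of 0] unfolding continuous_on_iff by fastforce
  then obtain d where d: "d > 0" "\<And>y. norm y < d \<Longrightarrow> dist (v y - y \<bullet> G y) (v 0) < v 0" by auto
  define r0 where "r0 = d / 2"
  have r0: "r0 > 0" "\<And>y. norm y \<le> r0 \<Longrightarrow> y \<bullet> G y \<le> v y"
  proof -
    show "r0 > 0" using d by (simp add: r0_def)
    fix y :: "real^'n" assume "norm y \<le> r0"
    then have "dist (v y - y \<bullet> G y) (v 0) < v 0" using d by (intro d(2)) (simp add: r0_def)
    then show "y \<bullet> G y \<le> v y" by (simp add: dist_real_def)
  qed
  have "compact (cball (0::real^'n) r0)" "cball (0::real^'n) r0 \<noteq> {}" using r0 by auto
  then obtain x0 where x0: "\<And>y. y \<in> cball 0 r0 \<Longrightarrow> v x0 \<le> v y"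
    using continuous_attains_inf continuous_on_subset[OF cont(1)] by (metis subset_UNIV)
  define m where "m = v x0"
  have m: "m > 0" "\<And>y. norm y \<le> r0 \<Longrightarrow> m \<le> v y" using x0 pos by (auto simp: m_def)
  obtain B where B: "\<And>y. y \<in> cball 0 R0 \<Longrightarrow> norm (v y) \<le> B"
    using compact_continuous_bound[OF compact_cball continuous_on_subset[OF cont(1) subset_UNIV]] by blast
  define C where "C = \<bar>b\<bar> + \<bar>B\<bar> / r0\<^sup>2 + 1"
  have C: "C > 0" by (simp add: C_def add_nonneg_pos)
  have vC: "v y \<le> C * (y \<bullet> y)" if y: "r0 \<le> norm y" for y
  proof (cases "R0 \<le> norm y")
    case True
    have "b \<le> C" using r0 by (auto simp: C_def intro: order_trans[OF abs_ge_self] add_increasing2)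
    then have "b * (y \<bullet> y) \<le> C * (y \<bullet> y)" by (intro mult_right_mono) auto
    then show ?thesis using growth[OF True] by linarith
  next
    case False
    have "v y \<le> \<bar>B\<bar>" using B[of y] False by simp
    also have "\<dots> = \<bar>B\<bar> / r0\<^sup>2 * r0\<^sup>2" using r0 by simp
    also have "\<dots> \<le> C * (y \<bullet> y)"
    proof (intro mult_mono)
      show "\<bar>B\<bar> / r0\<^sup>2 \<le> C" by (simp add: C_def)
      show "r0\<^sup>2 \<le> y \<bullet> y" using power_mono[OF y, of 2] r0 by (simp add: power2_norm_eq_inner)
    qed (use C in auto)
    finally show ?thesis .
  qed
  define l0 where "l0 = min r0 (sqrt (m / C))"
  have l0: "l0 > 0" using r0 m C by (simp add: l0_def)
  have "v y \<le> kelvin l v y" if l: "0 < l" "l < l0" and y: "l \<le> norm y" for l y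
  proof -
    define t where "t = norm y"
    have t: "t > 0" "l \<le> t" using l y by (auto simp: t_def)
    then have "y \<noteq> 0" by (auto simp: t_def)
    then obtain \<theta> where th: "norm \<theta> = 1" "y = t *\<^sub>R \<theta>" using polar_form t_def by metis
    have l2t: "l\<^sup>2 / t \<le> l" using t l by (simp add: field_simps power2_eq_square)
    show ?thesis
    proof (cases "t \<le> r0")
      case True
      have "v (t *\<^sub>R \<theta>) / t \<le> v ((l\<^sup>2 / t) *\<^sub>R \<theta>) / (l\<^sup>2 / t)"
      proof (rule radial_decreasing[OF J])
        show "0 < l\<^sup>2 / t" "l\<^sup>2 / t \<le> t" using t l l2t by auto
        fix r assume "l\<^sup>2 / t \<le> r" "r \<le> t"
        moreover have "0 < l\<^sup>2 / t" using t l by simp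
        ultimately show "r *\<^sub>R \<theta> \<bullet> G (r *\<^sub>R \<theta>) \<le> v (r *\<^sub>R \<theta>)"
          using True th by (intro r0) simp
      qed
      then show ?thesis using kelvin_le_iff[OF t(1) th(1) l(1)] th by metis
    next
      case False
      have "C * l\<^sup>2 \<le> m"
      proof -
        have "l\<^sup>2 \<le> (sqrt (m / C))\<^sup>2" using l by (intro power_mono) (auto simp: l0_def)
        then show ?thesis using m C by (simp add: field_simps)
      qed
      moreover have "m \<le> v ((l\<^sup>2 / t) *\<^sub>R \<theta>)"
        using l2t l t th by (intro m) (simp add: l0_def)
      ultimately have "C * l\<^sup>2 \<le> v ((l\<^sup>2 / t) *\<^sub>R \<theta>)" by linarith
      then have "t\<^sup>2 / l\<^sup>2 * (C * l\<^sup>2) \<le> t\<^sup>2 / l\<^sup>2 * v ((l\<^sup>2 / t) *\<^sub>R \<theta>)"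
        by (intro mult_left_mono) auto
      moreover have "v y \<le> C * t\<^sup>2" using vC[of y] False by (simp add: t_def power2_norm_eq_inner)
      ultimately show ?thesis using l kelvin_polar[OF t(1) th(1), of l v] th by (simp add: mult.commute)
    qed
  qed
  then show ?thesis using that l0 by blast
qed

locale elliptic_operator =
  fixes U :: "(real^'n^'n) set" and F :: "real^'n^'n \<Rightarrow> real"
  assumes U_open: "openin (top_of_set symmetric_mats) U"
    and U_inv: "\<And>Q :: real^'n^'n. orthogonal_matrix Q \<Longrightarrow> (\<lambda>M. matrix_inv Q ** M ** Q) ` U = U"
    and U_conv: "\<And>M N. M \<in> symmetric_mats \<Longrightarrow> N \<in> posdef_mats \<Longrightarrow>
        convex (U \<inter> {M + t *\<^sub>R N | t. 0 < t})"
    and F_C1: "C1_on_sym U F"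
    and F_inv: "\<And>M Q. M \<in> U \<Longrightarrow> orthogonal_matrix Q \<Longrightarrow> F (matrix_inv Q ** M ** Q) = F M"
    and F_elliptic: "\<And>M. M \<in> U \<Longrightarrow> mat_partials F M \<in> posdef_mats"

locale conformal_solution = elliptic_operator U F
  for U :: "(real^'n^'n) set" and F +
  fixes v :: "real^'n \<Rightarrow> real" and G H and q :: real
  assumes J: "has_jet v G H UNIV" and pos: "\<And>x. 0 < v x"
    and adm: "\<And>x. schouten (v x) (G x) (H x) \<in> U"
    and eq: "\<And>x. F (schouten (v x) (G x) (H x)) = v x powr q"
    and q: "0 \<le> q"
begin

lemma kelvin_pos: "y \<noteq> 0 \<Longrightarrow> l > 0 \<Longrightarrow> 0 < kelvin l v y"
  using pos by (simp add: kelvin_def)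

lemma kelvin_admissible:
  assumes "y \<noteq> 0" "l > 0"
  shows "schouten (kelvin l v y) (kelvin_grad l v G y) (kelvin_hess l v G H y) \<in> U"
  unfolding schouten_kelvin[OF assms]
  using U_inv[OF refl_mat_orthogonal[OF assms(1)]] adm by blast

text \<open>By conformal invariance the left hand side is \<open>v\<^sup>q\<close> at the inverse point, and outside the sphere
  the conformal factor \<open>|y|\<^sup>2/l\<^sup>2\<close> is at least \<open>1\<close>.\<close>

lemma kelvin_supersolution:
  assumes "l \<le> norm y" "l > 0"
  shows "F (schouten (kelvin l v y) (kelvin_grad l v G y) (kelvin_hess l v G H y)) \<le> kelvin l v y powr q"
proof -
  have y: "y \<noteq> 0" using assms by auto
  have "F (schouten (kelvin l v y) (kelvin_grad l v G y) (kelvin_hess l v G H y)) = v (sphere_inv l y) powr q"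
    unfolding schouten_kelvin[OF y assms(2)]
    using F_inv[OF adm refl_mat_orthogonal[OF y]] eq by simp
  also have "\<dots> \<le> kelvin l v y powr q"
  proof (rule powr_mono2[OF q])
    have "l\<^sup>2 \<le> y \<bullet> y" using power_mono[OF assms(1), of 2] assms by (simp add: power2_norm_eq_inner)
    then have "1 \<le> (y \<bullet> y) / l\<^sup>2" using assms by simp
    then have "1 * v (sphere_inv l y) \<le> (y \<bullet> y) / l\<^sup>2 * v (sphere_inv l y)"
      using pos by (intro mult_right_mono) (auto simp: less_imp_le)
    then show "v (sphere_inv l y) \<le> kelvin l v y" by (simp add: kelvin_def)
  qed (use pos in \<open>simp add: less_imp_le\<close>)
  finally show ?thesis .
qed

text \<open>Among all points of contact one of maximal norm is taken. Beyond its norm the inequality is strict, so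
  the closed ball of radius \<open>|z|\<close> about \<open>2 z\<close>, which meets the sphere \<open>|y| = |z|\<close> from outside at \<open>z\<close> alone,
  fits the boundary point lemma. If \<open>|z| > l\<close>, the gradients agree at \<open>z\<close> because the difference has an interior minimum
  there; if all contact is on the sphere of inversion, where it is automatic, the point
  \<open>y0\<close> with agreeing gradients is used.\<close>

lemma no_touching:
  assumes l: "l > 0" and le: "\<And>y. l \<le> norm y \<Longrightarrow> v y \<le> kelvin l v y"
    and far: "\<And>y. R1 \<le> norm y \<Longrightarrow> v y < kelvin l v y"
    and y0: "l \<le> norm y0" "kelvin l v y0 = v y0" "norm y0 = l \<Longrightarrow> kelvin_grad l v G y0 = G y0"
  shows False
proof -
  note Jk = kelvin_jet[OF J l]
  let ?K = "cball 0 R1 - ball 0 l :: (real^'n) set"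
  define Z where "Z = {y \<in> ?K. kelvin l v y - v y = 0}"
  have K: "compact ?K" by (intro compact_diff) auto
  have K0: "?K \<subseteq> -{0}" using l by auto
  have "continuous_on ?K (\<lambda>y. kelvin l v y - v y)"
    by (intro continuous_intros continuous_on_subset[OF has_jet_continuous(1)[OF Jk] K0]
        continuous_on_subset[OF has_jet_continuous(1)[OF J]]) auto
  then have "closed Z" unfolding Z_def using K compact_imp_closed
    by (intro continuous_closed_preimage_constant) auto
  moreover have "bounded Z" 
    by (rule bounded_subset[OF compact_imp_bounded[OF K]]) (simp add: Z_def subset_iff)
  ultimately have Z: "compact Z" by (simp add: compact_eq_bounded_closed)
  have inZ: "y \<in> Z" if "l \<le> norm y" "kelvin l v y = v y" for y
  proof -
    have "\<not> R1 \<le> norm y" using far[of y] that by auto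
    then show ?thesis using that by (simp add: Z_def)
  qed
  have "y0 \<in> Z" using inZ y0 by blast
  then obtain z1 where z1: "z1 \<in> Z" "\<And>y. y \<in> Z \<Longrightarrow> norm y \<le> norm z1"
    using continuous_attains_sup[OF Z _ continuous_on_norm_id] by blast
  define z where "z = (if norm z1 = l then y0 else z1)"
  have z: "l \<le> norm z" "kelvin l v z = v z"
    using z1 y0 by (auto simp: z_def Z_def)
  have zmax: "v y < kelvin l v y" if "norm z < norm y" for y
  proof -
    have "norm z1 \<le> norm z" using z y0 by (simp add: z_def)
    then have "y \<notin> Z" using z1(2)[of y] that by auto
    then have "kelvin l v y \<noteq> v y" using inZ[of y] z that by auto
    then show ?thesis using le[of y] z that by auto
  qed
  have z0: "z \<noteq> 0" using z l by auto
  have grad: "kelvin_grad l v G z = G z"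
  proof (cases "norm z = l")
    case True
    then have "norm z1 = l" by (auto simp: z_def split: if_splits)
    then show ?thesis using y0 True by (simp add: z_def)
  next
    case False
    let ?S = "- cball 0 l :: (real^'n) set"
    have S: "open ?S" "z \<in> ?S" using z False by auto
    have "?S \<subseteq> -{0}" using l by auto
    then have JW: "has_jet (\<lambda>y. kelvin l v y - v y) (\<lambda>y. kelvin_grad l v G y - G y)
       (\<lambda>y. kelvin_hess l v G H y - H y) ?S"
      by (intro has_jet_diff has_jet_subset[OF Jk] has_jet_subset[OF J]) auto
    have "kelvin_grad l v G z - G z = 0"
      by (rule gradient_zero_at_min[OF JW S]) (use le z in auto)
    then show ?thesis by simp
  qed
  define S where "S = ball z (norm z / 2)"
  have S: "open S" "z \<in> S" using z0 by (auto simp: S_def)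
  have cS: "cball z (norm z / 2) \<subseteq> -{0}"
    using z0 by (auto simp: dist_norm)
  then have S0: "S \<subseteq> -{0}" by (auto simp: S_def)
  have cc: "compact (cball z (norm z / 2))" "cball z (norm z / 2) \<noteq> {}" by auto
  have cv: "continuous_on (cball z (norm z / 2)) v"
    and ck: "continuous_on (cball z (norm z / 2)) (kelvin l v)"
    using continuous_on_subset[OF has_jet_continuous(1)[OF J]] continuous_on_subset[OF has_jet_continuous(1)[OF Jk] cS] by auto
  obtain x0 where x0: "\<And>y. y \<in> cball z (norm z / 2) \<Longrightarrow> v x0 \<le> v y"
    using continuous_attains_inf[OF cc cv] by blast
  obtain x1 where x1: "\<And>y. y \<in> cball z (norm z / 2) \<Longrightarrow> kelvin l v y \<le> kelvin l v x1"
    using continuous_attains_sup[OF cc ck] by blast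
  obtain L where L: "\<And>a b. v x0 \<le> a \<Longrightarrow> a \<le> b \<Longrightarrow> b \<le> kelvin l v x1 \<Longrightarrow> b powr q - a powr q \<le> L * (b - a)"
    using powr_lipschitz[OF pos q] by blast
  have ext: "norm z \<le> norm y" "norm y = norm z \<Longrightarrow> y = z" if "dist y (2 *\<^sub>R z) \<le> norm z" for y
  proof -
    have "norm (2 *\<^sub>R z) \<le> norm y + dist y (2 *\<^sub>R z)"
      using norm_triangle_sub[of "2 *\<^sub>R z" y] by (simp add: dist_norm norm_minus_commute)
    then show "norm z \<le> norm y" using that by simp
    assume e: "norm y = norm z"
    have "(dist y (2 *\<^sub>R z))\<^sup>2 \<le> (norm z)\<^sup>2" using that by (intro power_mono) auto
    then have "y \<bullet> y - 4 * (y \<bullet> z) + 4 * (z \<bullet> z) \<le> z \<bullet> z"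
      by (simp add: dist_norm power2_norm_eq_inner inner_diff_left inner_diff_right inner_commute)
    moreover have "y \<bullet> y = z \<bullet> z" using e by (metis power2_norm_eq_inner)
    moreover have "(y - z) \<bullet> (y - z) = y \<bullet> y - 2 * (y \<bullet> z) + z \<bullet> z"
      by (simp add: inner_diff_left inner_diff_right inner_commute)
    ultimately have "(y - z) \<bullet> (y - z) \<le> 0" by linarith
    then have "(y - z) \<bullet> (y - z) = 0" using inner_ge_zero[of "y - z"] by linarith
    then show "y = z" by simp
  qed
  show False
  proof (rule boundary_point_lemma[OF U_open U_conv F_C1 F_elliptic S has_jet_subset[OF Jk S0]
        has_jet_subset[OF J subset_UNIV], where c = "2 *\<^sub>R z" and R = "norm z" and L = L])
    show "0 < kelvin l v y" if "y \<in> S" for y using kelvin_pos[OF _ l] S0 that by blast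
    show "schouten (kelvin l v y) (kelvin_grad l v G y) (kelvin_hess l v G H y) \<in> U" if "y \<in> S" for y
      using kelvin_admissible[OF _ l] S0 that by blast
    show "v y < kelvin l v y" if "dist y (2 *\<^sub>R z) \<le> norm z" "y \<noteq> z" for y
      using ext[OF that(1)] that(2) by (intro zmax) force
    show "dist z (2 *\<^sub>R z) = norm z"
    proof -
      have "z - 2 *\<^sub>R z = - z" using scaleR_2[of z] by (simp add: algebra_simps del: scaleR_2)
      then show ?thesis unfolding dist_norm by (simp only: norm_minus_cancel)
    qed
    fix y assume y: "y \<in> S" "dist y (2 *\<^sub>R z) \<le> norm z" "v y \<le> kelvin l v y"
    have yc: "y \<in> cball z (norm z / 2)" using y by (simp add: S_def)
    have "kelvin l v y powr q - v y powr q \<le> L * (kelvin l v y - v y)"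
      using x0[OF yc] x1[OF yc] y by (intro L) auto
    moreover have "l \<le> norm y" using ext(1)[OF y(2)] z by linarith
    ultimately show "F (schouten (kelvin l v y) (kelvin_grad l v G y) (kelvin_hess l v G H y)) -
      F (schouten (v y) (G y) (H y)) \<le> L * (kelvin l v y - v y)"
      using kelvin_supersolution[of l y] l eq[of y] by simp
  qed (use z z0 grad pos adm in auto)
qed

lemma kelvin_tendsto:
  assumes "lk \<longlonglongrightarrow> l" "yk \<longlonglongrightarrow> y" "l > 0" "y \<noteq> 0"
  shows "(\<lambda>k. kelvin (lk k) v (yk k)) \<longlonglongrightarrow> kelvin l v y"
proof -
  have "isCont v x" for x
    using has_jet_continuous(1)[OF J] by (simp add: continuous_on_eq_continuous_at)
  moreover have "(\<lambda>k. sphere_inv (lk k) (yk k)) \<longlonglongrightarrow> sphere_inv l y"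
    unfolding sphere_inv_def using assms by (intro tendsto_intros) auto
  ultimately have "(\<lambda>k. v (sphere_inv (lk k) (yk k))) \<longlonglongrightarrow> v (sphere_inv l y)"
    by (rule isCont_tendsto_compose)
  then show ?thesis
    unfolding kelvin_def using assms by (intro tendsto_intros) auto
qed

lemma kelvin_le_limit:
  assumes below: "\<And>\<rho>. 0 < \<rho> \<Longrightarrow> \<rho> < l \<Longrightarrow> v y \<le> kelvin \<rho> v y" and "l > 0" "y \<noteq> 0"
  shows "v y \<le> kelvin l v y"
proof -
  let ?lk = "\<lambda>k. l * (1 - 1 / (real k + 2))"
  have "(\<lambda>k. 1 / (real k + 2)) \<longlonglongrightarrow> 0"
    using LIMSEQ_ignore_initial_segment[OF lim_1_over_n[where 'a = real], of 2] by (simp add: add.commute)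
  then have "?lk \<longlonglongrightarrow> l * (1 - 0)" by (intro tendsto_intros)
  then have "?lk \<longlonglongrightarrow> l" by simp
  then have "(\<lambda>k. kelvin (?lk k) v y) \<longlonglongrightarrow> kelvin l v y"
    by (rule kelvin_tendsto[OF _ tendsto_const assms(2,3)])
  moreover have "v y \<le> kelvin (?lk k) v y" for k
  proof -
    have "0 < 1 - 1 / (real k + 2)" "1 - 1 / (real k + 2) < 1" by (auto simp: field_simps)
    then show ?thesis using assms(2) by (intro below) (auto simp: mult_less_cancel_left2)
  qed
  ultimately show ?thesis by (intro LIMSEQ_le_const) auto
qed

text \<open>The Kelvin transform behaves like \<open>v(0) |y|\<^sup>2/\<rho>\<^sup>2\<close> at infinity, and the radius \<open>R1\<close> has to serve all
  \<open>\<rho> \<le> l\<close> at once.\<close>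

lemma kelvin_large:
  assumes l: "l > 0" and b: "0 \<le> b" "l\<^sup>2 * b < v 0"
    and growth: "\<And>y. R0 \<le> norm y \<Longrightarrow> v y \<le> b * (y \<bullet> y)"
  obtains R1 where "\<And>\<rho> y. 0 < \<rho> \<Longrightarrow> \<rho> \<le> l \<Longrightarrow> R1 \<le> norm y \<Longrightarrow> v y < kelvin \<rho> v y"
proof -
  define \<delta> where "\<delta> = v 0 - l\<^sup>2 * b"
  have d0: "\<delta> > 0" using b by (simp add: \<delta>_def)
  obtain d where d: "d > 0" "\<And>y. dist y 0 < d \<Longrightarrow> dist (v y) (v 0) < \<delta>"
    using has_jet_continuous(1)[OF J] d0 unfolding continuous_on_iff by (metis UNIV_I)
  define R1 where "R1 = max (max R0 1) (2 * l\<^sup>2 / d)"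
  have "v y < kelvin \<rho> v y" if r: "0 < \<rho>" "\<rho> \<le> l" and y: "R1 \<le> norm y" for \<rho> y
  proof -
    have y1: "norm y \<ge> 1" "norm y \<ge> R0" "norm y \<ge> 2 * l\<^sup>2 / d" using y by (auto simp: R1_def)
    have y0: "y \<bullet> y > 0" "norm y > 0" using y1 by auto
    have r2: "\<rho>\<^sup>2 \<le> l\<^sup>2" using r by (intro power_mono) auto
    have "norm (sphere_inv \<rho> y) = \<rho>\<^sup>2 / norm y"
      using y0 by (simp add: sphere_inv_def power2_norm_eq_inner[symmetric] power2_eq_square)
    also have "\<dots> \<le> l\<^sup>2 / norm y" using r2 by (intro divide_right_mono) auto
    also have "\<dots> < d"
    proof -
      have "2 * l\<^sup>2 \<le> norm y * d" using y1(3) d(1) by (simp add: pos_divide_le_eq)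
      moreover have "0 < l\<^sup>2" using l by simp
      ultimately have "l\<^sup>2 < norm y * d" by linarith
      then have "l\<^sup>2 < d * norm y" by (simp add: mult.commute)
      then show ?thesis using y0 by (simp add: pos_divide_less_eq)
    qed
    finally have "dist (v (sphere_inv \<rho> y)) (v 0) < \<delta>" by (intro d) simp
    then have big: "l\<^sup>2 * b < v (sphere_inv \<rho> y)" by (simp add: \<delta>_def dist_real_def)
    have "\<rho>\<^sup>2 * b \<le> l\<^sup>2 * b" using r2 b by (intro mult_right_mono) auto
    then have "b * \<rho>\<^sup>2 < v (sphere_inv \<rho> y)" using big by (simp add: mult.commute)
    then have "b < v (sphere_inv \<rho> y) / \<rho>\<^sup>2" using r by (simp add: pos_less_divide_eq)
    then have "b * (y \<bullet> y) < v (sphere_inv \<rho> y) / \<rho>\<^sup>2 * (y \<bullet> y)" using y0 by (intro mult_strict_right_mono)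
    also have "\<dots> = kelvin \<rho> v y" by (simp add: kelvin_def)
    finally show ?thesis using growth[OF y1(2)] by linarith
  qed
  then show ?thesis using that by blast
qed

text \<open>The difference \<open>kelvin l v - v\<close> vanishes on the sphere of inversion, so its gradient there is
  radial; the sign comes from its being nonnegative outside.\<close>

lemma sphere_gradient:
  assumes l: "l > 0" and le: "\<And>y. l \<le> norm y \<Longrightarrow> v y \<le> kelvin l v y" and y: "norm y = l"
  shows "kelvin_grad l v G y - G y = (2 * (v y - y \<bullet> G y) / l\<^sup>2) *\<^sub>R y" "y \<bullet> G y \<le> v y"
proof -
  have yy: "y \<bullet> y = l\<^sup>2" using y by (metis power2_norm_eq_inner)
  have i: "sphere_inv l y = y" using yy l by (simp add: sphere_inv_def)
  show grad: "kelvin_grad l v G y - G y = (2 * (v y - y \<bullet> G y) / l\<^sup>2) *\<^sub>R y"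
    unfolding kelvin_grad_def i refl_mat_vec yy by (simp add: algebra_simps diff_divide_distrib)
  show "y \<bullet> G y \<le> v y"
  proof (rule ccontr)
    assume "\<not> ?thesis"
    then have neg: "v y - y \<bullet> G y < 0" by simp
    let ?W = "\<lambda>y. kelvin l v y - v y"
    have JW: "has_jet ?W (\<lambda>y. kelvin_grad l v G y - G y) (\<lambda>y. kelvin_hess l v G H y - H y) (-{0})"
      by (intro has_jet_diff kelvin_jet J l has_jet_subset[OF J]) auto
    have y0: "y + 0 *\<^sub>R y \<in> -{0}" using y l by auto
    have "((\<lambda>t. ?W (y + t *\<^sub>R y)) has_real_derivative (kelvin_grad l v G y - G y) \<bullet> y) (at 0)"
      using jet_along_line(1)[OF JW y0] by simp
    moreover have "(kelvin_grad l v G y - G y) \<bullet> y < 0"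
      unfolding grad using yy l neg by simp
    ultimately have "\<exists>d>0. \<forall>t>0. t < d \<longrightarrow> ?W (y + (0 + t) *\<^sub>R y) < ?W (y + 0 *\<^sub>R y)"
      by (rule DERIV_neg_dec_right)
    then obtain d where d: "d > 0" "\<And>t. 0 < t \<Longrightarrow> t < d \<Longrightarrow> ?W (y + t *\<^sub>R y) < ?W y" by auto
    have "?W (y + (d/2) *\<^sub>R y) < 0" using d(2)[of "d/2"] d(1) kelvin_fixed[OF y l] by simp
    moreover have "norm (y + (d/2) *\<^sub>R y) = (1 + d/2) * l"
    proof -
      have "y + (d/2) *\<^sub>R y = (1 + d/2) *\<^sub>R y" by (simp add: algebra_simps)
      then show ?thesis using d(1) y by simp
    qed
    moreover have "l \<le> (1 + d/2) * l" using d l by simp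
    ultimately show False using le[of "y + (d/2) *\<^sub>R y"] by simp
  qed
qed

text \<open>Let \<open>l\<close> be the infimum of the radii for which the inequality fails. Failing points for radii
  decreasing to \<open>l\<close> are bounded by \<open>kelvin_large\<close> and accumulate at a point of contact \<open>y0\<close> for the radius \<open>l\<close>. If
  \<open>y0\<close> lies on the sphere, its normal derivative must be shown to vanish as well: by \<open>radial_decreasing\<close>, a failing point has on its
  ray, between itself and its inverse point, a point with \<open>y \<bullet> \<nabla>v > v\<close>, and these
  points also tend to \<open>y0\<close>. In either case \<open>no_touching\<close> applies.\<close>

lemma moving_sphere:
  assumes growth: "\<And>y. R0 \<le> norm y \<Longrightarrow> v y \<le> b * (y \<bullet> y)" and b: "0 \<le> b"
    and l1: "l1 > 0" "l1\<^sup>2 * b < v 0" and y: "l1 \<le> norm y"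
  shows "v y \<le> kelvin l1 v y"
proof (rule ccontr)
  assume fail: "\<not> v y \<le> kelvin l1 v y"
  define B where "B = {l. 0 < l \<and> (\<exists>y. l \<le> norm y \<and> kelvin l v y < v y)}"
  have l1B: "l1 \<in> B" using fail l1 y by (auto simp: B_def not_le)
  obtain l0 where l0: "l0 > 0" "\<And>l y. 0 < l \<Longrightarrow> l < l0 \<Longrightarrow> l \<le> norm y \<Longrightarrow> v y \<le> kelvin l v y"
    using moving_sphere_start[OF J pos growth] by blast
  have Bl0: "l0 \<le> l" if "l \<in> B" for l
    using that l0(2) by (force simp: B_def not_less[symmetric])
  then have bdd: "bdd_below B" by (auto simp: bdd_below_def)
  define l where "l = Inf B"
  have "l0 \<le> l" unfolding l_def using l1B Bl0 by (intro cInf_greatest) auto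
  then have l: "l > 0" using l0 by linarith
  have ll1: "l \<le> l1" unfolding l_def by (rule cInf_lower[OF l1B bdd])
  have below: "v y \<le> kelvin \<rho> v y" if "0 < \<rho>" "\<rho> < l" "\<rho> \<le> norm y" for \<rho> y
  proof -
    have "\<rho> \<notin> B" using cInf_lower[OF _ bdd, of \<rho>] that by (auto simp: l_def)
    then show ?thesis using that by (auto simp: B_def not_less)
  qed
  have Pl: "v y \<le> kelvin l v y" if y: "l \<le> norm y" for y
    by (rule kelvin_le_limit) (use below y l in auto)
  obtain l' where l': "l1 < l'" "l'\<^sup>2 * b < v 0"
  proof -
    have "((\<lambda>l. l\<^sup>2 * b) \<longlongrightarrow> l1\<^sup>2 * b) (at_right l1)" by (intro tendsto_intros)
    then have "eventually (\<lambda>l. l\<^sup>2 * b < v 0) (at_right l1)" using l1(2) by (rule order_tendstoD(2))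
    moreover have "eventually (\<lambda>l. l1 < l) (at_right l1)" by (rule eventually_at_right_less)
    ultimately have "eventually (\<lambda>l. l1 < l \<and> l\<^sup>2 * b < v 0) (at_right l1)"
      by eventually_elim auto
    then show ?thesis using that eventually_happens[of _ "at_right l1"] by force
  qed
  obtain R1 where R1: "\<And>\<rho> y. 0 < \<rho> \<Longrightarrow> \<rho> \<le> l' \<Longrightarrow> R1 \<le> norm y \<Longrightarrow> v y < kelvin \<rho> v y"
    using kelvin_large[of l' b R0] l' l1 b growth by (metis less_trans)
  have "\<exists>\<rho> y. l \<le> \<rho> \<and> \<rho> < l + (l' - l) / (real k + 1) \<and> \<rho> \<le> norm y \<and> kelvin \<rho> v y < v y" for k
  proof -
    have "l < l + (l' - l) / (real k + 1)" using l' ll1 by simp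
    then obtain \<rho> where "\<rho> \<in> B" "\<rho> < l + (l' - l) / (real k + 1)"
      using cInf_lessD[of B] l1B unfolding l_def by blast
    moreover have "l \<le> \<rho>" using \<open>\<rho> \<in> B\<close> bdd by (simp add: l_def cInf_lower)
    ultimately show ?thesis by (auto simp: B_def)
  qed
  then obtain lk yk where k: "\<And>k::nat. l \<le> lk k" "\<And>k. lk k < l + (l' - l) / (real k + 1)"
    "\<And>k. lk k \<le> norm (yk k)" "\<And>k. kelvin (lk k) v (yk k) < v (yk k)" by metis
  have lk: "lk \<longlonglongrightarrow> l"
  proof (rule tendsto_sandwich[of "\<lambda>_. l" lk sequentially "\<lambda>k. l + (l' - l) / (real k + 1)"])
    have "(\<lambda>k. 1 / (real k + 1)) \<longlonglongrightarrow> 0"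
      using LIMSEQ_ignore_initial_segment[OF lim_1_over_n[where 'a = real], of 1] by (simp add: add.commute)
    then have "(\<lambda>k. l + (l' - l) * (1 / (real k + 1))) \<longlonglongrightarrow> l + (l' - l) * 0" by (intro tendsto_intros)
    then show "(\<lambda>k. l + (l' - l) / (real k + 1)) \<longlonglongrightarrow> l" by simp
  qed (use k in \<open>auto intro!: always_eventually less_imp_le\<close>)
  have bound: "norm (yk i) \<le> R1" for i
  proof (rule ccontr)
    assume "\<not> ?thesis"
    moreover have "(l' - l) / (real i + 1) \<le> (l' - l) / 1" using l' ll1 by (intro divide_left_mono) auto
    then have "lk i \<le> l'" using k(2)[of i] by simp
    ultimately have "v (yk i) < kelvin (lk i) v (yk i)" using R1[of "lk i" "yk i"] k(1)[of i] l by simp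
    then show False using k(4)[of i] by simp
  qed
  then have "\<forall>i. yk i \<in> cball 0 R1" by simp
  then obtain y0 r where r: "strict_mono r" "(yk \<circ> r) \<longlonglongrightarrow> y0"
    using compact_cball[of 0 R1] unfolding compact_def by metis
  have lkr: "(lk \<circ> r) \<longlonglongrightarrow> l" using lk r(1) by (rule LIMSEQ_subseq_LIMSEQ)
  have nr: "(\<lambda>i. norm ((yk \<circ> r) i)) \<longlonglongrightarrow> norm y0" using r(2) by (rule tendsto_norm)
  have ly0: "l \<le> norm y0"
    by (rule LIMSEQ_le[OF lkr nr]) (use k(3) in auto)
  then have y00: "y0 \<noteq> 0" using l by auto
  have isv: "isCont v x" "isCont G x" for x
    using has_jet_continuous[OF J] by (auto simp: continuous_on_eq_continuous_at)
  have "(\<lambda>i. kelvin ((lk \<circ> r) i) v ((yk \<circ> r) i)) \<longlonglongrightarrow> kelvin l v y0"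
    by (rule kelvin_tendsto[OF lkr r(2) l y00])
  moreover have "(\<lambda>i. v ((yk \<circ> r) i)) \<longlonglongrightarrow> v y0" by (rule isCont_tendsto_compose[OF isv(1) r(2)])
  ultimately have "kelvin l v y0 \<le> v y0"
    by (rule LIMSEQ_le) (use k(4) in \<open>auto intro: less_imp_le\<close>)
  then have eq0: "kelvin l v y0 = v y0" using Pl[OF ly0] by simp
  have grad0: "kelvin_grad l v G y0 = G y0" if n0: "norm y0 = l"
  proof -
    \<comment> \<open>the failing points force the radial derivative of \<open>v / r\<close> to be nonnegative at \<open>y0\<close>\<close>
    let ?x = "\<lambda>i s. (s / norm (yk i)) *\<^sub>R yk i"
    have "\<exists>s. (lk i)\<^sup>2 / norm (yk i) \<le> s \<and> s \<le> norm (yk i) \<and> v (?x i s) < ?x i s \<bullet> G (?x i s)" for i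
    proof (rule ccontr)
      assume no: "\<not> ?thesis"
      define t where "t = norm (yk i)"
      have t: "0 < lk i" "lk i \<le> t" "0 < t" using k(1,3)[of i] l by (auto simp: t_def)
      then have "yk i \<noteq> 0" by (auto simp: t_def)
      then obtain \<theta> where th: "norm \<theta> = 1" "yk i = t *\<^sub>R \<theta>" using polar_form t_def by metis
      have "v (t *\<^sub>R \<theta>) / t \<le> v (((lk i)\<^sup>2 / t) *\<^sub>R \<theta>) / ((lk i)\<^sup>2 / t)"
      proof (rule radial_decreasing[OF J])
        show "0 < (lk i)\<^sup>2 / t" using t by simp
        have "lk i * lk i \<le> t * t" using t by (intro mult_mono) auto
        then show "(lk i)\<^sup>2 / t \<le> t" using t by (simp add: pos_divide_le_eq power2_eq_square)
        fix s assume s: "(lk i)\<^sup>2 / t \<le> s" "s \<le> t"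
        have "(s / t) *\<^sub>R yk i = s *\<^sub>R \<theta>" using th t by simp
        then show "s *\<^sub>R \<theta> \<bullet> G (s *\<^sub>R \<theta>) \<le> v (s *\<^sub>R \<theta>)"
          using no s unfolding t_def[symmetric] by (metis not_le)
      qed
      then have "v (yk i) \<le> kelvin (lk i) v (yk i)"
        using kelvin_le_iff[OF t(3) th(1) t(1), of v] th(2) by simp
      then show False using k(4)[of i] by simp
    qed
    then obtain s where s: "\<And>i. (lk i)\<^sup>2 / norm (yk i) \<le> s i" "\<And>i. s i \<le> norm (yk i)"
      "\<And>i. v (?x i (s i)) < ?x i (s i) \<bullet> G (?x i (s i))"
      by metis
    have "(\<lambda>i. ((lk \<circ> r) i)\<^sup>2 / norm ((yk \<circ> r) i)) \<longlonglongrightarrow> l\<^sup>2 / norm y0"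
      by (intro tendsto_intros lkr r(2)) (use y00 in simp)
    then have lo: "(\<lambda>i. ((lk \<circ> r) i)\<^sup>2 / norm ((yk \<circ> r) i)) \<longlonglongrightarrow> l"
      using n0 l by (simp add: power2_eq_square)
    have "(\<lambda>i. s (r i)) \<longlonglongrightarrow> l"
      by (rule tendsto_sandwich[OF _ _ lo nr[unfolded n0]]) (use s in \<open>auto intro!: always_eventually\<close>)
    then have "(\<lambda>i. (s (r i) / norm ((yk \<circ> r) i)) *\<^sub>R (yk \<circ> r) i) \<longlonglongrightarrow> (l / norm y0) *\<^sub>R y0"
      by (intro tendsto_intros r(2)) (use y00 in simp_all)
    then have lim: "(\<lambda>i. ?x (r i) (s (r i))) \<longlonglongrightarrow> y0"
      using n0 l by simp
    have "v y0 \<le> y0 \<bullet> G y0"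
    proof (rule LIMSEQ_le)
      show "(\<lambda>i. v (?x (r i) (s (r i)))) \<longlonglongrightarrow> v y0"
        by (rule isCont_tendsto_compose[OF isv(1) lim])
      show "(\<lambda>i. ?x (r i) (s (r i)) \<bullet> G (?x (r i) (s (r i)))) \<longlonglongrightarrow> y0 \<bullet> G y0"
        by (rule tendsto_inner[OF lim isCont_tendsto_compose[OF isv(2) lim]])
    qed (use s(3) in \<open>auto intro: less_imp_le\<close>)
    then have "v y0 - y0 \<bullet> G y0 = 0" using sphere_gradient(2)[OF l Pl n0] by simp
    then have "kelvin_grad l v G y0 - G y0 = 0" using sphere_gradient(1)[OF l Pl n0] by simp
    then show ?thesis by simp
  qed
  show False
    by (rule no_touching[of l R1, OF l Pl _ ly0 eq0 grad0]) (use R1[of l] l ll1 l' in auto)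
qed

end

section \<open>Superharmonic functions at infinity\<close>

lemma has_jet_mult:
  assumes "has_jet f1 G1 H1 S" "has_jet f2 G2 H2 S"
  shows "has_jet (\<lambda>x. f1 x * f2 x) (\<lambda>x. f1 x *\<^sub>R G2 x + f2 x *\<^sub>R G1 x)
     (\<lambda>x. f1 x *\<^sub>R H2 x + f2 x *\<^sub>R H1 x + tensor (G1 x) (G2 x) + tensor (G2 x) (G1 x)) S"
  unfolding has_jet_def
proof (intro conjI ballI)
  fix x assume x: "x \<in> S"
  have d: "(f1 has_derivative (\<lambda>h. G1 x \<bullet> h)) (at x)" "(G1 has_derivative (\<lambda>h. H1 x *v h)) (at x)"
    "(f2 has_derivative (\<lambda>h. G2 x \<bullet> h)) (at x)" "(G2 has_derivative (\<lambda>h. H2 x *v h)) (at x)"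
    using assms x by (auto simp: has_jet_def)
  show "((\<lambda>x. f1 x * f2 x) has_derivative (\<lambda>h. (f1 x *\<^sub>R G2 x + f2 x *\<^sub>R G1 x) \<bullet> h)) (at x)"
    by (rule has_derivative_eq_rhs[OF has_derivative_mult[OF d(1) d(3)]])
      (auto simp: inner_add_left mult.commute)
  have "((\<lambda>x. f1 x *\<^sub>R G2 x + f2 x *\<^sub>R G1 x) has_derivative
     (\<lambda>h. (f1 x *\<^sub>R (H2 x *v h) + (G1 x \<bullet> h) *\<^sub>R G2 x) + (f2 x *\<^sub>R (H1 x *v h) + (G2 x \<bullet> h) *\<^sub>R G1 x))) (at x)"
    by (intro has_derivative_add has_derivative_scaleR d)
  then show "((\<lambda>x. f1 x *\<^sub>R G2 x + f2 x *\<^sub>R G1 x) has_derivative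
     (\<lambda>h. (f1 x *\<^sub>R H2 x + f2 x *\<^sub>R H1 x + tensor (G1 x) (G2 x) + tensor (G2 x) (G1 x)) *v h)) (at x)"
    by (rule has_derivative_eq_rhs)
      (simp add: fun_eq_iff matrix_vector_mult_add_rdistrib tensor_mult_vec flip: scaleR_matrix_vector_assoc)
next
  note c = has_jet_continuous[OF assms(1)] has_jet_continuous[OF assms(2)]
  show "continuous_on S (\<lambda>x. f1 x *\<^sub>R H2 x + f2 x *\<^sub>R H1 x + tensor (G1 x) (G2 x) + tensor (G2 x) (G1 x))"
    by (intro continuous_intros c)
qed

lemma has_jet_square_norm: "has_jet (\<lambda>y. y \<bullet> y) (\<lambda>y. 2 *\<^sub>R y) (\<lambda>y. 2 *\<^sub>R mat 1) S"
proof -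
  have "((\<lambda>y. y \<bullet> y) has_derivative (\<lambda>h. (2 *\<^sub>R y) \<bullet> h)) (at y)" for y :: "real^'n"
    by (rule has_derivative_eq_rhs[OF has_derivative_inner[OF has_derivative_ident has_derivative_ident]])
      (simp add: fun_eq_iff inner_commute)
  moreover have "((\<lambda>y. 2 *\<^sub>R y) has_derivative (\<lambda>h. (2 *\<^sub>R mat 1) *v h)) (at y)" for y :: "real^'n"
    by (rule has_derivative_eq_rhs[OF has_derivative_scaleR_right[OF has_derivative_ident]])
      (simp add: fun_eq_iff flip: scaleR_matrix_vector_assoc)
  ultimately show ?thesis by (auto simp: has_jet_def)
qed

lemma has_jet_linear: "has_jet (\<lambda>y. g \<bullet> y) (\<lambda>y. g) (\<lambda>y. 0) S"
  by (auto simp: has_jet_def intro!: derivative_eq_intros)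

lemma has_jet_powr:
  assumes J: "has_jet f G H S" and pos: "\<And>x. x \<in> S \<Longrightarrow> 0 < f x"
  shows "has_jet (\<lambda>x. f x powr a) (\<lambda>x. (a * f x powr (a - 1)) *\<^sub>R G x)
     (\<lambda>x. (a * f x powr (a - 1)) *\<^sub>R H x + (a * (a - 1) * f x powr (a - 2)) *\<^sub>R tensor (G x) (G x)) S"
  unfolding has_jet_def
proof (intro conjI ballI)
  have pw: "((\<lambda>x. f x powr b) has_derivative (\<lambda>h. (b * f x powr (b - 1)) * (G x \<bullet> h))) (at x)" if x: "x \<in> S" for x b
  proof -
    have f: "(f has_derivative (\<lambda>h. G x \<bullet> h)) (at x)" using J x by (simp add: has_jet_def)
    have "((\<lambda>r. r powr b) has_real_derivative (b * f x powr (b - 1))) (at (f x))"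
      using pos[OF x] by (auto intro!: derivative_eq_intros)
    then have "((\<lambda>r. r powr b) has_derivative (\<lambda>h. (b * f x powr (b - 1)) * h)) (at (f x))"
      by (simp add: has_field_derivative_def)
    from has_derivative_compose[OF f this] show ?thesis .
  qed
  fix x assume x: "x \<in> S"
  show "((\<lambda>x. f x powr a) has_derivative (\<lambda>h. ((a * f x powr (a - 1)) *\<^sub>R G x) \<bullet> h)) (at x)"
    using pw[OF x] by simp
  have G: "(G has_derivative (\<lambda>h. H x *v h)) (at x)" using J x by (simp add: has_jet_def)
  have "((\<lambda>x. (a * f x powr (a - 1)) *\<^sub>R G x) has_derivative
     (\<lambda>h. (a * f x powr (a - 1)) *\<^sub>R (H x *v h) + (a * ((a - 1) * f x powr (a - 1 - 1) * (G x \<bullet> h))) *\<^sub>R G x)) (at x)"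
    by (intro has_derivative_scaleR has_derivative_mult_right pw[OF x] G)
  then show "((\<lambda>x. (a * f x powr (a - 1)) *\<^sub>R G x) has_derivative
     (\<lambda>h. ((a * f x powr (a - 1)) *\<^sub>R H x + (a * (a - 1) * f x powr (a - 2)) *\<^sub>R tensor (G x) (G x)) *v h)) (at x)"
    by (rule has_derivative_eq_rhs)
      (simp add: fun_eq_iff matrix_vector_mult_add_rdistrib tensor_mult_vec mult.assoc flip: scaleR_matrix_vector_assoc)
next
  have nz: "\<forall>x\<in>S. f x \<noteq> 0" using pos by force
  show "continuous_on S (\<lambda>x. (a * f x powr (a - 1)) *\<^sub>R H x + (a * (a - 1) * f x powr (a - 2)) *\<^sub>R tensor (G x) (G x))"
    by (intro continuous_intros has_jet_continuous[OF J] nz)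
qed

lemma trace_eq: "mat 1 \<bullet> (P::real^'n^'n) = (\<Sum>i\<in>UNIV. P $ i $ i)"
  by (simp add: mat_inner mat_def if_distrib[of "\<lambda>x. x * _"] cong: if_cong)

lemma trace_tensor: "mat 1 \<bullet> tensor a (b::real^'n) = a \<bullet> b"
  by (simp add: inner_tensor)

lemma trace_mat_1: "mat 1 \<bullet> (mat 1 :: real^'n^'n) = real CARD('n)"
  by (subst trace_eq) (simp add: mat_def)

text \<open>The maximum principle outside a ball. The point at infinity causes no trouble because \<open>w\<close> is positive and \<open>h\<close>
  becomes arbitrarily small there; the term \<open>-\<delta> |y|\<^sup>2\<close> makes the differential inequality strict.\<close>

lemma exterior_comparison:
  fixes w h :: "real^'n \<Rightarrow> real"
  assumes Jw: "has_jet w Gw Hw UNIV" and pos: "\<And>y. 0 < w y" and sup: "\<And>y. mat 1 \<bullet> Hw y \<le> 0"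
    and Jh: "has_jet h Gh Hh (-{0})" and sub: "\<And>y. y \<noteq> 0 \<Longrightarrow> 0 \<le> mat 1 \<bullet> Hh y"
    and lim: "\<And>e. 0 < e \<Longrightarrow> \<exists>R'. \<forall>y. R' \<le> norm y \<longrightarrow> h y \<le> e"
    and R: "R > 0" and bd: "\<And>y. norm y = R \<Longrightarrow> h y \<le> w y" and y: "R \<le> norm y"
  shows "h y \<le> w y"
proof (rule ccontr)
  assume neg: "\<not> h y \<le> w y"
  define e where "e = (h y - w y) / 2"
  have e: "e > 0" using neg by (simp add: e_def)
  obtain R0 where R0: "\<And>y. R0 \<le> norm y \<Longrightarrow> h y \<le> e" using lim[OF e] by blast
  define R' where "R' = max R0 (norm y)"
  have R': "R' \<ge> norm y" "R' > 0" "\<And>y. R' \<le> norm y \<Longrightarrow> h y \<le> e" using R0 y R by (auto simp: R'_def)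
  define \<delta> where "\<delta> = e / (2 * R'\<^sup>2)"
  have \<delta>: "\<delta> > 0" "\<delta> * R'\<^sup>2 < e" using e R' by (auto simp: \<delta>_def)
  define g where "g = (\<lambda>y. (w y - h y) - \<delta> * (y \<bullet> y))"
  have Jg: "has_jet g (\<lambda>y. (Gw y - Gh y) - \<delta> *\<^sub>R (2 *\<^sub>R y)) (\<lambda>y. (Hw y - Hh y) - \<delta> *\<^sub>R (2 *\<^sub>R mat 1)) (-{0})"
    unfolding g_def
    by (intro has_jet_diff has_jet_scale has_jet_square_norm Jh has_jet_subset[OF Jw]) auto
  let ?K = "cball 0 R' - ball 0 R :: (real^'n) set"
  have "compact ?K" by (intro compact_diff) auto
  moreover have yK: "y \<in> ?K" using y R' by auto
  moreover have "continuous_on ?K g"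
    by (rule continuous_on_subset[OF has_jet_continuous(1)[OF Jg]]) (use R in auto)
  ultimately obtain z where z: "z \<in> ?K" "\<And>x. x \<in> ?K \<Longrightarrow> g z \<le> g x"
    using continuous_attains_inf[of ?K g] by blast
  have zz: "\<delta> * (z \<bullet> z) < e"
  proof -
    have "z \<bullet> z \<le> R'\<^sup>2" using z(1) power_mono[of "norm z" R' 2] by (simp add: power2_norm_eq_inner)
    then have "\<delta> * (z \<bullet> z) \<le> \<delta> * R'\<^sup>2" using \<delta> by (intro mult_left_mono) auto
    then show ?thesis using \<delta> by linarith
  qed
  have "g y \<le> -2 * e" using \<delta> by (simp add: g_def e_def)
  then have gz: "g z \<le> -2 * e" using z(2)[OF yK] by linarith
  have "norm z \<noteq> R"
  proof
    assume "norm z = R"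
    then have "h z \<le> w z" by (rule bd)
    then show False using gz zz e by (simp add: g_def)
  qed
  moreover have "norm z \<noteq> R'"
  proof
    assume "norm z = R'"
    then have "h z \<le> e" by (intro R') simp
    then show False using gz zz e pos[of z] by (simp add: g_def)
  qed
  ultimately have zI: "z \<in> ball 0 R' - cball 0 R" using z(1) by auto
  have op: "open (ball 0 R' - cball 0 R :: (real^'n) set)" by auto
  have sub0: "ball 0 R' - cball 0 R \<subseteq> (-{0} :: (real^'n) set)" using R by auto
  have "0 \<le> e \<bullet> (((Hw z - Hh z) - \<delta> *\<^sub>R (2 *\<^sub>R mat 1)) *v e)" for e
    by (rule hessian_psd_at_min[OF has_jet_subset[OF Jg sub0] op zI]) (use z(2) in auto)
  from this[of "axis _ 1"] have "0 \<le> mat 1 \<bullet> ((Hw z - Hh z) - \<delta> *\<^sub>R (2 *\<^sub>R mat 1))"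
    unfolding axis_quadratic trace_eq by (rule sum_nonneg)
  also have "\<dots> = mat 1 \<bullet> Hw z - mat 1 \<bullet> Hh z - \<delta> * (2 * real CARD('n))"
    by (simp add: inner_diff_right trace_mat_1)
  also have "\<dots> < 0"
  proof -
    have "z \<noteq> 0" using zI R by auto
    then have "mat 1 \<bullet> Hw z - mat 1 \<bullet> Hh z \<le> 0" using sup[of z] sub[of z] by linarith
    moreover have "0 < \<delta> * (2 * real CARD('n))" using \<delta> by simp
    ultimately show ?thesis by linarith
  qed
  finally show False by simp
qed

definition radial_grad :: "real \<Rightarrow> real^'n \<Rightarrow> real^'n" where
  "radial_grad a y = (a * (y \<bullet> y) powr (a - 1)) *\<^sub>R (2 *\<^sub>R y)"

definition radial_hess :: "real \<Rightarrow> real^'n \<Rightarrow> real^'n^'n" where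
  "radial_hess a y = (a * (y \<bullet> y) powr (a - 1)) *\<^sub>R (2 *\<^sub>R mat 1)
     + (a * (a - 1) * (y \<bullet> y) powr (a - 2)) *\<^sub>R tensor (2 *\<^sub>R y) (2 *\<^sub>R y)"

lemma radial_jet: "has_jet (\<lambda>y. (y \<bullet> y) powr a) (radial_grad a) (radial_hess a) (-{0})"
  unfolding radial_grad_def[abs_def] radial_hess_def[abs_def]
  by (rule has_jet_powr[OF has_jet_square_norm]) auto

lemma powr_shift: "x > 0 \<Longrightarrow> x * x powr (a - 1) = x powr (a::real)"
  using powr_add[of x 1 "a - 1"] by simp

lemma radial_trace:
  fixes y :: "real^'n"
  assumes "y \<noteq> 0" "real CARD('n) = 2 * k + 2"
  shows "mat 1 \<bullet> radial_hess a y = 4 * a * (k + a) * (y \<bullet> y) powr (a - 1)"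
proof -
  define f where "f = y \<bullet> y"
  have f: "f > 0" using assms by (simp add: f_def)
  have "mat 1 \<bullet> radial_hess a y = a * f powr (a - 1) * (2 * real CARD('n)) + a * (a - 1) * (4 * (f * f powr (a - 1 - 1)))"
    by (simp add: radial_hess_def inner_add_right trace_tensor trace_mat_1 f_def[symmetric] mult_ac)
  also have "\<dots> = 4 * a * (k + a) * f powr (a - 1)"
    unfolding powr_shift[OF f] assms(2) by (simp add: algebra_simps)
  finally show ?thesis by (simp add: f_def)
qed

text \<open>With \<open>k = (n-2)/2\<close> this combines the fundamental solution with the Kelvin transform of the harmonic polynomial
  \<open>(g \<cdot> y)\<^sup>2 - |g|\<^sup>2 |y|\<^sup>2/n\<close>. The latter is even in \<open>y\<close> and largest along \<open>\<plusminus>g\<close>, which is what a comparison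
  with \<open>|g \<cdot> y|\<close> requires; on a sphere about \<open>0\<close> its mean is zero.\<close>

definition quadrupole :: "real \<Rightarrow> real \<Rightarrow> real \<Rightarrow> real^'n \<Rightarrow> real^'n \<Rightarrow> real" where
  "quadrupole k A B g y = A * (y \<bullet> y) powr (-k) + B * ((g \<bullet> y) * (g \<bullet> y) * (y \<bullet> y) powr (-k-2)
        - (g \<bullet> g) / real CARD('n) * (y \<bullet> y) powr (-k-1))"

lemma harmonic_quadrupole:
  fixes g :: "real^'n"
  assumes n: "real CARD('n) = 2 * k + 2" and k: "k > 0"
  obtains Gh Hh where
    "has_jet (quadrupole k A B g) Gh Hh (-{0})"
    "\<And>y. y \<noteq> 0 \<Longrightarrow> mat 1 \<bullet> Hh y = 0"
proof -
  let ?G2 = "\<lambda>y. (g \<bullet> y) *\<^sub>R g + (g \<bullet> y) *\<^sub>R g"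
  let ?H2 = "\<lambda>y. (g \<bullet> y) *\<^sub>R (0::real^'n^'n) + (g \<bullet> y) *\<^sub>R 0 + tensor g g + tensor g g"
  let ?H3 = "\<lambda>y. ((g \<bullet> y) * (g \<bullet> y)) *\<^sub>R radial_hess (-k-2) y + ((y \<bullet> y) powr (-k-2)) *\<^sub>R ?H2 y
      + tensor (?G2 y) (radial_grad (-k-2) y) + tensor (radial_grad (-k-2) y) (?G2 y)"
  let ?H = "\<lambda>y. A *\<^sub>R radial_hess (-k) y + B *\<^sub>R (?H3 y - ((g \<bullet> g) / real CARD('n)) *\<^sub>R radial_hess (-k-1) y)"
  have J: "has_jet (quadrupole k A B g)
     (\<lambda>y. A *\<^sub>R radial_grad (-k) y + B *\<^sub>R ((((g \<bullet> y) * (g \<bullet> y)) *\<^sub>R radial_grad (-k-2) y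
        + ((y \<bullet> y) powr (-k-2)) *\<^sub>R ?G2 y) - ((g \<bullet> g) / real CARD('n)) *\<^sub>R radial_grad (-k-1) y)) ?H (-{0})"
    unfolding quadrupole_def[abs_def]
    by (intro has_jet_add has_jet_scale has_jet_diff has_jet_mult radial_jet has_jet_linear)
  have "mat 1 \<bullet> ?H y = 0" if y: "y \<noteq> 0" for y
  proof -
    define f where "f = y \<bullet> y"
    define t where "t = f powr (-k-2-1)"
    have f: "f > 0" using y by (simp add: f_def)
    have ft: "f powr (-k-2) = f * t" using powr_shift[OF f, of "-k-2"] by (simp add: t_def)
    have tr: "mat 1 \<bullet> radial_hess (-k-2) y = 4 * (-k-2) * (k + (-k-2)) * t"
      "mat 1 \<bullet> radial_hess (-k-1) y = 4 * (-k-1) * (k + (-k-1)) * (f * t)"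
      "mat 1 \<bullet> radial_hess (-k) y = 0"
      unfolding radial_trace[OF y n] f_def[symmetric] t_def
      using ft[unfolded t_def] by (simp_all add: algebra_simps)
    have gr: "g \<bullet> radial_grad (-k-2) y = (-k-2) * t * (2 * (g \<bullet> y))"
      by (simp add: radial_grad_def f_def[symmetric] t_def)
    have "mat 1 \<bullet> ?H y = B * ((g \<bullet> y) * (g \<bullet> y) * (4 * (-k-2) * (k + (-k-2)) * t)
        + (f * t) * (2 * (g \<bullet> g)) + 4 * ((g \<bullet> y) * ((-k-2) * t * (2 * (g \<bullet> y))))
        - (g \<bullet> g) / real CARD('n) * (4 * (-k-1) * (k + (-k-1)) * (f * t)))"
      unfolding inner_add_right inner_diff_right inner_scaleR_right inner_add_left inner_scaleR_left trace_tensor tr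
        inner_commute[of "radial_grad (-k-2) y" g] gr f_def[symmetric] ft
      by simp
    also have "\<dots> = 0"
      using k unfolding n by (simp add: field_simps)
    finally show ?thesis .
  qed
  then show ?thesis using that[OF J] by blast
qed

lemma powr_neg_small:
  fixes k C e :: real
  assumes "k > 0" "e > 0"
  shows "\<exists>R. \<forall>y::'a::real_inner. R \<le> norm y \<longrightarrow> C * (y \<bullet> y) powr (-k) \<le> e"
proof -
  define m where "m = (\<bar>C\<bar> / e + 1) powr (1 / k)"
  have "0 < \<bar>C\<bar> / e + 1" using assms by (simp add: add_nonneg_pos)
  then have m: "m > 0" unfolding m_def by simp
  have "C * (y \<bullet> y) powr (-k) \<le> e" if y: "sqrt m \<le> norm y" for y :: 'a
  proof -
    have "m \<le> y \<bullet> y" using y m by (metis dot_square_norm power_mono real_sqrt_ge_zero less_imp_le real_sqrt_pow2)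
    then have le: "m powr k \<le> (y \<bullet> y) powr k" using m assms by (intro powr_mono2) auto
    have "0 < \<bar>C\<bar> / e + 1" using assms by (simp add: add_nonneg_pos)
    moreover have "1 / k * k = 1" using assms by simp
    then have "m powr k = (\<bar>C\<bar> / e + 1) powr 1" unfolding m_def powr_powr by (simp only:)
    ultimately have "m powr k = \<bar>C\<bar> / e + 1" by (simp only: powr_one)
    then have "\<bar>C\<bar> / e < (y \<bullet> y) powr k" using le by linarith
    then have "\<bar>C\<bar> < e * (y \<bullet> y) powr k" using assms by (simp add: pos_divide_less_eq mult.commute)
    moreover have "0 < y \<bullet> y" using \<open>m \<le> y \<bullet> y\<close> m by linarith
    then have "(y \<bullet> y) powr k > 0" by simp
    ultimately have "\<bar>C\<bar> * (y \<bullet> y) powr (-k) \<le> e" by (simp add: powr_minus field_simps)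
    moreover have "C * (y \<bullet> y) powr (-k) \<le> \<bar>C\<bar> * (y \<bullet> y) powr (-k)" by (intro mult_right_mono) auto
    ultimately show ?thesis by linarith
  qed
  then show ?thesis by blast
qed

text \<open>Comparison with a multiple of the fundamental solution outside the unit sphere.\<close>

lemma superharmonic_lower_bound:
  fixes w :: "real^'n \<Rightarrow> real"
  assumes n: "real CARD('n) = 2 * k + 2" and k: "k > 0"
    and Jw: "has_jet w Gw Hw UNIV" and pos: "\<And>y. 0 < w y" and sup: "\<And>y. mat 1 \<bullet> Hw y \<le> 0"
  obtains c where "c > 0" "\<And>y. 1 \<le> norm y \<Longrightarrow> c * (y \<bullet> y) powr (-k) \<le> w y"
proof -
  have "axis undefined 1 \<in> sphere (0::real^'n) 1" by simp
  then have "sphere (0::real^'n) 1 \<noteq> {}" by blast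
  then obtain x0 where x0: "\<And>y. y \<in> sphere 0 1 \<Longrightarrow> w x0 \<le> w y"
    using continuous_attains_inf[OF compact_sphere _ continuous_on_subset[OF has_jet_continuous(1)[OF Jw] subset_UNIV]]
    by metis
  have "w x0 * (y \<bullet> y) powr (-k) \<le> w y" if "1 \<le> norm y" for y
  proof (rule exterior_comparison[OF Jw pos sup has_jet_scale[OF radial_jet] _ _ _ _ that])
    show "0 \<le> mat 1 \<bullet> (w x0 *\<^sub>R radial_hess (-k) y)" if "y \<noteq> 0" for y :: "real^'n"
      using radial_trace[OF that n, of "-k"] by simp
    show "w x0 * (y \<bullet> y) powr (-k) \<le> w y" if "norm y = 1" for y
      using that x0[of y] by (simp add: norm_eq_1)
  qed (use powr_neg_small k in auto)
  then show ?thesis using that pos by blast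
qed

lemma bernoulli_neg:
  fixes s k :: real
  assumes "s < 1" "k > 0"
  shows "1 + k * s \<le> (1 - s) powr (-k)"
proof -
  have "ln (1 - s) \<le> - s" using ln_add_one_self_le_self2[of "-s"] assms by simp
  then have "k * ln (1 - s) \<le> k * (- s)" using assms by (intro mult_left_mono) auto
  then have "1 + k * s \<le> 1 + (- k * ln (1 - s))" by simp
  also have "\<dots> \<le> exp (- k * ln (1 - s))" by (rule exp_ge_add_one_self)
  also have "\<dots> = (1 - s) powr (-k)" using assms by (simp add: powr_def)
  finally show ?thesis .
qed

text \<open>In terms of \<open>w\<close>, the bound says that on the sphere \<open>|y| = R\<close> the function \<open>w\<close> is at least
  \<open>(\<beta> R\<^sup>2)\<^sup>-\<^sup>k (1 + k s)\<close>, where \<open>s\<close> is \<open>|g \<cdot> y|/(\<beta> R\<^sup>2)\<close> up to the error term. There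
  \<open>|g \<cdot> y| \<ge> (g \<cdot> y)\<^sup>2/(|g| R)\<close>, and the lower bound obtained in this way is the restriction to the sphere
  of the harmonic function \<open>h\<close> of \<open>harmonic_quadrupole\<close>. The mean of \<open>(g \<cdot> y)\<^sup>2\<close> over the sphere is \<open>|g|\<^sup>2 R\<^sup>2/n\<close>; with
  the error constant \<open>\<epsilon> = |g|/(2 n)\<close> the coefficient \<open>A\<close> of the fundamental solution is still larger than \<open>1\<close>.
  By comparison \<open>w \<ge> h\<close> outside the sphere, and \<open>h\<close> is asymptotic to \<open>A \<beta>\<^sup>-\<^sup>k |y|\<^bsup>2-n\<^esup>\<close>.\<close>

lemma growth_improvement:
  fixes w :: "real^'n \<Rightarrow> real" and g :: "real^'n"
  assumes n: "real CARD('n) = 2 * k + 2" and k: "k > 0"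
    and Jw: "has_jet w Gw Hw UNIV" and pos: "\<And>y. 0 < w y" and sup: "\<And>y. mat 1 \<bullet> Hw y \<le> 0"
    and \<beta>: "\<beta> > 0" and g: "g \<noteq> 0"
    and up: "\<And>\<epsilon>. \<epsilon> > 0 \<Longrightarrow> \<exists>R. \<forall>y. R \<le> norm y \<longrightarrow>
        w y powr (- 1 / k) \<le> \<beta> * (y \<bullet> y) - \<bar>g \<bullet> y\<bar> + \<epsilon> * norm y"
  obtains b R where "b < \<beta>" "\<And>y. R \<le> norm y \<Longrightarrow> w y powr (- 1 / k) \<le> b * (y \<bullet> y)"
proof -
  let ?N = "real CARD('n)"
  have N: "?N > 0" by simp
  have ng: "norm g > 0" using g by simp
  define \<epsilon> where "\<epsilon> = norm g / (2 * ?N)"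
  have "\<epsilon> > 0" using ng N by (simp add: \<epsilon>_def)
  then obtain R0 where R0: "\<And>y. R0 \<le> norm y \<Longrightarrow> w y powr (- 1 / k) \<le> \<beta> * (y \<bullet> y) - \<bar>g \<bullet> y\<bar> + \<epsilon> * norm y"
    using up by blast
  define R where "R = max R0 1"
  have R: "R > 0" "R \<ge> R0" by (auto simp: R_def)
  \<comment> \<open>\<open>A\<close> and \<open>B\<close> are determined by \<open>h = (\<beta> R\<^sup>2)\<^sup>-\<^sup>k (1 + k s)\<close> on the sphere of radius \<open>R\<close>\<close>
  define B where "B = k * R / (norm g * \<beta>)"
  define A where "A = 1 + k / (\<beta> * R) * (norm g / ?N - \<epsilon>)"
  have B: "B > 0" using k R ng \<beta> by (simp add: B_def)
  have "norm g / ?N - \<epsilon> > 0" using ng N by (simp add: \<epsilon>_def field_simps)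
  then have A: "A > 1" using k \<beta> R by (simp add: A_def)
  define h where "h = (\<lambda>y. \<beta> powr (-k) * quadrupole k A B g y)"
  obtain Gh Hh where Jh0: "has_jet (quadrupole k A B g) Gh Hh (-{0})"
    and tr: "\<And>y. y \<noteq> 0 \<Longrightarrow> mat 1 \<bullet> Hh y = 0"
    using harmonic_quadrupole[OF n k, of A B g] by blast
  have Jh: "has_jet h (\<lambda>y. \<beta> powr (-k) *\<^sub>R Gh y) (\<lambda>y. \<beta> powr (-k) *\<^sub>R Hh y) (-{0})"
    unfolding h_def by (rule has_jet_scale[OF Jh0])
  have hform: "h y = \<beta> powr (-k) * (y \<bullet> y) powr (-k) * (A + B * ((g \<bullet> y)\<^sup>2 / (y \<bullet> y)\<^sup>2 - (g \<bullet> g) / ?N / (y \<bullet> y)))"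
    if "y \<noteq> 0" for y
  proof -
    have f: "y \<bullet> y > 0" using that by simp
    have "(y \<bullet> y) powr (-k-2) = (y \<bullet> y) powr (-k) / (y \<bullet> y)\<^sup>2" "(y \<bullet> y) powr (-k-1) = (y \<bullet> y) powr (-k) / (y \<bullet> y)"
      using f by (simp_all add: powr_diff)
    then show ?thesis by (simp add: h_def quadrupole_def power2_eq_square algebra_simps)
  qed
  have gy: "(g \<bullet> y)\<^sup>2 \<le> (g \<bullet> g) * (y \<bullet> y)" for y by (rule Cauchy_Schwarz_ineq)
  have lower: "h y \<le> w y" if "R \<le> norm y" for y
  proof (rule exterior_comparison[OF Jw pos sup Jh _ _ R(1) _ that])
    show "0 \<le> mat 1 \<bullet> (\<beta> powr (-k) *\<^sub>R Hh y)" if "y \<noteq> 0" for y using tr[OF that] by simp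
  next
    fix e :: real assume "e > 0"
    then obtain R1 where R1: "\<And>y::real^'n. R1 \<le> norm y \<Longrightarrow> (\<beta> powr (-k) * (A + B * (g \<bullet> g))) * (y \<bullet> y) powr (-k) \<le> e"
      using powr_neg_small[OF k] by blast
    have "h y \<le> e" if y: "max R1 1 \<le> norm y" for y
    proof -
      have f: "y \<bullet> y \<ge> 1" using y power_mono[of 1 "norm y" 2] by (simp add: power2_norm_eq_inner)
      then have y0: "y \<noteq> 0" by auto
      have "(g \<bullet> y)\<^sup>2 / (y \<bullet> y)\<^sup>2 \<le> (g \<bullet> g) * (y \<bullet> y) / (y \<bullet> y)\<^sup>2" by (intro divide_right_mono gy) auto
      also have "\<dots> = (g \<bullet> g) / (y \<bullet> y)" using f by (simp add: power2_eq_square)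
      also have "\<dots> \<le> (g \<bullet> g) / 1" using f by (intro divide_left_mono) auto
      finally have c1: "(g \<bullet> y)\<^sup>2 / (y \<bullet> y)\<^sup>2 \<le> (g \<bullet> g) / 1" .
      have "(g \<bullet> y)\<^sup>2 / (y \<bullet> y)\<^sup>2 - (g \<bullet> g) / ?N / (y \<bullet> y) \<le> g \<bullet> g"
      proof -
        have "0 \<le> (g \<bullet> g) / ?N / (y \<bullet> y)" by simp
        with c1 show ?thesis by linarith
      qed
      then have "A + B * ((g \<bullet> y)\<^sup>2 / (y \<bullet> y)\<^sup>2 - (g \<bullet> g) / ?N / (y \<bullet> y)) \<le> A + B * (g \<bullet> g)"
        using B by simp
      then have "h y \<le> \<beta> powr (-k) * (y \<bullet> y) powr (-k) * (A + B * (g \<bullet> g))"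
        unfolding hform[OF y0] by (intro mult_left_mono) auto
      also have "\<dots> \<le> e" using R1[of y] y by (simp add: mult_ac)
      finally show ?thesis .
    qed
    then show "\<exists>R'. \<forall>y. R' \<le> norm y \<longrightarrow> h y \<le> e" by blast
  next
    fix y :: "real^'n" assume yR: "norm y = R"
    have f: "y \<bullet> y = R\<^sup>2" using yR by (metis power2_norm_eq_inner)
    have y0: "y \<noteq> 0" using yR R by auto
    define V where "V = w y powr (- 1 / k)"
    have V: "V > 0" using pos[of y] by (simp add: V_def)
    have wV: "w y = V powr (-k)" using k pos[of y] by (simp add: V_def powr_powr)
    define s where "s = ((g \<bullet> y)\<^sup>2 / (norm g * R) - \<epsilon> * R) / (\<beta> * R\<^sup>2)"
    have bR: "\<beta> * R\<^sup>2 > 0" using \<beta> R by simp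
    have "(g \<bullet> y)\<^sup>2 / (norm g * R) \<le> \<bar>g \<bullet> y\<bar>"
    proof -
      have "\<bar>g \<bullet> y\<bar> \<le> norm g * R" using Cauchy_Schwarz_ineq2[of g y] yR by simp
      then have "\<bar>g \<bullet> y\<bar> * \<bar>g \<bullet> y\<bar> \<le> \<bar>g \<bullet> y\<bar> * (norm g * R)" by (intro mult_left_mono) auto
      then show ?thesis using ng R by (simp add: pos_divide_le_eq power2_eq_square)
    qed
    then have "V \<le> \<beta> * R\<^sup>2 - (g \<bullet> y)\<^sup>2 / (norm g * R) + \<epsilon> * R"
      using R0[of y] yR R f by (simp add: V_def)
    also have "\<dots> = (\<beta> * R\<^sup>2) * (1 - s)"
    proof -
      have "(\<beta> * R\<^sup>2) * s = (g \<bullet> y)\<^sup>2 / (norm g * R) - \<epsilon> * R"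
        unfolding s_def using bR by (metis less_irrefl nonzero_mult_div_cancel_left times_divide_eq_right)
      then show ?thesis by (simp add: right_diff_distrib)
    qed
    finally have VV: "V \<le> (\<beta> * R\<^sup>2) * (1 - s)" .
    then have "0 < (\<beta> * R\<^sup>2) * (1 - s)" using V by linarith
    then have s: "s < 1" using bR by (simp add: zero_less_mult_iff)
    have "h y = (\<beta> * R\<^sup>2) powr (-k) * (1 + k * s)"
    proof -
      have "A + B * ((g \<bullet> y)\<^sup>2 / (R\<^sup>2)\<^sup>2 - (g \<bullet> g) / ?N / R\<^sup>2) = 1 + k * s"
        unfolding A_def B_def s_def power2_norm_eq_inner[symmetric]
        using R ng \<beta> N by (simp add: field_simps power2_eq_square)
      then show ?thesis unfolding hform[OF y0] f using \<beta> R by (simp add: powr_mult)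
    qed
    also have "\<dots> \<le> (\<beta> * R\<^sup>2) powr (-k) * (1 - s) powr (-k)"
      by (intro mult_left_mono bernoulli_neg s k) auto
    also have "\<dots> = ((\<beta> * R\<^sup>2) * (1 - s)) powr (-k)" using bR s by (simp add: powr_mult)
    also have "\<dots> \<le> V powr (-k)" using VV V k by (intro powr_mono2') auto
    finally show "h y \<le> w y" using wV by simp
  qed
  \<comment> \<open>any value between \<open>1\<close> and \<open>A\<close> absorbs the quadrupole term far out\<close>
  define A' where "A' = (1 + A) / 2"
  have A': "A' > 1" "A' < A" using A by (auto simp: A'_def)
  define R2 where "R2 = max R (sqrt (B * (g \<bullet> g) / (A - A')) + 1)"
  define b where "b = \<beta> * A' powr (- 1 / k)"
  show ?thesis
  proof (rule that)
    have "A' powr (- 1 / k) < 1" using A' k by (simp add: powr_less_one)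
    then show "b < \<beta>" using \<beta> by (simp add: b_def)
    fix y :: "real^'n" assume y: "R2 \<le> norm y"
    have yR: "R \<le> norm y" using y by (simp add: R2_def)
    then have y0: "y \<noteq> 0" using R by auto
    then have f: "y \<bullet> y > 0" by simp
    have "B * (g \<bullet> g) / (A - A') \<le> y \<bullet> y"
    proof -
      have "sqrt (B * (g \<bullet> g) / (A - A')) \<le> norm y" using y by (simp add: R2_def)
      then have "B * (g \<bullet> g) / (A - A') \<le> (norm y)\<^sup>2" by (rule sqrt_le_D)
      then show ?thesis by (simp add: power2_norm_eq_inner)
    qed
    then have "B * (g \<bullet> g) / (y \<bullet> y) \<le> A - A'" using A' f by (simp add: pos_divide_le_eq mult.commute)
    moreover have "B * ((g \<bullet> g) / ?N / (y \<bullet> y)) \<le> B * (g \<bullet> g) / (y \<bullet> y)"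
    proof -
      have "(g \<bullet> g) / ?N \<le> (g \<bullet> g) / 1" by (intro divide_left_mono) (auto simp: Suc_le_eq)
      then have "B * ((g \<bullet> g) / ?N / (y \<bullet> y)) \<le> B * ((g \<bullet> g) / (y \<bullet> y))"
        using B f by (intro mult_left_mono divide_right_mono) auto
      then show ?thesis by simp
    qed
    moreover have "0 \<le> B * ((g \<bullet> y)\<^sup>2 / (y \<bullet> y)\<^sup>2)" using B by simp
    ultimately have "A' \<le> A + B * ((g \<bullet> y)\<^sup>2 / (y \<bullet> y)\<^sup>2 - (g \<bullet> g) / ?N / (y \<bullet> y))"
      unfolding right_diff_distrib by linarith
    then have "\<beta> powr (-k) * (y \<bullet> y) powr (-k) * A' \<le> h y"
      unfolding hform[OF y0] by (intro mult_left_mono) auto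
    also have "\<dots> \<le> w y" by (rule lower[OF yR])
    finally have "\<beta> powr (-k) * (y \<bullet> y) powr (-k) * A' \<le> w y" .
    then have "w y powr (- 1 / k) \<le> (\<beta> powr (-k) * (y \<bullet> y) powr (-k) * A') powr (- 1 / k)"
      using k \<beta> f A' by (intro powr_mono2') auto
    also have "\<dots> = b * (y \<bullet> y)"
      using k \<beta> f A' by (simp add: powr_mult powr_powr b_def mult_ac)
    finally show "w y powr (- 1 / k) \<le> b * (y \<bullet> y)" .
  qed
qed

section \<open>Critical spheres and the growth rate\<close>

text \<open>The leading coefficient of a quadratic bound is translation invariant up to an arbitrarily small
  loss, so growth rates may be measured from any centre.\<close>

lemma quadratic_growth_translate:
  fixes v :: "real^'n \<Rightarrow> real"
  assumes growth: "\<And>y. R \<le> norm y \<Longrightarrow> v y \<le> b * (y \<bullet> y)" and b: "0 \<le> b" "b < b'"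
  obtains R' where "\<And>y. R' \<le> norm y \<Longrightarrow> v (x + y) \<le> b' * (y \<bullet> y)"
proof -
  define c where "c = 2 * norm x + (norm x)\<^sup>2"
  have c: "c \<ge> 0" by (simp add: c_def)
  define R' where "R' = max (R + norm x) (max 1 (b * c / (b' - b)))"
  have "v (x + y) \<le> b' * (y \<bullet> y)" if y: "R' \<le> norm y" for y
  proof -
    define r where "r = norm y"
    have r: "r \<ge> R + norm x" "r \<ge> 1" "b * c / (b' - b) \<le> r" using y by (auto simp: R'_def r_def)
    have "norm y \<le> norm (x + y) + norm x" using norm_triangle_ineq4[of "x + y" x] by simp
    then have "R \<le> norm (x + y)" using r by (simp add: r_def)
    then have "v (x + y) \<le> b * (norm (x + y))\<^sup>2" using growth by (simp add: power2_norm_eq_inner)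
    also have "\<dots> \<le> b * (norm x + r)\<^sup>2"
      using b norm_triangle_ineq[of x y] by (intro mult_left_mono power_mono) (auto simp: r_def)
    also have "(norm x + r)\<^sup>2 \<le> r\<^sup>2 + c * r"
    proof -
      have "(norm x)\<^sup>2 * 1 \<le> (norm x)\<^sup>2 * r" using r by (intro mult_left_mono) auto
      then show ?thesis by (simp add: c_def power2_eq_square algebra_simps)
    qed
    then have "b * (norm x + r)\<^sup>2 \<le> b * (r\<^sup>2 + c * r)" using b by (intro mult_left_mono)
    also have "\<dots> = b * r\<^sup>2 + (b * c) * r" by (simp add: algebra_simps)
    also have "\<dots> \<le> b * r\<^sup>2 + ((b' - b) * r) * r"
    proof -
      have "b * c \<le> r * (b' - b)" using r(3) b by (simp add: pos_divide_le_eq)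
      then have "(b * c) * r \<le> ((b' - b) * r) * r" using r by (intro mult_right_mono) (auto simp: mult.commute)
      then show ?thesis by simp
    qed
    also have "\<dots> = b' * r\<^sup>2" by (simp add: power2_eq_square algebra_simps)
    finally show ?thesis by (simp add: r_def power2_norm_eq_inner)
  qed
  then show ?thesis using that by blast
qed

text \<open>Take the centre \<open>c - M \<theta>\<close> on the line through \<open>a\<close> and \<open>c\<close>, behind \<open>c\<close>, and the radius for which \<open>c\<close> is the
  inverse point of \<open>a\<close>. The conformal factor tends to \<open>1\<close> as \<open>M\<close> grows, so \<open>v a \<le> v c\<close>, and the roles of the points can
  be exchanged.\<close>

lemma constant_if_all_spheres:
  fixes v :: "real^'n \<Rightarrow> real"
  assumes pos: "\<And>x. 0 < v x"
    and spheres: "\<And>x l z. 0 < l \<Longrightarrow> l \<le> norm z \<Longrightarrow> v (x + z) \<le> kelvin l (\<lambda>y. v (x + y)) z"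
  shows "v a = v c"
proof -
  have le: "v a \<le> v c" for a c
  proof (cases "a = c")
    case False
    define d where "d = norm (a - c)"
    have d: "d > 0" using False by (simp add: d_def)
    obtain \<theta> where th: "norm \<theta> = 1" "a - c = d *\<^sub>R \<theta>"
      using polar_form[of "a - c"] False by (metis d_def right_minus_eq)
    show ?thesis
    proof (rule field_le_epsilon)
      fix e :: real assume e: "e > 0"
      define M where "M = d * v c / e"
      have M: "M > 0" using d e pos by (simp add: M_def)
      define l where "l = sqrt (M * (M + d))"
      have l: "l > 0" "l\<^sup>2 = M * (M + d)" using M d by (auto simp: l_def)
      have "l\<^sup>2 \<le> (M + d)\<^sup>2" using M d l by (simp add: power2_eq_square mult_right_mono)
      then have "l \<le> M + d" by (rule power2_le_imp_le) (use M d in simp)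
      then have "v ((c - M *\<^sub>R \<theta>) + (M + d) *\<^sub>R \<theta>) \<le> kelvin l (\<lambda>y. v ((c - M *\<^sub>R \<theta>) + y)) ((M + d) *\<^sub>R \<theta>)"
        using th M d by (intro spheres l) simp
      also have "\<dots> = (M + d)\<^sup>2 / l\<^sup>2 * v ((c - M *\<^sub>R \<theta>) + (l\<^sup>2 / (M + d)) *\<^sub>R \<theta>)"
        using M d by (intro kelvin_polar th) simp
      also have "l\<^sup>2 / (M + d) = M" using l M d by simp
      also have "(M + d)\<^sup>2 / l\<^sup>2 * v ((c - M *\<^sub>R \<theta>) + M *\<^sub>R \<theta>) = (1 + d / M) * v c"
      proof -
        have "(M + d)\<^sup>2 / l\<^sup>2 = 1 + d / M"
          unfolding l(2) using M d by (simp add: power2_eq_square add_divide_distrib)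
        then show ?thesis by simp
      qed
      also have "\<dots> = v c + e" using M d e pos[of c] by (simp add: M_def field_simps)
      also have "(c - M *\<^sub>R \<theta>) + (M + d) *\<^sub>R \<theta> = a" using th(2) by (simp add: algebra_simps)
      finally show "v a \<le> v c + e" .
    qed
  qed simp
  show ?thesis using le[of a c] le[of c a] by simp
qed

context conformal_solution
begin

lemma translate: "conformal_solution U F (\<lambda>y. v (x + y)) (\<lambda>y. G (x + y)) (\<lambda>y. H (x + y)) q"
  by unfold_locales (use has_jet_translate[OF J] pos adm eq q in auto)

lemma sphere_inequality:
  assumes growth: "\<And>y. R \<le> norm y \<Longrightarrow> v y \<le> b * (y \<bullet> y)" and b: "0 \<le> b"
    and l: "0 < l" "l\<^sup>2 * b < v x" "l \<le> norm z"
  shows "v (x + z) \<le> kelvin l (\<lambda>y. v (x + y)) z"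
proof -
  interpret T: conformal_solution U F "\<lambda>y. v (x + y)" "\<lambda>y. G (x + y)" "\<lambda>y. H (x + y)" q
    by (rule translate)
  define b' where "b' = b + (v x - l\<^sup>2 * b) / (2 * l\<^sup>2)"
  have b': "b < b'" "l\<^sup>2 * b' < v x"
  proof -
    define s where "s = l\<^sup>2"
    have "s > 0" "s * b < v x" using l by (auto simp: s_def)
    then show "b < b'" "l\<^sup>2 * b' < v x"
      unfolding b'_def s_def[symmetric] by (auto simp: field_simps)
  qed
  obtain R' where "\<And>y. R' \<le> norm y \<Longrightarrow> v (x + y) \<le> b' * (y \<bullet> y)"
    using quadratic_growth_translate[OF growth b b'(1)] by blast
  then show ?thesis
    by (rule T.moving_sphere) (use b b' l in auto)
qed

text \<open>The limit of the inequalities for smaller radii; a bound \<open>v(y) \<le> \<beta> |y|\<^sup>2\<close> at infinity with the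
  optimal \<open>\<beta>\<close> itself need not hold.\<close>

lemma critical_sphere_inequality:
  assumes growth: "\<And>b. \<beta> < b \<Longrightarrow> \<exists>R. \<forall>y. R \<le> norm y \<longrightarrow> v y \<le> b * (y \<bullet> y)" and \<beta>: "0 < \<beta>"
    and l: "l = sqrt (v x / \<beta>)" "l \<le> norm z"
  shows "v (x + z) \<le> kelvin l (\<lambda>y. v (x + y)) z"
proof -
  interpret T: conformal_solution U F "\<lambda>y. v (x + y)" "\<lambda>y. G (x + y)" "\<lambda>y. H (x + y)" q
    by (rule translate)
  have l0: "l > 0" "l\<^sup>2 = v x / \<beta>" using pos[of x] \<beta> l by auto
  show ?thesis
  proof (rule T.kelvin_le_limit)
    fix \<rho> assume \<rho>: "0 < \<rho>" "\<rho> < l"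
    define s where "s = \<rho>\<^sup>2"
    have "\<rho>\<^sup>2 < l\<^sup>2" using \<rho> by (intro power_strict_mono) auto
    then have "s < v x / \<beta>" unfolding s_def l0(2) .
    then have s: "s > 0" "s * \<beta> < v x" using \<rho> pos_less_divide_eq[OF \<beta>] by (auto simp: s_def)
    define b where "b = \<beta> + (v x - s * \<beta>) / (2 * s)"
    have b: "\<beta> < b" "s * b < v x" using s by (auto simp: b_def field_simps)
    obtain R where "\<And>y. R \<le> norm y \<Longrightarrow> v y \<le> b * (y \<bullet> y)" using growth[OF b(1)] by blast
    then show "v (x + z) \<le> kelvin \<rho> (\<lambda>y. v (x + y)) z"
      using b \<beta> \<rho> l(2) unfolding s_def by (intro sphere_inequality) auto
  qed (use l(2) l0(1) in auto)
qed

text \<open>At the critical radius the Kelvin transform of \<open>v\<close> is asymptotic to \<open>\<beta> |z|\<^sup>2\<close>, and the first order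
  Taylor expansion of \<open>v\<close> at the centre supplies the next term. The inverse point has distance \<open>l\<^sup>2/|z|\<close> from the centre, so the
  Taylor remainder, multiplied by \<open>|z|\<^sup>2/l\<^sup>2\<close>, is small compared with \<open>|z|\<close>.\<close>

lemma asymptotic_upper_bound:
  assumes growth: "\<And>b. \<beta> < b \<Longrightarrow> \<exists>R. \<forall>y. R \<le> norm y \<longrightarrow> v y \<le> b * (y \<bullet> y)" and \<beta>: "0 < \<beta>"
    and \<epsilon>: "0 < \<epsilon>"
  obtains R where "\<And>z. R \<le> norm z \<Longrightarrow> v (x + z) \<le> \<beta> * (z \<bullet> z) + G x \<bullet> z + \<epsilon> * norm z"
proof -
  define l where "l = sqrt (v x / \<beta>)"
  have l: "l > 0" "l\<^sup>2 = v x / \<beta>" using pos[of x] \<beta> by (auto simp: l_def)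
  have "(v has_derivative (\<lambda>h. G x \<bullet> h)) (at x)" using J by (simp add: has_jet_def)
  then obtain d where d: "d > 0" "\<And>y. norm (y - x) < d \<Longrightarrow> norm (v y - v x - G x \<bullet> (y - x)) \<le> \<epsilon> * norm (y - x)"
    using \<epsilon> unfolding has_derivative_at_alt by blast
  have "v (x + z) \<le> \<beta> * (z \<bullet> z) + G x \<bullet> z + \<epsilon> * norm z" if z: "max l (2 * l\<^sup>2 / d) \<le> norm z" for z
  proof -
    define r where "r = norm z"
    have r: "l \<le> r" "r > 0" "2 * l\<^sup>2 / d \<le> r" using z l by (auto simp: r_def)
    have zz: "z \<bullet> z = r\<^sup>2" by (simp add: r_def power2_norm_eq_inner)
    define h where "h = sphere_inv l z"
    have h: "h = (l\<^sup>2 / r\<^sup>2) *\<^sub>R z" by (simp add: h_def sphere_inv_def zz)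
    have nh: "norm h = l\<^sup>2 / r" using r by (simp add: h r_def[symmetric] power2_eq_square)
    have "2 * l\<^sup>2 \<le> r * d" using r(3) d(1) by (simp add: pos_divide_le_eq)
    moreover have "0 < l\<^sup>2" using l(1) by (rule zero_less_power)
    ultimately have "l\<^sup>2 < d * r" by (simp only: mult.commute[of d r])
    then have "norm h < d" unfolding nh using r by (simp add: pos_divide_less_eq)
    then have "norm (v (x + h) - v x - G x \<bullet> h) \<le> \<epsilon> * norm h" using d(2)[of "x + h"] by simp
    then have vh: "v (x + h) \<le> v x + G x \<bullet> h + \<epsilon> * norm h" by (simp add: abs_le_iff)
    have "v (x + z) \<le> kelvin l (\<lambda>y. v (x + y)) z"
      by (rule critical_sphere_inequality[OF growth \<beta> l_def]) (use r in \<open>auto simp: r_def\<close>)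
    also have "\<dots> = r\<^sup>2 / l\<^sup>2 * v (x + h)" by (simp add: kelvin_def h_def zz)
    also have "\<dots> \<le> r\<^sup>2 / l\<^sup>2 * (v x + G x \<bullet> h + \<epsilon> * norm h)" using vh by (intro mult_left_mono) auto
    also have "\<dots> = r\<^sup>2 / l\<^sup>2 * v x + G x \<bullet> z + \<epsilon> * r"
    proof -
      have "c * (s + t + \<epsilon> * e) = c * s + c * t + \<epsilon> * (c * e)" for c s t e :: real
        by (simp add: algebra_simps)
      moreover have "r\<^sup>2 / l\<^sup>2 * (G x \<bullet> h) = G x \<bullet> z" using l(1) r(2) by (simp add: h)
      moreover have "r\<^sup>2 / l\<^sup>2 * norm h = r" using l(1) r(2) by (simp add: nh power2_eq_square)
      ultimately show ?thesis by metis
    qed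
    also have "r\<^sup>2 / l\<^sup>2 * v x = \<beta> * r\<^sup>2" using l \<beta> pos[of x] by simp
    finally show ?thesis by (simp add: zz r_def)
  qed
  then show ?thesis using that by blast
qed

text \<open>Bounds from different centres \<open>x\<close> are compared about a common origin \<open>y0\<close>; only the linear coefficient changes, up to
  constants that the error term absorbs.\<close>

lemma asymptotic_upper_bound_recentred:
  assumes growth: "\<And>b. \<beta> < b \<Longrightarrow> \<exists>R. \<forall>y. R \<le> norm y \<longrightarrow> v y \<le> b * (y \<bullet> y)" and \<beta>: "0 < \<beta>"
    and \<epsilon>: "0 < \<epsilon>"
  obtains R where "\<And>y. R \<le> norm y \<Longrightarrow>
    v (y0 + y) \<le> \<beta> * (y \<bullet> y) + (G x - (2 * \<beta>) *\<^sub>R x + (2 * \<beta>) *\<^sub>R y0) \<bullet> y + \<epsilon> * norm y"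
proof -
  obtain R where R: "\<And>z. R \<le> norm z \<Longrightarrow> v (x + z) \<le> \<beta> * (z \<bullet> z) + G x \<bullet> z + \<epsilon>/2 * norm z"
    using asymptotic_upper_bound[OF growth \<beta>, of "\<epsilon>/2" x] \<epsilon> by auto
  define s where "s = y0 - x"
  define C where "C = \<beta> * (s \<bullet> s) + \<bar>G x \<bullet> s\<bar> + \<epsilon>/2 * norm s"
  define R' where "R' = max (R + norm s) (2 * C / \<epsilon>)"
  have "v (y0 + y) \<le> \<beta> * (y \<bullet> y) + (G x - (2 * \<beta>) *\<^sub>R x + (2 * \<beta>) *\<^sub>R y0) \<bullet> y + \<epsilon> * norm y"
    if y: "R' \<le> norm y" for y
  proof -
    have "norm y \<le> norm (s + y) + norm s" using norm_triangle_ineq4[of "s + y" s] by simp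
    then have "R \<le> norm (s + y)" using y by (simp add: R'_def)
    from R[OF this] have "v (y0 + y) \<le> \<beta> * ((s + y) \<bullet> (s + y)) + G x \<bullet> (s + y) + \<epsilon>/2 * norm (s + y)"
      by (simp add: s_def add.assoc[symmetric])
    also have "\<epsilon>/2 * norm (s + y) \<le> \<epsilon>/2 * (norm s + norm y)"
      using \<epsilon> by (intro mult_left_mono norm_triangle_ineq) auto
    also have "\<beta> * ((s + y) \<bullet> (s + y)) + G x \<bullet> (s + y) + \<epsilon>/2 * (norm s + norm y)
       = \<beta> * (y \<bullet> y) + (G x + (2 * \<beta>) *\<^sub>R s) \<bullet> y + \<epsilon>/2 * norm y + (\<beta> * (s \<bullet> s) + G x \<bullet> s + \<epsilon>/2 * norm s)"
      by (simp add: inner_add_left inner_add_right inner_commute[of y s] algebra_simps)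
    also have "\<dots> \<le> \<beta> * (y \<bullet> y) + (G x + (2 * \<beta>) *\<^sub>R s) \<bullet> y + \<epsilon>/2 * norm y + C"
      by (simp add: C_def)
    also have "C \<le> \<epsilon>/2 * norm y"
    proof -
      have "2 * C / \<epsilon> \<le> norm y" using y by (simp add: R'_def)
      then show ?thesis using \<epsilon> by (simp add: pos_divide_le_eq mult.commute)
    qed
    also have "G x + (2 * \<beta>) *\<^sub>R s = G x - (2 * \<beta>) *\<^sub>R x + (2 * \<beta>) *\<^sub>R y0" by (simp add: s_def algebra_simps)
    finally show ?thesis by simp
  qed
  then show ?thesis using that by blast
qed

end

text \<open>Here \<open>w\<close> is the original solution, \<open>k = (n-2)/2\<close>, and \<open>v = w\<^bsup>-1/k\<^esup>\<close>.\<close>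

locale superharmonic_solution = conformal_solution U F v G H q
  for U :: "(real^'n^'n) set" and F v G H q +
  fixes k :: real and w :: "real^'n \<Rightarrow> real" and Gw Hw
  assumes n: "real CARD('n) = 2 * k + 2" and k: "0 < k"
    and Jw: "has_jet w Gw Hw UNIV" and w_pos: "\<And>x. 0 < w x"
    and w_super: "\<And>x. mat 1 \<bullet> Hw x \<le> 0"
    and v_eq: "\<And>x. v x = w x powr (- 1 / k)"
begin

definition growth_rates :: "real set" where
  "growth_rates = {b. 0 \<le> b \<and> (\<exists>R. \<forall>y. R \<le> norm y \<longrightarrow> v y \<le> b * (y \<bullet> y))}"

lemma growth_rates_nonempty: "growth_rates \<noteq> {}"
proof -
  obtain c where c: "c > 0" "\<And>y. 1 \<le> norm y \<Longrightarrow> c * (y \<bullet> y) powr (-k) \<le> w y"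
    using superharmonic_lower_bound[OF n k Jw w_pos w_super] by blast
  have "v y \<le> c powr (- 1 / k) * (y \<bullet> y)" if y: "1 \<le> norm y" for y
  proof -
    have f: "y \<bullet> y > 0" using y by auto
    have "v y \<le> (c * (y \<bullet> y) powr (-k)) powr (- 1 / k)"
      unfolding v_eq using c y f k by (intro powr_mono2') auto
    also have "\<dots> = c powr (- 1 / k) * (y \<bullet> y)" using c f k by (simp add: powr_mult powr_powr)
    finally show ?thesis .
  qed
  then have "c powr (- 1 / k) \<in> growth_rates" by (auto simp: growth_rates_def)
  then show ?thesis by blast
qed

definition growth_rate :: real where
  "growth_rate = Inf growth_rates"

lemma growth_rates_bdd: "bdd_below growth_rates"
  by (auto simp: growth_rates_def bdd_below_def)

lemma growth_rate_nonneg: "0 \<le> growth_rate"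
  unfolding growth_rate_def using growth_rates_nonempty
  by (intro cInf_greatest) (auto simp: growth_rates_def)

lemma growth_above:
  assumes "growth_rate < b"
  shows "\<exists>R. \<forall>y. R \<le> norm y \<longrightarrow> v y \<le> b * (y \<bullet> y)"
proof -
  obtain b' R where b': "b' < b" "\<And>y. R \<le> norm y \<Longrightarrow> v y \<le> b' * (y \<bullet> y)"
  proof -
    obtain b' where "b' \<in> growth_rates" "b' < b"
      using cInf_lessD[OF growth_rates_nonempty assms[unfolded growth_rate_def]] by blast
    then show ?thesis using that by (auto simp: growth_rates_def)
  qed
  have "v y \<le> b * (y \<bullet> y)" if "R \<le> norm y" for y
  proof -
    have "b' * (y \<bullet> y) \<le> b * (y \<bullet> y)" using b' by (intro mult_right_mono) auto
    then show ?thesis using b'(2)[OF that] by linarith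
  qed
  then show ?thesis by blast
qed

lemma growth_rate_optimal:
  assumes "\<And>y. R \<le> norm y \<Longrightarrow> v (x + y) \<le> b * (y \<bullet> y)"
  shows "growth_rate \<le> b"
proof (rule dense_ge)
  fix b' assume b': "b < b'"
  have "b \<ge> 0"
  proof -
    let ?y = "(\<bar>R\<bar> + 1) *\<^sub>R axis undefined 1 :: real^'n"
    have "R \<le> norm ?y" by simp
    then have "0 < b * (?y \<bullet> ?y)" using assms pos by (meson less_le_trans)
    then show ?thesis by (smt (verit) inner_ge_zero mult_nonpos_nonneg)
  qed
  obtain R' where "\<And>y. R' \<le> norm y \<Longrightarrow> v (x + (- x + y)) \<le> b' * (y \<bullet> y)"
    using quadratic_growth_translate[of R "\<lambda>y. v (x + y)" b b' "- x", OF assms \<open>b \<ge> 0\<close> b'] by blast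
  then have "b' \<in> growth_rates" using \<open>b \<ge> 0\<close> b' by (auto simp: growth_rates_def)
  then show "growth_rate \<le> b'" unfolding growth_rate_def by (intro cInf_lower growth_rates_bdd)
qed

lemma constant_of_zero_rate:
  assumes "growth_rate = 0"
  shows "v a = v c"
proof (rule constant_if_all_spheres[OF pos])
  fix x z :: "real^'n" and l :: real
  assume l: "0 < l" "l \<le> norm z"
  define b where "b = v x / (2 * l\<^sup>2)"
  have b: "b > 0" "l\<^sup>2 * b < v x" using l pos[of x] by (auto simp: b_def)
  obtain R where "\<And>y. R \<le> norm y \<Longrightarrow> v y \<le> b * (y \<bullet> y)" using growth_above[of b] b assms by auto
  then show "v (x + z) \<le> kelvin l (\<lambda>y. v (x + y)) z"
    using b l by (intro sphere_inequality) auto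
qed

text \<open>About \<open>y0\<close>, half way between the vertices of the two paraboloids that bound \<open>v\<close>, the linear coefficients
  of the bounds are \<open>g\<close> and \<open>-g\<close>. If \<open>g\<close> were nonzero, \<open>growth_improvement\<close> would lower the growth rate.\<close>

lemma gradient_affine:
  assumes \<beta>: "0 < growth_rate"
  shows "G x1 - (2 * growth_rate) *\<^sub>R x1 = G x2 - (2 * growth_rate) *\<^sub>R x2"
proof (rule ccontr)
  define \<beta> where "\<beta> = growth_rate"
  note \<beta>pos = \<beta>[folded \<beta>_def]
  note growth = growth_above[folded \<beta>_def]
  define p1 where "p1 = G x1 - (2 * \<beta>) *\<^sub>R x1"
  define p2 where "p2 = G x2 - (2 * \<beta>) *\<^sub>R x2"
  assume "\<not> ?thesis"
  then have ne: "p1 \<noteq> p2" by (simp add: p1_def p2_def \<beta>_def)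
  define g where "g = (1/2) *\<^sub>R (p1 - p2)"
  define y0 where "y0 = (- 1 / (4 * \<beta>)) *\<^sub>R (p1 + p2)"
  have g: "g \<noteq> 0" using ne by (simp add: g_def)
  have y0: "(2 * \<beta>) *\<^sub>R y0 = - ((1/2) *\<^sub>R (p1 + p2))" using \<beta>pos by (simp add: y0_def)
  have gp: "p1 + (2 * \<beta>) *\<^sub>R y0 = g" "p2 + (2 * \<beta>) *\<^sub>R y0 = - g"
  proof -
    have h: "p1 = (1/2) *\<^sub>R p1 + (1/2) *\<^sub>R p1" "p2 = (1/2) *\<^sub>R p2 + (1/2) *\<^sub>R p2"
      by (simp_all flip: scaleR_left_distrib)
    show "p1 + (2 * \<beta>) *\<^sub>R y0 = g" unfolding y0 g_def by (subst h(1)) (simp add: algebra_simps)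
    show "p2 + (2 * \<beta>) *\<^sub>R y0 = - g" unfolding y0 g_def by (subst h(2)) (simp add: algebra_simps)
  qed
  have up: "\<exists>R. \<forall>y. R \<le> norm y \<longrightarrow> w (y0 + y) powr (- 1 / k) \<le> \<beta> * (y \<bullet> y) - \<bar>g \<bullet> y\<bar> + \<epsilon> * norm y"
    if \<epsilon>: "\<epsilon> > 0" for \<epsilon>
  proof -
    obtain R1 where R1: "\<And>y. R1 \<le> norm y \<Longrightarrow> v (y0 + y) \<le> \<beta> * (y \<bullet> y) + g \<bullet> y + \<epsilon> * norm y"
      using asymptotic_upper_bound_recentred[OF growth \<beta>pos \<epsilon>, of y0 x1] gp(1) by (auto simp: p1_def)
    obtain R2 where R2: "\<And>y. R2 \<le> norm y \<Longrightarrow> v (y0 + y) \<le> \<beta> * (y \<bullet> y) + (- g) \<bullet> y + \<epsilon> * norm y"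
      using asymptotic_upper_bound_recentred[OF growth \<beta>pos \<epsilon>, of y0 x2] gp(2) by (auto simp: p2_def)
    have "v (y0 + y) \<le> \<beta> * (y \<bullet> y) - \<bar>g \<bullet> y\<bar> + \<epsilon> * norm y" if "max R1 R2 \<le> norm y" for y
      using R1[of y] R2[of y] that by (auto simp: abs_if)
    then show ?thesis unfolding v_eq by blast
  qed
  obtain b R where b: "b < \<beta>" "\<And>y. R \<le> norm y \<Longrightarrow> w (y0 + y) powr (- 1 / k) \<le> b * (y \<bullet> y)"
    using growth_improvement[OF n k has_jet_translate[OF Jw] w_pos w_super \<beta>pos g up] by blast
  have "growth_rate \<le> b" by (rule growth_rate_optimal[of R y0]) (use b in \<open>simp add: v_eq\<close>)
  then show False using b by (simp add: \<beta>_def)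
qed

text \<open>For a positive growth rate the gradient is affine with linear part \<open>2 \<beta>\<close>, so \<open>v\<close> is a quadratic
  polynomial with a constant matrix, and the equation makes \<open>v\<^sup>q\<close> constant although \<open>v\<close> is not.\<close>

theorem classification:
  "(\<exists>c. \<forall>x. v x = c) \<or>
   (q = 0 \<and> (\<exists>xbar \<beta> d. 0 < \<beta> \<and> 0 < d \<and> (2 * \<beta> * d) *\<^sub>R mat 1 \<in> U \<and> F ((2 * \<beta> * d) *\<^sub>R mat 1) = 1 \<and>
      (\<forall>x. v x = \<beta> * (norm (x - xbar))\<^sup>2 + d)))"
proof (cases "growth_rate = 0")
  case True
  then show ?thesis using constant_of_zero_rate by blast
next
  case False
  define \<beta> where "\<beta> = growth_rate"
  have \<beta>: "\<beta> > 0" using False growth_rate_nonneg by (simp add: \<beta>_def)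
  define p0 where "p0 = G 0"
  have G: "G x = (2 * \<beta>) *\<^sub>R x + p0" for x
    using gradient_affine[of x 0] \<beta> by (simp add: \<beta>_def p0_def algebra_simps)
  define xbar where "xbar = (- 1 / (2 * \<beta>)) *\<^sub>R p0"
  have p0: "p0 = - ((2 * \<beta>) *\<^sub>R xbar)" using \<beta> by (simp add: xbar_def)
  have G': "G x = (2 * \<beta>) *\<^sub>R (x - xbar)" for x unfolding G p0 by (simp add: algebra_simps)
  have H: "H x = (2 * \<beta>) *\<^sub>R mat 1" for x
  proof -
    have "(G has_derivative (\<lambda>h. H x *v h)) (at x)" using J by (simp add: has_jet_def)
    moreover have "(G has_derivative (\<lambda>h. (2 * \<beta>) *\<^sub>R h)) (at x)"
      unfolding G'[abs_def] by (auto intro!: derivative_eq_intros)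
    ultimately have "(\<lambda>h. H x *v h) = (\<lambda>h. (2 * \<beta>) *\<^sub>R h)" by (rule has_derivative_unique)
    then have "H x *v h = ((2 * \<beta>) *\<^sub>R mat 1) *v h" for h
      by (simp add: fun_eq_iff flip: scaleR_matrix_vector_assoc)
    then show ?thesis by (simp add: matrix_eq)
  qed
  define d where "d = v xbar"
  have d: "d > 0" using pos by (simp add: d_def)
  have v: "v x = \<beta> * (norm (x - xbar))\<^sup>2 + d" for x
  proof -
    have "((\<lambda>x. v x - \<beta> * ((x - xbar) \<bullet> (x - xbar))) has_derivative (\<lambda>h. 0)) (at x)" for x
    proof -
      have "(v has_derivative (\<lambda>h. G x \<bullet> h)) (at x)" using J by (simp add: has_jet_def)
      then show ?thesis unfolding G'
        by (auto intro!: derivative_eq_intros simp: inner_commute algebra_simps)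
    qed
    then have "v x - \<beta> * ((x - xbar) \<bullet> (x - xbar)) = v xbar - \<beta> * ((xbar - xbar) \<bullet> (xbar - xbar))"
      by (intro has_derivative_zero_unique[OF convex_UNIV]) (auto intro: has_derivative_at_withinI)
    then show ?thesis by (simp add: d_def power2_norm_eq_inner)
  qed
  have A: "schouten (v x) (G x) (H x) = (2 * \<beta> * d) *\<^sub>R mat 1" for x
  proof -
    define s where "s = x - xbar"
    have "v x * (2 * \<beta>) - (G x \<bullet> G x) / 2 = 2 * \<beta> * d"
      unfolding v G' s_def[symmetric] by (simp add: power2_norm_eq_inner algebra_simps)
    then show ?thesis unfolding schouten_def H by (simp flip: scaleR_left_diff_distrib)
  qed
  have FA: "F ((2 * \<beta> * d) *\<^sub>R mat 1) = v x powr q" for x using eq[of x] unfolding A .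
  have "q = 0"
  proof (rule ccontr)
    assume "q \<noteq> 0"
    then have "q > 0" using q by simp
    then have "d powr q < (\<beta> + d) powr q" using \<beta> d by (intro powr_less_mono2) auto
    moreover have "v xbar = d" "v (xbar + axis undefined 1) = \<beta> + d" by (simp_all add: v)
    ultimately show False using FA[of xbar] FA[of "xbar + axis undefined 1"] by simp
  qed
  moreover have "F ((2 * \<beta> * d) *\<^sub>R mat 1) = 1" using FA[of 0] pos[of 0] \<open>q = 0\<close> by simp
  moreover have "(2 * \<beta> * d) *\<^sub>R mat 1 \<in> U" using adm[of 0] unfolding A .
  ultimately show ?thesis using \<beta> d v by blast
qed

end

section \<open>Passing between \<open>u\<close> and \<open>v\<close>\<close>

lemma dir_deriv_eq:
  assumes "(f has_derivative D) (at x)"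
  shows "dir_deriv f v x = D v"
proof -
  interpret D: bounded_linear D using assms by (rule has_derivative_bounded_linear)
  have "((\<lambda>t::real. x + t *\<^sub>R v) has_derivative (\<lambda>t. t *\<^sub>R v)) (at 0)"
    by (auto intro!: derivative_eq_intros)
  moreover have "(f has_derivative D) (at (x + 0 *\<^sub>R v))" using assms by simp
  ultimately have "((\<lambda>t. f (x + t *\<^sub>R v)) has_derivative (\<lambda>t. D (t *\<^sub>R v))) (at 0)"
    by (rule has_derivative_compose)
  then have "((\<lambda>t. f (x + t *\<^sub>R v)) has_real_derivative D v) (at 0)"
    by (simp add: has_field_derivative_def D.scaleR mult.commute[of _ "D v"])
  then show ?thesis by (simp add: dir_deriv_def DERIV_imp_deriv)
qed

lemma derivative_gradient:
  fixes f :: "real^'n \<Rightarrow> real"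
  assumes "f differentiable (at x)"
  shows "(f has_derivative (\<lambda>h. gradient f x \<bullet> h)) (at x)"
proof -
  obtain D where D: "(f has_derivative D) (at x)" using assms by (auto simp: differentiable_def)
  interpret D: bounded_linear D using D by (rule has_derivative_bounded_linear)
  have "D h = gradient f x \<bullet> h" for h
  proof -
    have "D h = D (\<Sum>i\<in>UNIV. h $ i *\<^sub>R axis i 1)"
      using basis_expansion[of h] by (simp add: scalar_mult_eq_scaleR)
    also have "\<dots> = (\<Sum>i\<in>UNIV. h $ i * partial i f x)"
      by (simp add: D.sum D.scaleR partial_def dir_deriv_eq[OF D])
    also have "\<dots> = gradient f x \<bullet> h" by (simp add: gradient_def inner_vec_def mult.commute)
    finally show ?thesis .
  qed
  then show ?thesis using D by (simp add: ext[of D "\<lambda>h. gradient f x \<bullet> h"])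
qed

lemma has_derivative_vec:
  fixes f :: "'n::finite \<Rightarrow> 'a::euclidean_space \<Rightarrow> real"
  assumes "\<And>j. (f j has_derivative D j) (at x)"
  shows "((\<lambda>y. \<chi> j. f j y) has_derivative (\<lambda>h. \<chi> j. D j h)) (at x)"
  by (rule has_derivative_componentwise_within[THEN iffD2]) (auto simp: Basis_vec_def inner_axis assms)

text \<open>The derivative of the gradient is the transpose of the Hessian matrix, which is why symmetry is
  assumed; here it comes from the symmetry of the conformal Hessian, by \<open>conformal_hessian_symmetric\<close>.\<close>

lemma C2_jet:
  fixes u :: "real^'n \<Rightarrow> real"
  assumes "C2 u" and sym: "\<And>x. hessian u x \<in> symmetric_mats"
  shows "has_jet u (gradient u) (hessian u) UNIV"
  unfolding has_jet_def
proof (intro conjI ballI)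
  fix x
  have d: "u differentiable (at x)" "\<And>j. partial j u differentiable (at x)" using assms(1) by (auto simp: C2_def)
  show "(u has_derivative (\<lambda>h. gradient u x \<bullet> h)) (at x)" by (rule derivative_gradient[OF d(1)])
  have "((\<lambda>y. \<chi> j. partial j u y) has_derivative (\<lambda>h. \<chi> j. gradient (partial j u) x \<bullet> h)) (at x)"
    by (rule has_derivative_vec) (rule derivative_gradient[OF d(2)])
  moreover have "(\<chi> j. gradient (partial j u) x \<bullet> h) = hessian u x *v h" for h
  proof -
    have "gradient (partial j u) x \<bullet> h = (hessian u x *v h) $ j" for j
    proof -
      have "partial i (partial j u) x = hessian u x $ j $ i" for i
        using sym[of x] by (simp add: symmetric_mats_iff hessian_def)
      then show ?thesis by (simp add: gradient_def inner_vec_def matrix_vector_mult_def)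
    qed
    then show ?thesis by (simp add: vec_eq_iff)
  qed
  ultimately show "(gradient u has_derivative (\<lambda>h. hessian u x *v h)) (at x)"
    by (simp add: gradient_def[abs_def])
next
  show "continuous_on UNIV (hessian u)"
    unfolding hessian_def[abs_def] using assms(1) by (intro continuous_intros) (auto simp: C2_def)
qed

lemma conformal_hessian_symmetric:
  fixes u :: "real^'n \<Rightarrow> real"
  assumes "CARD('n) \<ge> 3" "0 < u x" "conformal_hessian u x \<in> symmetric_mats"
  shows "hessian u x \<in> symmetric_mats"
proof -
  define c1 where "c1 = - (2 / (real CARD('n) - 2)) * u x powr (- ((real CARD('n) + 2) / (real CARD('n) - 2)))"
  define X where "X = (2 * real CARD('n) / (real CARD('n) - 2)\<^sup>2 * u x powr (- (2 * real CARD('n) / (real CARD('n) - 2)))) *\<^sub>R tensor (gradient u x) (gradient u x)"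
  define Y where "Y = (2 / (real CARD('n) - 2)\<^sup>2 * u x powr (- (2 * real CARD('n) / (real CARD('n) - 2))) * (norm (gradient u x))\<^sup>2) *\<^sub>R (mat 1 :: real^'n^'n)"
  have c: "conformal_hessian u x = c1 *\<^sub>R hessian u x + X - Y"
    by (simp add: conformal_hessian_def Let_def c1_def X_def Y_def)
  have "c1 \<noteq> 0" using assms by (simp add: c1_def)
  have "hessian u x = (1 / c1) *\<^sub>R (conformal_hessian u x - X + Y)" using \<open>c1 \<noteq> 0\<close> by (simp add: c)
  also have "\<dots> \<in> symmetric_mats"
    unfolding X_def Y_def by (intro symmetric_mats_simps assms)
  finally show ?thesis .
qed

text \<open>For \<open>v = u\<^sup>a\<close> the product \<open>v \<nabla>\<^sup>2v\<close> contributes \<open>a (a-1)\<close> times \<open>\<nabla>u \<otimes> \<nabla>u\<close> and the squared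
  gradient \<open>a\<^sup>2/2\<close> times \<open>|\<nabla>u|\<^sup>2 I\<close>; at \<open>a = -2/(n-2)\<close> these coefficients are \<open>2n/(n-2)\<^sup>2\<close> and
  \<open>2/(n-2)\<^sup>2\<close>.\<close>

lemma conformal_hessian_schouten:
  fixes u :: "real^'n \<Rightarrow> real"
  assumes n3: "CARD('n) \<ge> 3" and u: "0 < u x" and a: "a = - 2 / (real CARD('n) - 2)"
  shows "conformal_hessian u x = schouten (u x powr a) ((a * u x powr (a - 1)) *\<^sub>R gradient u x)
     ((a * u x powr (a - 1)) *\<^sub>R hessian u x + (a * (a - 1) * u x powr (a - 2)) *\<^sub>R tensor (gradient u x) (gradient u x))"
proof -
  define n where "n = real CARD('n)"
  have n: "n - 2 > 0" using n3 by (simp add: n_def)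
  have a: "a = - 2 / (n - 2)" using a by (simp add: n_def)
  define m where "m = n - 2"
  have m: "m > 0" "n = m + 2" "n - 2 = m" using n by (simp_all add: m_def)
  have e1: "- ((n + 2) / (n - 2)) = a + (a - 1)" unfolding a m using m(1) by (simp add: field_simps)
  have e2: "- (2 * n / (n - 2)) = a + (a - 2)" unfolding a m using m(1) by (simp add: field_simps)
  have c1: "- (2 / (n - 2)) = a" by (simp add: a)
  have c2: "2 * n / (n - 2)\<^sup>2 = a * (a - 1)"
    unfolding a m using m(1) by (simp add: field_simps power2_eq_square)
  have c3: "2 / (n - 2)\<^sup>2 = a\<^sup>2 / 2" using n by (simp add: a power_divide)
  have sq: "u x powr (a - 1) * u x powr (a - 1) = u x powr (a + (a - 2))"
    by (simp flip: powr_add)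
  have "conformal_hessian u x = (a * u x powr (a + (a - 1))) *\<^sub>R hessian u x
     + (a * (a - 1) * u x powr (a + (a - 2))) *\<^sub>R tensor (gradient u x) (gradient u x)
     - (a\<^sup>2 / 2 * u x powr (a + (a - 2)) * (norm (gradient u x))\<^sup>2) *\<^sub>R mat 1"
    unfolding conformal_hessian_def Let_def n_def[symmetric] c2 c3 e1 e2 c1 ..
  also have "\<dots> = schouten (u x powr a) ((a * u x powr (a - 1)) *\<^sub>R gradient u x)
     ((a * u x powr (a - 1)) *\<^sub>R hessian u x + (a * (a - 1) * u x powr (a - 2)) *\<^sub>R tensor (gradient u x) (gradient u x))"
  proof -
    have "a\<^sup>2 / 2 * u x powr (a + (a - 2)) * (norm (gradient u x))\<^sup>2 =
       (((a * u x powr (a - 1)) *\<^sub>R gradient u x) \<bullet> ((a * u x powr (a - 1)) *\<^sub>R gradient u x)) / 2"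
      unfolding sq[symmetric] power2_norm_eq_inner by (simp add: power2_eq_square mult_ac)
    then show ?thesis
      unfolding schouten_def by (simp only: scaleR_add_right scaleR_scaleR powr_add mult_ac)
  qed
  finally show ?thesis .
qed

theorem theorem1p3:
  fixes U :: "(real^'n^'n) set"
    and F :: "real^'n^'n \<Rightarrow> real"
    and u :: "real^'n \<Rightarrow> real"
    and p n :: real
  defines "n \<equiv> real CARD('n)"
  assumes dim: "CARD('n) \<ge> 3"
    and U_open: "openin (top_of_set symmetric_mats) U"
    and U_inv: "\<And>Q :: real^'n^'n. orthogonal_matrix Q \<Longrightarrow> (\<lambda>M. matrix_inv Q ** M ** Q) ` U = U"
    and U_conv: "\<And>M N. M \<in> symmetric_mats \<Longrightarrow> N \<in> posdef_mats \<Longrightarrow>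
        convex (U \<inter> {M + t *\<^sub>R N | t. 0 < t})"
    and F_C1: "C1_on_sym U F"
    and F_inv: "\<And>M Q. M \<in> U \<Longrightarrow> orthogonal_matrix Q \<Longrightarrow> F (matrix_inv Q ** M ** Q) = F M"
    and F_elliptic: "\<And>M. M \<in> U \<Longrightarrow> mat_partials F M \<in> posdef_mats"
    and u_C2: "C2 u"
    and u_superharmonic: "superharmonic u"
    and u_pos: "\<And>x. u x > 0"
    and u_adm: "\<And>x. conformal_hessian u x \<in> U"
    and u_eq: "\<And>x. F (conformal_hessian u x) = u x powr (p - (n + 2) / (n - 2))"
    and p_le: "p \<le> (n + 2) / (n - 2)"
  shows "(\<exists>c. \<forall>x. u x = c) \<or>
    (p = (n + 2) / (n - 2) \<and>
     (\<exists>xbar a b. a > 0 \<and> b > 0 \<and>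
        (2 * b\<^sup>2 / a\<^sup>2) *\<^sub>R mat 1 \<in> U \<and> F ((2 * b\<^sup>2 / a\<^sup>2) *\<^sub>R mat 1) = 1 \<and>
        (\<forall>x. u x = (a / (1 + b\<^sup>2 * (norm (x - xbar))\<^sup>2)) powr ((n - 2) / 2))))"
proof -
  define k where "k = (n - 2) / 2"
  define a where "a = - 1 / k"
  define q where "q = k * ((n + 2) / (n - 2) - p)"
  define v where "v = (\<lambda>x. u x powr a)"
  have n3: "n \<ge> 3" using dim by (simp add: n_def)
  have k: "k > 0" "n = 2 * k + 2" using n3 by (simp_all add: k_def field_simps)
  have a2: "a = - 2 / (real CARD('n) - 2)" using n3 by (simp add: a_def k_def n_def)
  have q: "q \<ge> 0" using k p_le by (simp add: q_def)
  have Usym: "U \<subseteq> symmetric_mats" using U_open openin_imp_subset by blast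
  have "hessian u x \<in> symmetric_mats" for x
    by (rule conformal_hessian_symmetric[OF dim u_pos subsetD[OF Usym u_adm]])
  then have Ju: "has_jet u (gradient u) (hessian u) UNIV" using C2_jet[OF u_C2] by blast
  define G where "G = (\<lambda>x. (a * u x powr (a - 1)) *\<^sub>R gradient u x)"
  define H where "H = (\<lambda>x. (a * u x powr (a - 1)) *\<^sub>R hessian u x
     + (a * (a - 1) * u x powr (a - 2)) *\<^sub>R tensor (gradient u x) (gradient u x))"
  have Jv: "has_jet v G H UNIV" unfolding v_def G_def H_def by (rule has_jet_powr[OF Ju u_pos])
  have A: "schouten (v x) (G x) (H x) = conformal_hessian u x" for x
    unfolding v_def G_def H_def by (rule conformal_hessian_schouten[symmetric, OF dim u_pos a2])
  have vq: "v x powr q = u x powr (p - (n + 2) / (n - 2))" for x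
  proof -
    have "a * q = p - (n + 2) / (n - 2)" using k(1) by (simp add: a_def q_def)
    then show ?thesis by (simp add: v_def powr_powr)
  qed
  interpret superharmonic_solution U F v G H q k u "gradient u" "hessian u"
  proof unfold_locales
    show "mat 1 \<bullet> hessian u x \<le> 0" for x
      using u_superharmonic by (simp add: trace_eq superharmonic_def laplacian_def hessian_def)
    show "0 < v x" for x using u_pos[of x] by (simp add: v_def)
  qed (use assms k q Jv A Ju vq in \<open>auto simp: v_def a_def n_def\<close>)
  have uv: "u x = v x powr (- k)" for x
    using u_pos[of x] k(1) by (simp add: v_def a_def powr_powr)
  consider c where "\<And>x. v x = c"
    | xbar \<beta> d where "q = 0" "0 < \<beta>" "0 < d" "(2 * \<beta> * d) *\<^sub>R mat 1 \<in> U" "F ((2 * \<beta> * d) *\<^sub>R mat 1) = 1"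
      "\<And>x. v x = \<beta> * (norm (x - xbar))\<^sup>2 + d"
    using classification by blast
  then show ?thesis
  proof cases
    case 1
    then have "\<forall>x. u x = c powr (- k)" using uv by simp
    then show ?thesis by (intro disjI1 exI)
  next
    case 2
    have pc: "p = (n + 2) / (n - 2)" using 2(1) k(1) by (simp add: q_def)
    define a' where "a' = 1 / d"
    define b where "b = sqrt (\<beta> / d)"
    have ab: "a' > 0" "b > 0" "b\<^sup>2 = \<beta> / d" using 2 by (auto simp: a'_def b_def)
    have c: "2 * b\<^sup>2 / a'\<^sup>2 = 2 * \<beta> * d" using 2 ab by (simp add: a'_def power2_eq_square field_simps)
    have "u x = (a' / (1 + b\<^sup>2 * (norm (x - xbar))\<^sup>2)) powr ((n - 2) / 2)" for x
    proof -
      have "1 + b\<^sup>2 * (norm (x - xbar))\<^sup>2 = v x / d" using 2(3) ab 2(6)[of x] by (simp add: field_simps)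
      then have "a' / (1 + b\<^sup>2 * (norm (x - xbar))\<^sup>2) = inverse (v x)"
        using 2(3) pos[of x] by (simp add: a'_def field_simps)
      then show ?thesis using uv[of x] pos[of x]
        by (simp add: k_def inverse_powr powr_minus)
    qed
    then show ?thesis using pc ab(1,2) 2(4,5) unfolding c[symmetric] by blast
  qed
qed

end
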